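(* Let $A$ be a unital, semisimple and regular abelian operator algebra with the total reduction property. Then $A\cong C(\Phi_A)$, where $\Phi_A$ is the maximal ideal space of $A$ and $\cong$ denotes isomorphism of Banach algebras (bicontinuous algebra isomorphism).
   Context: An operator algebra is a complex Banach algebra that is isomorphic, via a bicontinuous algebra isomorphism, to a norm-closed (not necessarily self-adjoint) subalgebra of $\mathcal B(H)$ for some Hilbert space $H$. A representation of $A$ on a Hilbert space $L$ is a continuous algebra homomorphism $\theta:A\to\mathcal B(L)$ (not required to be unital). $A$ has the total reduction property if for every representation $\theta:A\to\mathcal B(L)$ on a Hilbert space $L$ and every norm-closed $\theta(A)$-invariant subspace $V\subseteq L$ there is a norm-closed $\theta(A)$-invariant subspace $W\subseteq L$ with $L=V\oplus W$ (not necessarily orthogonal). For a unital abelian Banach algebra $A$, $\Phi_A$ is the set of maximal ideals of $A$, identified with the nonzero homomorphisms $A\to\mathbb C$ and equipped with the relative weak* topology from $A^*$; it is compact Hausdorff. $A$ is semisimple if the Gelfand transform $A\to C(\Phi_A)$ is injective. The hull-kernel topology on $\Phi_A$ is defined by letting the closure of $E\subseteq\Phi_A$ be $\{\omega\in\Phi_A:\omega(a)=0\text{ whenever }a\in A\text{ satisfies }\eta(a)=0\ \forall \eta\in E\}$. $A$ is regular if the hull-kernel topology and the weak* topology on $\Phi_A$ coincide. *)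

theory Defs
  imports "HOL-Analysis.Analysis"
begin

section \<open>Complex Banach algebras\<close>

text \<open>No unit is part of the structure, and \<open>norm e = 1\<close> is not required of a unit \<open>e\<close>;
  the zero algebra is included.\<close>

class complex_banach_algebra = real_normed_algebra + banach +
  fixes scaleC :: "complex \<Rightarrow> 'a \<Rightarrow> 'a"
  assumes scaleC_add_right: "scaleC c (x + y) = scaleC c x + scaleC c y"
    and scaleC_add_left: "scaleC (c + d) x = scaleC c x + scaleC d x"
    and scaleC_scaleC: "scaleC c (scaleC d x) = scaleC (c * d) x"
    and scaleC_of_real: "scaleC (complex_of_real r) x = scaleR r x"
    and norm_scaleC: "norm (scaleC c x) = cmod c * norm x"
    and mult_scaleC_left: "scaleC c x * y = scaleC c (x * y)"
    and mult_scaleC_right: "x * scaleC c y = scaleC c (x * y)"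

definition unital_algebra :: "'a::complex_banach_algebra itself \<Rightarrow> bool" where
  "unital_algebra A \<longleftrightarrow> (\<exists>e::'a. \<forall>x. e * x = x \<and> x * e = x)"


section \<open>Hilbert spaces\<close>

text \<open>Hilbert spaces are structures with an explicit carrier, so that they can be quantified over
  inside a formula. The inner product is linear in its first argument.\<close>

record 'v hilbert =
  hcarrier :: "'v set"
  hzero :: 'v
  hadd :: "'v \<Rightarrow> 'v \<Rightarrow> 'v"
  hscale :: "complex \<Rightarrow> 'v \<Rightarrow> 'v"
  hinner :: "'v \<Rightarrow> 'v \<Rightarrow> complex"

definition hdiff :: "'v hilbert \<Rightarrow> 'v \<Rightarrow> 'v \<Rightarrow> 'v" where
  "hdiff H x y = hadd H x (hscale H (-1) y)"

definition hnorm :: "'v hilbert \<Rightarrow> 'v \<Rightarrow> real" where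
  "hnorm H x = sqrt (Re (hinner H x x))"

text \<open>The value 0 off the carrier is there because \<^locale>\<open>Metric_space\<close> demands symmetry and
  nonnegativity of the distance function on the whole type.\<close>

definition hdist :: "'v hilbert \<Rightarrow> 'v \<Rightarrow> 'v \<Rightarrow> real" where
  "hdist H x y = (if x \<in> hcarrier H \<and> y \<in> hcarrier H then hnorm H (hdiff H x y) else 0)"

definition norm_topology :: "'v hilbert \<Rightarrow> 'v topology" where
  "norm_topology H = Metric_space.mtopology (hcarrier H) (hdist H)"

locale pre_hilbert_space =
  fixes H :: "'v hilbert"
  assumes zero_closed: "hzero H \<in> hcarrier H"
    and add_closed: "\<lbrakk>x \<in> hcarrier H; y \<in> hcarrier H\<rbrakk> \<Longrightarrow> hadd H x y \<in> hcarrier H"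
    and scale_closed: "x \<in> hcarrier H \<Longrightarrow> hscale H c x \<in> hcarrier H"
    and add_assoc: "\<lbrakk>x \<in> hcarrier H; y \<in> hcarrier H; z \<in> hcarrier H\<rbrakk>
          \<Longrightarrow> hadd H (hadd H x y) z = hadd H x (hadd H y z)"
    and add_commute: "\<lbrakk>x \<in> hcarrier H; y \<in> hcarrier H\<rbrakk> \<Longrightarrow> hadd H x y = hadd H y x"
    and add_zero: "x \<in> hcarrier H \<Longrightarrow> hadd H x (hzero H) = x"
    and diff_self: "x \<in> hcarrier H \<Longrightarrow> hdiff H x x = hzero H"
    and scale_add_right: "\<lbrakk>x \<in> hcarrier H; y \<in> hcarrier H\<rbrakk>
          \<Longrightarrow> hscale H c (hadd H x y) = hadd H (hscale H c x) (hscale H c y)"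
    and scale_add_left: "x \<in> hcarrier H
          \<Longrightarrow> hscale H (c + d) x = hadd H (hscale H c x) (hscale H d x)"
    and scale_scale: "x \<in> hcarrier H \<Longrightarrow> hscale H c (hscale H d x) = hscale H (c * d) x"
    and scale_one: "x \<in> hcarrier H \<Longrightarrow> hscale H 1 x = x"
    and inner_commute: "\<lbrakk>x \<in> hcarrier H; y \<in> hcarrier H\<rbrakk>
          \<Longrightarrow> hinner H x y = cnj (hinner H y x)"
    and inner_add_left: "\<lbrakk>x \<in> hcarrier H; y \<in> hcarrier H; z \<in> hcarrier H\<rbrakk>
          \<Longrightarrow> hinner H (hadd H x y) z = hinner H x z + hinner H y z"
    and inner_scale_left: "\<lbrakk>x \<in> hcarrier H; y \<in> hcarrier H\<rbrakk>
          \<Longrightarrow> hinner H (hscale H c x) y = c * hinner H x y"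
    and inner_pos: "\<lbrakk>x \<in> hcarrier H; x \<noteq> hzero H\<rbrakk> \<Longrightarrow> 0 < Re (hinner H x x)"

locale hilbert_space = pre_hilbert_space +
  assumes complete: "Metric_space.mcomplete (hcarrier H) (hdist H)"

definition closed_subspace :: "'v hilbert \<Rightarrow> 'v set \<Rightarrow> bool" where
  "closed_subspace H V \<longleftrightarrow>
     V \<subseteq> hcarrier H \<and> hzero H \<in> V \<and>
     (\<forall>x\<in>V. \<forall>y\<in>V. hadd H x y \<in> V) \<and> (\<forall>c. \<forall>x\<in>V. hscale H c x \<in> V) \<and>
     closedin (norm_topology H) V"

definition direct_sum :: "'v hilbert \<Rightarrow> 'v set \<Rightarrow> 'v set \<Rightarrow> bool" where
  "direct_sum H V W \<longleftrightarrow>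
     V \<inter> W = {hzero H} \<and> hcarrier H = {hadd H v w | v w. v \<in> V \<and> w \<in> W}"

text \<open>Operators are extensional functions on the carrier, so
  that equality of operators is equality of functions.\<close>

definition bounded_operators :: "'v hilbert \<Rightarrow> ('v \<Rightarrow> 'v) set" where
  "bounded_operators H =
     {T \<in> hcarrier H \<rightarrow>\<^sub>E hcarrier H.
        (\<forall>x\<in>hcarrier H. \<forall>y\<in>hcarrier H. T (hadd H x y) = hadd H (T x) (T y)) \<and>
        (\<forall>c. \<forall>x\<in>hcarrier H. T (hscale H c x) = hscale H c (T x)) \<and>
        (\<exists>K. \<forall>x\<in>hcarrier H. hnorm H (T x) \<le> K * hnorm H x)}"

definition operator_dist :: "'v hilbert \<Rightarrow> ('v \<Rightarrow> 'v) \<Rightarrow> ('v \<Rightarrow> 'v) \<Rightarrow> real" where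
  "operator_dist H S T =
     (if S \<in> bounded_operators H \<and> T \<in> bounded_operators H
      then SUP x \<in> {x \<in> hcarrier H. hnorm H x \<le> 1}. hnorm H (hdiff H (S x) (T x))
      else 0)"

definition operator_norm_topology :: "'v hilbert \<Rightarrow> ('v \<Rightarrow> 'v) topology" where
  "operator_norm_topology H = Metric_space.mtopology (bounded_operators H) (operator_dist H)"


section \<open>Norm and operator norm give metrics\<close>

context pre_hilbert_space
begin

abbreviation (input) "C \<equiv> hcarrier H"

lemma diff_closed: "\<lbrakk>x \<in> C; y \<in> C\<rbrakk> \<Longrightarrow> hdiff H x y \<in> C"
  by (simp add: hdiff_def add_closed scale_closed)

lemma inner_add_right:
  assumes "x \<in> C" "y \<in> C" "z \<in> C"
  shows "hinner H x (hadd H y z) = hinner H x y + hinner H x z"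
  by (metis assms add_closed complex_cnj_add inner_add_left inner_commute)

lemma inner_scale_right:
  assumes "x \<in> C" "y \<in> C"
  shows "hinner H x (hscale H c y) = cnj c * hinner H x y"
  by (metis assms complex_cnj_mult inner_commute inner_scale_left scale_closed)

lemma scale_zero_left:
  assumes "x \<in> C" shows "hscale H 0 x = hzero H"
  using scale_add_left[OF assms, of 1 "-1"] scale_one[OF assms] diff_self[OF assms]
  by (simp add: hdiff_def)

lemma inner_zero_left:
  assumes "x \<in> C" shows "hinner H (hzero H) x = 0"
  using inner_scale_left[OF zero_closed assms, of 0] scale_zero_left[OF zero_closed] by simp

lemma inner_nonneg: "x \<in> C \<Longrightarrow> 0 \<le> Re (hinner H x x)"
  by (cases "x = hzero H") (auto simp: inner_zero_left zero_closed dest: inner_pos)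

lemma hnorm_nonneg: "x \<in> C \<Longrightarrow> 0 \<le> hnorm H x"
  by (simp add: hnorm_def inner_nonneg)

lemma hnorm_power2: "x \<in> C \<Longrightarrow> (hnorm H x)\<^sup>2 = Re (hinner H x x)"
  by (simp add: hnorm_def inner_nonneg)

lemma hnorm_eq_0: "x \<in> C \<Longrightarrow> hnorm H x = 0 \<longleftrightarrow> x = hzero H"
  by (metis hnorm_def inner_pos inner_zero_left order_less_irrefl real_sqrt_eq_zero_cancel_iff
      zero_closed zero_complex.sel(1))

lemma hnorm_scale:
  assumes "x \<in> C" shows "hnorm H (hscale H c x) = cmod c * hnorm H x"
proof -
  have "hinner H (hscale H c x) (hscale H c x) = of_real ((cmod c)\<^sup>2) * hinner H x x"
    using assms
    by (simp add: inner_scale_left inner_scale_right scale_closed complex_norm_square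
        mult.assoc [symmetric] mult.commute [of "cnj c"] del: of_real_power)
  then have "Re (hinner H (hscale H c x) (hscale H c x)) = (cmod c)\<^sup>2 * Re (hinner H x x)"
    by simp
  then show ?thesis by (simp add: hnorm_def real_sqrt_mult)
qed

lemma Re_inner_le:
  assumes x: "x \<in> C" and y: "y \<in> C"
  shows "Re (hinner H x y) \<le> hnorm H x * hnorm H y"
proof (cases "x = hzero H \<or> y = hzero H")
  case True
  then show ?thesis
    using inner_zero_left[OF y] inner_zero_left[OF x] inner_commute[OF x y] hnorm_nonneg x y
    by auto
next
  case False
  define a b where "a = hnorm H y" and "b = hnorm H x"
  have pos: "a * b > 0"
    using False x y hnorm_nonneg hnorm_eq_0 by (simp add: a_def b_def less_le)
  let ?u = "hscale H (of_real a) x" and ?v = "hscale H (of_real (-b)) y"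
  have C: "?u \<in> C" "?v \<in> C" using x y scale_closed by auto
  have "0 \<le> Re (hinner H (hadd H ?u ?v) (hadd H ?u ?v))"
    by (intro inner_nonneg add_closed C)
  also have "\<dots> = a\<^sup>2 * Re (hinner H x x) - 2 * (a * b) * Re (hinner H x y)
                  + b\<^sup>2 * Re (hinner H y y)"
    using x y C inner_commute[OF x y]
    by (simp add: inner_add_left inner_add_right add_closed inner_scale_left inner_scale_right
        scale_closed algebra_simps power2_eq_square)
  also have "\<dots> = 2 * (a * b) * (a * b) - 2 * (a * b) * Re (hinner H x y)"
    using hnorm_power2[OF x] hnorm_power2[OF y]
    by (simp add: a_def b_def power2_eq_square algebra_simps)
  finally have "2 * (a * b) * Re (hinner H x y) \<le> 2 * (a * b) * (a * b)" by simp
  then have "Re (hinner H x y) \<le> a * b"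
    by (rule mult_left_le_imp_le) (use pos in simp)
  then show ?thesis by (simp add: a_def b_def mult.commute)
qed

lemma hnorm_triangle:
  assumes x: "x \<in> C" and y: "y \<in> C"
  shows "hnorm H (hadd H x y) \<le> hnorm H x + hnorm H y"
proof (rule power2_le_imp_le)
  have "(hnorm H (hadd H x y))\<^sup>2 = (hnorm H x)\<^sup>2 + 2 * Re (hinner H x y) + (hnorm H y)\<^sup>2"
    using x y inner_commute[OF x y]
    by (simp add: hnorm_power2 add_closed inner_add_left inner_add_right)
  also have "\<dots> \<le> (hnorm H x + hnorm H y)\<^sup>2"
    using Re_inner_le[OF x y] by (simp add: power2_sum)
  finally show "(hnorm H (hadd H x y))\<^sup>2 \<le> (hnorm H x + hnorm H y)\<^sup>2" .
  show "0 \<le> hnorm H x + hnorm H y" using x y hnorm_nonneg by simp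
qed

lemma diff_add_diff:
  assumes "x \<in> C" "y \<in> C" "z \<in> C"
  shows "hadd H (hdiff H x y) (hdiff H y z) = hdiff H x z"
proof -
  have "hadd H (hscale H (-1) y) (hadd H y (hscale H (-1) z))
      = hadd H (hadd H y (hscale H (-1) y)) (hscale H (-1) z)"
    using assms by (metis add_assoc add_commute scale_closed)
  also have "\<dots> = hscale H (-1) z"
    using diff_self[OF assms(2)] assms add_zero add_commute zero_closed scale_closed
    by (metis hdiff_def)
  finally show ?thesis
    using assms by (simp add: hdiff_def add_assoc add_closed scale_closed)
qed

lemma diff_commute:
  assumes "x \<in> C" "y \<in> C" shows "hdiff H x y = hscale H (-1) (hdiff H y x)"
  using assms
  by (simp add: hdiff_def scale_add_right scale_closed scale_scale scale_one add_commute)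

lemma hnorm_diff_commute: "\<lbrakk>x \<in> C; y \<in> C\<rbrakk> \<Longrightarrow> hnorm H (hdiff H x y) = hnorm H (hdiff H y x)"
  by (subst diff_commute) (simp_all add: hnorm_scale diff_closed)

lemma hnorm_diff_triangle:
  assumes "x \<in> C" "y \<in> C" "z \<in> C"
  shows "hnorm H (hdiff H x z) \<le> hnorm H (hdiff H x y) + hnorm H (hdiff H y z)"
  using hnorm_triangle[of "hdiff H x y" "hdiff H y z"] assms
  by (simp add: diff_closed diff_add_diff)

lemma hdiff_eq_zero:
  assumes "x \<in> C" "y \<in> C" shows "hdiff H x y = hzero H \<longleftrightarrow> x = y"
proof
  assume *: "hdiff H x y = hzero H"
  have "x = hadd H x (hadd H (hscale H (-1) y) y)"
    using assms diff_self[of y] add_zero[of x] add_commute[of "hscale H (-1) y" y] scale_closed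
    by (metis hdiff_def)
  also have "\<dots> = hadd H (hdiff H x y) y"
    using assms by (simp add: hdiff_def add_assoc scale_closed)
  finally show "x = y"
    using * assms(2) add_commute[OF zero_closed] add_zero by simp
qed (use assms diff_self in simp)

lemma Metric_space_hdist: "Metric_space (hcarrier H) (hdist H)"
proof
  fix x y z
  show "0 \<le> hdist H x y" by (simp add: hdist_def hnorm_nonneg diff_closed)
  show "hdist H x y = hdist H y x" by (simp add: hdist_def hnorm_diff_commute)
  assume C: "x \<in> C" "y \<in> C"
  then show "hdist H x y = 0 \<longleftrightarrow> x = y"
    by (simp add: hdist_def hnorm_eq_0 diff_closed hdiff_eq_zero)
  assume "z \<in> C"
  with C show "hdist H x z \<le> hdist H x y + hdist H y z"
    by (simp add: hdist_def hnorm_diff_triangle)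
qed

lemma zero_in_unit_ball: "hzero H \<in> {x \<in> C. hnorm H x \<le> 1}"
  by (simp add: zero_closed hnorm_eq_0[THEN iffD2])

lemma bdd_above_operator_dist:
  assumes S: "S \<in> bounded_operators H" and T: "T \<in> bounded_operators H"
  shows "bdd_above ((\<lambda>x. hnorm H (hdiff H (S x) (T x))) ` {x \<in> C. hnorm H x \<le> 1})"
proof -
  have SC: "S x \<in> C" and TC: "T x \<in> C" if "x \<in> C" for x
    using S T that by (auto simp: bounded_operators_def)
  obtain K where K: "\<And>x. x \<in> C \<Longrightarrow> hnorm H (S x) \<le> K * hnorm H x"
    using S unfolding bounded_operators_def by blast
  obtain L where L: "\<And>x. x \<in> C \<Longrightarrow> hnorm H (T x) \<le> L * hnorm H x"
    using T unfolding bounded_operators_def by blast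
  have "hnorm H (hdiff H (S x) (T x)) \<le> \<bar>K\<bar> + \<bar>L\<bar>" if x: "x \<in> C" "hnorm H x \<le> 1" for x
  proof -
    have "hnorm H (hdiff H (S x) (T x)) \<le> hnorm H (S x) + hnorm H (T x)"
      using hnorm_triangle[of "S x" "hscale H (-1) (T x)"] SC TC x
      by (simp add: hdiff_def hnorm_scale scale_closed)
    moreover have "M * hnorm H x \<le> \<bar>M\<bar>" for M
      using mult_mono[of M "\<bar>M\<bar>" "hnorm H x" 1] x hnorm_nonneg by simp
    ultimately show ?thesis using K[OF x(1)] L[OF x(1)] by (meson add_mono order_trans)
  qed
  then show ?thesis by (intro bdd_aboveI2) auto
qed

lemma bounded_operators_closed: "\<lbrakk>T \<in> bounded_operators H; x \<in> C\<rbrakk> \<Longrightarrow> T x \<in> C"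
  by (auto simp: bounded_operators_def)

lemma operator_dist_upper:
  assumes S: "S \<in> bounded_operators H" and T: "T \<in> bounded_operators H"
    and x: "x \<in> C" "hnorm H x \<le> 1"
  shows "hnorm H (hdiff H (S x) (T x)) \<le> operator_dist H S T"
proof -
  have "hnorm H (hdiff H (S x) (T x))
      \<le> (SUP x\<in>{x \<in> C. hnorm H x \<le> 1}. hnorm H (hdiff H (S x) (T x)))"
    by (rule cSUP_upper[OF _ bdd_above_operator_dist[OF S T]]) (use x in simp)
  also have "\<dots> = operator_dist H S T"
    using S T by (simp only: operator_dist_def if_True simp_thms)
  finally show ?thesis .
qed

lemma operator_dist_least:
  assumes S: "S \<in> bounded_operators H" and T: "T \<in> bounded_operators H"
    and le: "\<And>x. \<lbrakk>x \<in> C; hnorm H x \<le> 1\<rbrakk> \<Longrightarrow> hnorm H (hdiff H (S x) (T x)) \<le> K"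
  shows "operator_dist H S T \<le> K"
proof -
  have "operator_dist H S T
      = (SUP x\<in>{x \<in> C. hnorm H x \<le> 1}. hnorm H (hdiff H (S x) (T x)))"
    using S T by (simp only: operator_dist_def if_True simp_thms)
  also have "\<dots> \<le> K"
  proof (rule cSUP_least)
    show "{x \<in> C. hnorm H x \<le> 1} \<noteq> {}" using zero_in_unit_ball by blast
  qed (use le in simp)
  finally show ?thesis .
qed

lemma operator_dist_nonneg: "0 \<le> operator_dist H S T"
proof (cases "S \<in> bounded_operators H \<and> T \<in> bounded_operators H")
  case True
  then have "0 \<le> hnorm H (hdiff H (S (hzero H)) (T (hzero H)))"
    by (simp add: hnorm_nonneg diff_closed bounded_operators_closed zero_closed)
  also have "\<dots> \<le> operator_dist H S T"
    using True zero_in_unit_ball by (intro operator_dist_upper) auto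
  finally show ?thesis .
next
  case False
  then show ?thesis by (simp only: operator_dist_def if_False order_refl)
qed

lemma operator_dist_le_commute: "operator_dist H S T \<le> operator_dist H T S"
proof (cases "S \<in> bounded_operators H \<and> T \<in> bounded_operators H")
  case True
  then have S: "S \<in> bounded_operators H" and T: "T \<in> bounded_operators H" by auto
  show ?thesis
  proof (rule operator_dist_least[OF S T])
    fix x assume x: "x \<in> C" "hnorm H x \<le> 1"
    show "hnorm H (hdiff H (S x) (T x)) \<le> operator_dist H T S"
      using operator_dist_upper[OF T S x] hnorm_diff_commute[of "S x" "T x"]
        bounded_operators_closed[OF S x(1)] bounded_operators_closed[OF T x(1)] by simp
  qed
next
  case False
  then have "operator_dist H S T = 0" by (simp only: operator_dist_def if_False)
  then show ?thesis by (simp add: operator_dist_nonneg)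
qed

lemma operator_dist_zero:
  assumes S: "S \<in> bounded_operators H" and T: "T \<in> bounded_operators H"
  shows "operator_dist H S T = 0 \<longleftrightarrow> S = T"
proof
  assume 0: "operator_dist H S T = 0"
  have "S x = T x" if x: "x \<in> C" for x
  proof -
    define r where "r = 1 / (1 + hnorm H x)"
    define y where "y = hscale H (of_real r) x"
    have "r > 0" using hnorm_nonneg[OF x] by (simp add: r_def)
    moreover have "hnorm H y = \<bar>r\<bar> * hnorm H x" by (simp add: y_def hnorm_scale x)
    ultimately have r: "r > 0" "hnorm H y \<le> 1"
      using hnorm_nonneg[OF x] by (simp_all add: r_def)
    have y: "y \<in> C" using x scale_closed by (simp add: y_def)
    have SyC: "S y \<in> C" "T y \<in> C" using y bounded_operators_closed S T by auto
    have "hnorm H (hdiff H (S y) (T y)) = 0"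
      using operator_dist_upper[OF S T y r(2)] 0 hnorm_nonneg[OF diff_closed[OF SyC]] by linarith
    then have "S y = T y"
      using hnorm_eq_0[OF diff_closed[OF SyC]] hdiff_eq_zero[OF SyC] by simp
    moreover have "S y = hscale H (of_real r) (S x)" "T y = hscale H (of_real r) (T x)"
      using S T x unfolding y_def bounded_operators_def by blast+
    ultimately have "hscale H (of_real (1/r) * of_real r) (S x)
                   = hscale H (of_real (1/r) * of_real r) (T x)"
      using scale_scale[OF bounded_operators_closed[OF S x]]
        scale_scale[OF bounded_operators_closed[OF T x]] by metis
    then show ?thesis
      using r scale_one[OF bounded_operators_closed[OF S x]]
        scale_one[OF bounded_operators_closed[OF T x]] by simp
  qed
  moreover have "S \<in> extensional C" "T \<in> extensional C"
    using S T by (auto simp: bounded_operators_def PiE_def)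
  ultimately show "S = T" by (intro extensionalityI[of S C T]) auto
next
  assume eq: "S = T"
  have "operator_dist H S S \<le> 0"
  proof (rule operator_dist_least[OF S S])
    fix x assume "x \<in> C"
    then show "hnorm H (hdiff H (S x) (S x)) \<le> 0"
      using diff_self bounded_operators_closed[OF S] hnorm_eq_0[OF zero_closed] by simp
  qed
  then show "operator_dist H S T = 0"
    using operator_dist_nonneg[of S S] eq by simp
qed

lemma Metric_space_operator_dist: "Metric_space (bounded_operators H) (operator_dist H)"
proof (rule Metric_space.intro)
  show "operator_dist H S T = operator_dist H T S" for S T
    by (rule antisym) (rule operator_dist_le_commute)+
  show "operator_dist H S U \<le> operator_dist H S T + operator_dist H T U"
    if S: "S \<in> bounded_operators H" and T: "T \<in> bounded_operators H"
      and U: "U \<in> bounded_operators H" for S T U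
  proof (rule operator_dist_least[OF S U])
    fix x assume x: "x \<in> C" "hnorm H x \<le> 1"
    have "hnorm H (hdiff H (S x) (U x))
        \<le> hnorm H (hdiff H (S x) (T x)) + hnorm H (hdiff H (T x) (U x))"
      using bounded_operators_closed[OF _ x(1)] S T U by (intro hnorm_diff_triangle) simp_all
    then show "hnorm H (hdiff H (S x) (U x)) \<le> operator_dist H S T + operator_dist H T U"
      using operator_dist_upper[OF S T x] operator_dist_upper[OF T U x] by linarith
  qed
qed (simp_all only: operator_dist_nonneg operator_dist_zero)

end


section \<open>Representations, operator algebras and the total reduction property\<close>

definition representation ::
    "'v hilbert \<Rightarrow> ('a::complex_banach_algebra \<Rightarrow> 'v \<Rightarrow> 'v) \<Rightarrow> bool" where
  "representation L \<theta> \<longleftrightarrow>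
     (\<forall>a. \<theta> a \<in> bounded_operators L) \<and>
     (\<forall>a b. \<forall>x\<in>hcarrier L. \<theta> (a + b) x = hadd L (\<theta> a x) (\<theta> b x)) \<and>
     (\<forall>c a. \<forall>x\<in>hcarrier L. \<theta> (scaleC c a) x = hscale L c (\<theta> a x)) \<and>
     (\<forall>a b. \<forall>x\<in>hcarrier L. \<theta> (a * b) x = \<theta> a (\<theta> b x)) \<and>
     continuous_map euclidean (operator_norm_topology L) \<theta>"

text \<open>The closed subalgebra is the range of \<open>\<theta>\<close>, and \<^const>\<open>embedding_map\<close> says that \<open>\<theta>\<close> is a
  homeomorphism onto it.\<close>

definition operator_algebra :: "'a::complex_banach_algebra itself \<Rightarrow> 'v itself \<Rightarrow> bool" where
  "operator_algebra A U \<longleftrightarrow>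
     (\<exists>(H :: 'v hilbert) (\<theta> :: 'a \<Rightarrow> 'v \<Rightarrow> 'v).
        hilbert_space H \<and> representation H \<theta> \<and>
        closedin (operator_norm_topology H) (range \<theta>) \<and>
        embedding_map euclidean (operator_norm_topology H) \<theta>)"

definition invariant_subspace ::
    "'v hilbert \<Rightarrow> ('a::complex_banach_algebra \<Rightarrow> 'v \<Rightarrow> 'v) \<Rightarrow> 'v set \<Rightarrow> bool" where
  "invariant_subspace L \<theta> V \<longleftrightarrow> closed_subspace L V \<and> (\<forall>a. \<forall>x\<in>V. \<theta> a x \<in> V)"

text \<open>HOL cannot quantify over all types inside a formula, so \<open>L\<close> ranges over the Hilbert spaces
  whose vectors belong to the type \<open>'u\<close>. If the cardinality \<open>\<kappa>\<close> of \<open>'u\<close> satisfies \<open>\<kappa> \<ge> \<bar>A\<bar>\<close>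
  and equals its own countable power, as for \<open>(nat + 'a + 'h) set set\<close>, this is equivalent to the
  property for all Hilbert spaces. Indeed, let \<open>V \<subseteq> L\<close> be closed and invariant, with \<open>L\<close> of
  any size, and let \<open>L'\<close> range over the closed invariant subspaces of \<open>L\<close> with at most \<open>\<kappa>\<close> elements.
  There are equivariant projections \<open>L' \<rightarrow> V \<inter> L'\<close> with a common norm bound, since otherwise a
  countable Hilbert sum of such \<open>L'\<close> would violate the property; and a weak limit of these
  projections over the directed family of all \<open>L'\<close> is an equivariant projection \<open>L \<rightarrow> V\<close>.\<close>

definition total_reduction_property ::
    "'a::complex_banach_algebra itself \<Rightarrow> 'u itself \<Rightarrow> bool" where
  "total_reduction_property A U \<longleftrightarrow>
     (\<forall>(L :: 'u hilbert) (\<theta> :: 'a \<Rightarrow> 'u \<Rightarrow> 'u) V.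
        hilbert_space L \<longrightarrow> representation L \<theta> \<longrightarrow> invariant_subspace L \<theta> V \<longrightarrow>
        (\<exists>W. invariant_subspace L \<theta> W \<and> direct_sum L V W))"


section \<open>Gelfand theory\<close>

definition characters :: "('a::complex_banach_algebra \<Rightarrow> complex) set" where
  "characters = {\<phi>. (\<forall>x y. \<phi> (x + y) = \<phi> x + \<phi> y) \<and> (\<forall>c x. \<phi> (scaleC c x) = c * \<phi> x) \<and>
                    (\<forall>x y. \<phi> (x * y) = \<phi> x * \<phi> y) \<and> (\<exists>x. \<phi> x \<noteq> 0)}"

text \<open>Characters of a Banach algebra are automatically bounded, and on the dual space the weak*
  topology is the topology of pointwise convergence.\<close>

definition maximal_ideal_space :: "('a::complex_banach_algebra \<Rightarrow> complex) topology" where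
  "maximal_ideal_space = subtopology (product_topology (\<lambda>_. euclidean) UNIV) characters"

definition gelfand_transform ::
    "'a::complex_banach_algebra \<Rightarrow> ('a \<Rightarrow> complex) \<Rightarrow> complex" where
  "gelfand_transform a = (\<lambda>\<phi>\<in>characters. \<phi> a)"

definition semisimple_algebra :: "'a::complex_banach_algebra itself \<Rightarrow> bool" where
  "semisimple_algebra A \<longleftrightarrow> inj (gelfand_transform :: 'a \<Rightarrow> ('a \<Rightarrow> complex) \<Rightarrow> complex)"

definition hull_kernel_closure ::
    "('a::complex_banach_algebra \<Rightarrow> complex) set \<Rightarrow> ('a \<Rightarrow> complex) set" where
  "hull_kernel_closure E = {\<omega> \<in> characters. \<forall>a. (\<forall>\<eta>\<in>E. \<eta> a = 0) \<longrightarrow> \<omega> a = 0}"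

definition hull_kernel_topology :: "('a::complex_banach_algebra \<Rightarrow> complex) topology" where
  "hull_kernel_topology =
     topology (\<lambda>U. U \<subseteq> characters \<and> hull_kernel_closure (characters - U) = characters - U)"

definition regular_algebra :: "'a::complex_banach_algebra itself \<Rightarrow> bool" where
  "regular_algebra A \<longleftrightarrow>
     (hull_kernel_topology :: ('a \<Rightarrow> complex) topology) = maximal_ideal_space"

lemma hull_kernel_closure_superset: "E \<subseteq> characters \<Longrightarrow> E \<subseteq> hull_kernel_closure E"
  by (auto simp: hull_kernel_closure_def)

lemma hull_kernel_closure_mono: "E \<subseteq> F \<Longrightarrow> hull_kernel_closure E \<subseteq> hull_kernel_closure F"
  by (auto simp: hull_kernel_closure_def)

lemma hull_kernel_closure_subset: "hull_kernel_closure E \<subseteq> characters"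
  by (auto simp: hull_kernel_closure_def)

lemma hull_kernel_closure_idem:
  "hull_kernel_closure (hull_kernel_closure E) = hull_kernel_closure E"
  by (auto simp: hull_kernel_closure_def)

lemma hull_kernel_closure_empty: "hull_kernel_closure {} = {}"
  by (auto simp: hull_kernel_closure_def characters_def)

lemma hull_kernel_closure_Un:
  "hull_kernel_closure (E \<union> F) = hull_kernel_closure E \<union> hull_kernel_closure F"
    if EF: "E \<subseteq> characters" "F \<subseteq> characters"
proof
  show "hull_kernel_closure (E \<union> F) \<subseteq> hull_kernel_closure E \<union> hull_kernel_closure F"
  proof (rule subsetI, rule ccontr)
    fix \<omega> assume \<omega>: "\<omega> \<in> hull_kernel_closure (E \<union> F)"
      and n: "\<omega> \<notin> hull_kernel_closure E \<union> hull_kernel_closure F"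
    have ch: "\<omega> \<in> characters" using \<omega> by (simp add: hull_kernel_closure_def)
    obtain a b where a: "\<forall>\<eta>\<in>E. \<eta> a = 0" "\<omega> a \<noteq> 0" and b: "\<forall>\<eta>\<in>F. \<eta> b = 0" "\<omega> b \<noteq> 0"
      using n ch by (auto simp: hull_kernel_closure_def)
    have "\<forall>\<eta>\<in>E \<union> F. \<eta> (a * b) = 0"
      using a b EF by (auto simp: characters_def subset_iff)
    then have "\<omega> (a * b) = 0" using \<omega> by (simp add: hull_kernel_closure_def)
    then show False using a b ch by (simp add: characters_def)
  qed
qed (simp add: hull_kernel_closure_mono)

lemma istopology_hull_kernel:
  "istopology (\<lambda>U. U \<subseteq> characters \<and> hull_kernel_closure (characters - U) = characters - U)"
  unfolding istopology_def
proof (intro conjI allI impI)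
  fix S T :: "('a \<Rightarrow> complex) set"
  assume S: "S \<subseteq> characters \<and> hull_kernel_closure (characters - S) = characters - S"
    and T: "T \<subseteq> characters \<and> hull_kernel_closure (characters - T) = characters - T"
  then show "S \<inter> T \<subseteq> characters" by blast
  have "characters - S \<inter> T = (characters - S) \<union> (characters - T)" by blast
  then show "hull_kernel_closure (characters - S \<inter> T) = characters - S \<inter> T"
    using S T hull_kernel_closure_Un[of "characters - S" "characters - T"] by simp
next
  fix \<K> :: "('a \<Rightarrow> complex) set set"
  assume \<K>: "\<forall>K\<in>\<K>. K \<subseteq> characters \<and> hull_kernel_closure (characters - K) = characters - K"
  then show "\<Union>\<K> \<subseteq> characters" by blast
  show "hull_kernel_closure (characters - \<Union>\<K>) = characters - \<Union>\<K>"
  proof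
    have "hull_kernel_closure (characters - \<Union>\<K>) \<subseteq> characters - K" if "K \<in> \<K>" for K
      using hull_kernel_closure_mono[of "characters - \<Union>\<K>" "characters - K"] \<K> that by blast
    then show "hull_kernel_closure (characters - \<Union>\<K>) \<subseteq> characters - \<Union>\<K>"
      using hull_kernel_closure_subset by blast
  qed (simp add: hull_kernel_closure_superset)
qed

lemma openin_hull_kernel:
  "openin hull_kernel_topology U \<longleftrightarrow>
     U \<subseteq> characters \<and> hull_kernel_closure (characters - U) = characters - U"
  by (simp add: hull_kernel_topology_def topology_inverse'[OF istopology_hull_kernel])

lemma topspace_hull_kernel: "topspace hull_kernel_topology = characters"
proof
  show "characters \<subseteq> topspace hull_kernel_topology"
    by (rule openin_subset) (simp add: openin_hull_kernel hull_kernel_closure_empty)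
  show "topspace hull_kernel_topology \<subseteq> characters"
    using openin_topspace openin_hull_kernel by blast
qed

lemma closedin_hull_kernel:
  "closedin hull_kernel_topology E \<longleftrightarrow> E \<subseteq> characters \<and> hull_kernel_closure E = E"
  by (auto simp: closedin_def openin_hull_kernel topspace_hull_kernel double_diff)

lemma closure_of_hull_kernel:
  assumes "E \<subseteq> characters"
  shows "hull_kernel_topology closure_of E = hull_kernel_closure E"
proof (rule closure_of_unique)
  show "E \<subseteq> hull_kernel_closure E" by (rule hull_kernel_closure_superset[OF assms])
  show "closedin hull_kernel_topology (hull_kernel_closure E)"
    by (simp add: closedin_hull_kernel hull_kernel_closure_subset hull_kernel_closure_idem)
  fix T assume "E \<subseteq> T" "closedin hull_kernel_topology T"
  then show "hull_kernel_closure E \<subseteq> T"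
    using hull_kernel_closure_mono closedin_hull_kernel by metis
qed


section \<open>Isomorphism with an algebra of continuous functions\<close>

text \<open>\<^term>\<open>cfunspace X euclidean_metric\<close> is the space of bounded continuous functions on \<open>X\<close>
  (extensional, with the supremum metric); on a compact \<open>X\<close> this is \<open>C(X)\<close>.
  Bijectivity is part of \<^const>\<open>homeomorphic_map\<close>.\<close>

definition isomorphic_to_C :: "'a::complex_banach_algebra itself \<Rightarrow> 'x topology \<Rightarrow> bool" where
  "isomorphic_to_C A X \<longleftrightarrow>
     (\<exists>T :: 'a \<Rightarrow> 'x \<Rightarrow> complex.
        homeomorphic_map euclidean (mtopology_of (cfunspace X euclidean_metric)) T \<and>
        (\<forall>a b. \<forall>x\<in>topspace X. T (a + b) x = T a x + T b x) \<and>
        (\<forall>c a. \<forall>x\<in>topspace X. T (scaleC c a) x = c * T a x) \<and>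
        (\<forall>a b. \<forall>x\<in>topspace X. T (a * b) x = T a x * T b x))"

end

theory Submission
  imports Defs "HOL-Probability.Discrete_Topology" "HOL-Computational_Algebra.Polynomial"
    "HOL-Complex_Analysis.Cauchy_Integral_Formula"
begin

text \<open>It suffices to find a constant \<open>K\<close> such that any two disjoint closed sets \<open>E\<close>, \<open>F\<close> of
  characters are separated by some \<open>a\<close> with \<open>norm a \<le> K\<close>, vanishing on \<open>E\<close> and equal to \<open>1\<close> on
  \<open>F\<close>: combinations of such elements approximate every continuous function up to half of its
  norm, with control of their own norm (as in the work of Bade and Curtis), and iterating this
  solves \<open>\<phi> a = g \<phi>\<close> with a norm bound.

  Regularity and the existence of characters that annihilate a proper ideal give some separating
  element for each pair. Suppose that for each \<open>n\<close> there is a pair \<open>E n\<close>, \<open>F n\<close> all of whose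
  separating elements have norm greater than \<open>n\<close>. As these elements form a convex set \<open>S n\<close>, a
  minimax argument yields a mean, over unit vectors \<open>h\<close>, of the forms that send \<open>a\<close>, \<open>b\<close> to the
  inner product of \<open>a h\<close> and \<open>b h\<close>, whose value at \<open>a\<close>, \<open>a\<close> is at least a fixed multiple of
  \<open>n\<^sup>2\<close> for all \<open>a \<in> S n\<close>. Each such mean makes \<open>A\<close> a Hilbert module. In the Hilbert sum of
  these modules, the sequences whose \<open>n\<close>-th entry vanishes on \<open>E n\<close> have as closure a submodule,
  onto which the total reduction property gives a bounded module projection. It maps the unit
  in the \<open>n\<close>-th summand to a vector whose \<open>n\<close>-th component is a limit of elements of \<open>S n\<close>, which
  contradicts boundedness.\<close>

section \<open>Positive functionals on cones\<close>

text \<open>In the given representation each single \<open>a \<in> S n\<close> is large at some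
  vector \<open>h\<close>, but \<open>h\<close> depends on \<open>a\<close>, whereas the
  contradiction needs one vector, the image of the unit, at which all of \<open>S n\<close> is large
  at once. Convexity of \<open>S n\<close> trades the vector for a mean, and the module defined by a
  mean need not sit inside the given representation: this is where the reduction property of other
  representations enters. Summing over \<open>n\<close> replaces infinitely many unrelated
  complements by one, so that a single constant bounds all projections; the sum is a bounded module
  because one constant \<open>C\<close> bounds every mean. As the reduction property is available
  for Hilbert spaces with vectors in a fixed type, the sum has to be moved into that type by an
  injective code. The separating element of unknown norm given by regularity is used once more at
  the end: it corrects an approximation of the projected unit to an exact element of
  \<open>S n\<close>, at bounded cost.\<close>

text \<open>By Zorn there is a maximal cone \<open>M\<close> above \<open>C\<close> that omits
  \<open>- e\<close>. Maximality makes the order total: \<open>M\<close> and its negatives cover the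
  whole space. Hence every vector is comparable with all multiples of \<open>e\<close>, and
  \<open>\<phi> u\<close> is the resulting cut. The same principle yields the means over forms and
  the Hahn-Banach theorem.\<close>

lemma order_unit_functional:
  fixes C :: "'v::real_vector set" and e :: 'v
  assumes add: "\<And>u v. u \<in> C \<Longrightarrow> v \<in> C \<Longrightarrow> u + v \<in> C"
    and scale: "\<And>t u. 0 \<le> t \<Longrightarrow> u \<in> C \<Longrightarrow> t *\<^sub>R u \<in> C"
    and e: "e \<in> C" and ne: "- e \<notin> C"
    and unit: "\<And>u. \<exists>t. t *\<^sub>R e - u \<in> C"
  obtains \<phi> :: "'v \<Rightarrow> real" where "linear \<phi>" "\<phi> e = 1" "\<And>u. u \<in> C \<Longrightarrow> 0 \<le> \<phi> u"
proof -
  define cone :: "'v set \<Rightarrow> bool" where "cone = (\<lambda>M. (\<forall>u\<in>M. \<forall>v\<in>M. u + v \<in> M) \<and> (\<forall>t\<ge>0. \<forall>u\<in>M. t *\<^sub>R u \<in> M)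
    \<and> C \<subseteq> M \<and> - e \<notin> M)"
  have "\<exists>M\<in>Collect cone. \<forall>X\<in>Collect cone. M \<subseteq> X \<longrightarrow> X = M"
  proof (rule subset_Zorn_nonempty)
    have "cone C" unfolding cone_def using add scale ne by blast
    then show "Collect cone \<noteq> {}" by blast
    fix \<C> assume ne': "\<C> \<noteq> {}" and ch: "subset.chain (Collect cone) \<C>"
    then have c: "\<And>M. M \<in> \<C> \<Longrightarrow> cone M" by (auto simp: subset.chain_def)
    have "u + v \<in> \<Union>\<C>" if uv: "u \<in> \<Union>\<C>" "v \<in> \<Union>\<C>" for u v
    proof -
      obtain X Y where "X \<in> \<C>" "Y \<in> \<C>" "u \<in> X" "v \<in> Y" using uv by blast
      moreover have "X \<subseteq> Y \<or> Y \<subseteq> X" using ch calculation by (auto simp: subset_chain_def)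
      ultimately obtain Z where "Z \<in> \<C>" "u \<in> Z" "v \<in> Z" by blast
      then show ?thesis using c[of Z] by (auto simp: cone_def)
    qed
    moreover have "C \<subseteq> \<Union>\<C>" using ne' c by (force simp: cone_def)
    moreover have "t *\<^sub>R u \<in> \<Union>\<C>" if "0 \<le> t" "u \<in> \<Union>\<C>" for t u
      using that c unfolding cone_def by blast
    moreover have "- e \<notin> \<Union>\<C>" using c unfolding cone_def by blast
    ultimately show "\<Union>\<C> \<in> Collect cone"
      unfolding cone_def by blast
  qed
  then obtain M where M: "cone M" and max: "\<And>X. cone X \<Longrightarrow> M \<subseteq> X \<Longrightarrow> X = M"
    by (metis mem_Collect_eq)
  have Madd: "\<And>u v. u \<in> M \<Longrightarrow> v \<in> M \<Longrightarrow> u + v \<in> M"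
    and Msc: "\<And>t u. 0 \<le> t \<Longrightarrow> u \<in> M \<Longrightarrow> t *\<^sub>R u \<in> M" and CM: "C \<subseteq> M" and neM: "- e \<notin> M"
    using M by (auto simp: cone_def)
  have sM: "t *\<^sub>R e \<in> M \<longleftrightarrow> 0 \<le> t" for t
  proof
    assume t: "t *\<^sub>R e \<in> M"
    show "0 \<le> t"
    proof (rule ccontr)
      assume "\<not> 0 \<le> t"
      then have "(1 / - t) *\<^sub>R (t *\<^sub>R e) \<in> M" by (intro Msc t) auto
      with \<open>\<not> 0 \<le> t\<close> show False using neM by simp
    qed
  qed (use Msc e CM in blast)
  \<comment> \<open>Adjoining a vector outside \<open>M\<close> must violate the only condition that
    can fail, so \<open>- e\<close> lies in the enlarged cone; the coefficient of \<open>u\<close>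
    is nonzero because \<open>- e\<close> is not in \<open>M\<close>.\<close>
  have ext: "\<exists>m\<in>M. \<exists>t>0. - e = m + t *\<^sub>R u" if u: "u \<notin> M" for u
  proof -
    let ?X = "{m + t *\<^sub>R u | m t. m \<in> M \<and> 0 \<le> t}"
    have z: "0 \<in> M" using Msc[of 0 e] e CM by auto
    have "m + 0 *\<^sub>R u \<in> ?X" if "m \<in> M" for m using that by blast
    then have MX: "M \<subseteq> ?X" by auto
    have "0 + 1 *\<^sub>R u \<in> ?X" using z by (intro CollectI exI[of _ 0] exI[of _ 1]) auto
    then have "u \<in> ?X" by simp
    then have nc: "\<not> cone ?X" using max[OF _ MX] u by auto
    have X1: "x + y \<in> ?X" if "x \<in> ?X" "y \<in> ?X" for x y
    proof -
      obtain m t n s where "x = m + t *\<^sub>R u" "y = n + s *\<^sub>R u" "m \<in> M" "n \<in> M" "0 \<le> t" "0 \<le> s"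
        using \<open>x \<in> ?X\<close> \<open>y \<in> ?X\<close> by blast
      then have "x + y = (m + n) + (t + s) *\<^sub>R u" "m + n \<in> M" "0 \<le> t + s" using Madd by (simp_all add: algebra_simps)
      then show ?thesis by blast
    qed
    have X2: "r *\<^sub>R x \<in> ?X" if "x \<in> ?X" "0 \<le> r" for x r
    proof -
      obtain m t where "x = m + t *\<^sub>R u" "m \<in> M" "0 \<le> t" using \<open>x \<in> ?X\<close> by blast
      then have "r *\<^sub>R x = r *\<^sub>R m + (r * t) *\<^sub>R u" "r *\<^sub>R m \<in> M" "0 \<le> r * t"
        using Msc \<open>0 \<le> r\<close> by (simp_all add: algebra_simps)
      then show ?thesis by blast
    qed
    have X3: "C \<subseteq> ?X" using CM MX by (rule subset_trans)
    have "- e \<in> ?X"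
    proof (rule ccontr)
      assume "- e \<notin> ?X"
      then have "cone ?X" unfolding cone_def using X1 X2 X3 by (intro conjI ballI allI impI)
      then show False using nc by contradiction
    qed
    then obtain m t where mt: "- e = m + t *\<^sub>R u" "m \<in> M" "0 \<le> t" by blast
    have "t \<noteq> 0"
    proof
      assume "t = 0"
      then have "- e = m" using mt(1) by simp
      then show False using mt(2) neM by simp
    qed
    then have "t > 0" using mt(3) by simp
    then show ?thesis using mt by blast
  qed
  \<comment> \<open>Eliminating \<open>u\<close> between the two expressions for \<open>- e\<close>
    puts a negative multiple of \<open>e\<close> into \<open>M\<close>.\<close>
  have total: "u \<in> M \<or> - u \<in> M" for u
  proof (rule ccontr)
    assume n: "\<not> (u \<in> M \<or> - u \<in> M)"
    then obtain m t n s where m: "m \<in> M" "0 < t" "- e = m + t *\<^sub>R u"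
      and n: "n \<in> M" "0 < s" "- e = n + s *\<^sub>R (- u)" using ext[of u] ext[of "- u"] by blast
    have "s *\<^sub>R m + t *\<^sub>R n = s *\<^sub>R (m + t *\<^sub>R u) + t *\<^sub>R (n + s *\<^sub>R (- u))" by (simp add: algebra_simps)
    also have "\<dots> = (- (s + t)) *\<^sub>R e" unfolding m(3)[symmetric] n(3)[symmetric] by (simp add: algebra_simps)
    finally have "(- (s + t)) *\<^sub>R e \<in> M" using m n by (metis Madd Msc less_imp_le)
    then show False using sM[of "- (s + t)"] m n by simp
  qed
  define \<phi> where "\<phi> = (\<lambda>u. Sup {t. u - t *\<^sub>R e \<in> M})"
  have bdd: "bdd_above {t. u - t *\<^sub>R e \<in> M}" for u
  proof -
    obtain s where s: "s *\<^sub>R e - u \<in> M" using unit[of u] CM by auto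
    have "t \<le> s" if "u - t *\<^sub>R e \<in> M" for t
      using Madd[OF s that] sM[of "s - t"] by (simp add: algebra_simps)
    then show ?thesis by (auto intro!: bdd_aboveI[of _ s])
  qed
  have nonempty: "{t. u - t *\<^sub>R e \<in> M} \<noteq> {}" for u
  proof -
    obtain s where s: "s *\<^sub>R e - (- u) \<in> M" using unit[of "- u"] CM by auto
    then have "u - (- s) *\<^sub>R e \<in> M" by (simp add: algebra_simps)
    then show ?thesis by blast
  qed
  have ge: "t \<le> \<phi> u" if "u - t *\<^sub>R e \<in> M" for t u
    unfolding \<phi>_def using bdd that by (intro cSup_upper) auto
  have lt: "u - t *\<^sub>R e \<in> M" if less: "t < \<phi> u" for t u
  proof -
    obtain s where s: "t < s" "u - s *\<^sub>R e \<in> M"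
      using less less_cSup_iff[OF nonempty bdd, of t u] unfolding \<phi>_def by auto
    have "(s - t) *\<^sub>R e \<in> M" using s sM by simp
    from Madd[OF s(2) this] show ?thesis by (simp add: algebra_simps)
  qed
  \<comment> \<open>A supremum of lower bounds is only superadditive. Additivity follows from this
    inequality for \<open>u\<close>, \<open>v\<close> and for \<open>- u\<close>,
    \<open>- v\<close>, once totality of \<open>M\<close> has given
    \<open>\<phi> (- u) = - \<phi> u\<close>.\<close>
  have super: "\<phi> u + \<phi> v \<le> \<phi> (u + v)" for u v
  proof (rule field_le_epsilon)
    fix \<epsilon> :: real assume "0 < \<epsilon>"
    then have "u - (\<phi> u - \<epsilon>/2) *\<^sub>R e \<in> M" "v - (\<phi> v - \<epsilon>/2) *\<^sub>R e \<in> M" by (auto intro!: lt)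
    from Madd[OF this] have "u + v - (\<phi> u + \<phi> v - \<epsilon>) *\<^sub>R e \<in> M" by (simp add: algebra_simps flip: scaleR_add_left)
    from ge[OF this] show "\<phi> u + \<phi> v \<le> \<phi> (u + v) + \<epsilon>" by simp
  qed
  have "\<phi> (0 *\<^sub>R e) = 0"
  proof -
    have "0 *\<^sub>R e - t *\<^sub>R e \<in> M \<longleftrightarrow> t \<le> 0" for t using sM[of "- t"] by simp
    then have "{t. 0 *\<^sub>R e - t *\<^sub>R e \<in> M} = {..0}" by auto
    then show ?thesis by (simp add: \<phi>_def)
  qed
  then have zero: "\<phi> 0 = 0" by simp
  have neg: "\<phi> (- u) = - \<phi> u" for u
  proof (rule antisym)
    show "\<phi> (- u) \<le> - \<phi> u" using super[of u "- u"] zero by simp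
    show "- \<phi> u \<le> \<phi> (- u)"
    proof (rule field_le_epsilon)
      fix \<epsilon> :: real assume "0 < \<epsilon>"
      then have "u - (\<phi> u + \<epsilon>) *\<^sub>R e \<notin> M" using ge[of u "\<phi> u + \<epsilon>"] by auto
      then have "- (u - (\<phi> u + \<epsilon>) *\<^sub>R e) \<in> M" using total by blast
      then have "- u - (- (\<phi> u + \<epsilon>)) *\<^sub>R e \<in> M" by (simp add: algebra_simps)
      from ge[OF this] show "- \<phi> u \<le> \<phi> (- u) + \<epsilon>" by simp
    qed
  qed
  have addit: "\<phi> (u + v) = \<phi> u + \<phi> v" for u v
    using super[of u v] super[of "- u" "- v"] neg[of "u + v"] neg by simp
  have pos: "0 \<le> \<phi> u" if "u \<in> M" for u using ge[of u 0] that by simp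
  have hpos: "r * \<phi> u \<le> \<phi> (r *\<^sub>R u)" if "0 < r" for r u
  proof (rule field_le_epsilon)
    fix \<epsilon> :: real assume "0 < \<epsilon>"
    then have "u - (\<phi> u - \<epsilon>/r) *\<^sub>R e \<in> M" using that by (auto intro!: lt)
    then have "r *\<^sub>R (u - (\<phi> u - \<epsilon>/r) *\<^sub>R e) \<in> M" by (rule Msc[rotated]) (use that in simp)
    moreover have "r *\<^sub>R (u - (\<phi> u - \<epsilon>/r) *\<^sub>R e) = r *\<^sub>R u - (r * \<phi> u - \<epsilon>) *\<^sub>R e"
      using that by (simp add: algebra_simps)
    ultimately show "r * \<phi> u \<le> \<phi> (r *\<^sub>R u) + \<epsilon>" using ge[of "r *\<^sub>R u" "r * \<phi> u - \<epsilon>"] by auto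
  qed
  have hpos': "\<phi> (r *\<^sub>R u) = r * \<phi> u" if "0 < r" for r u
    using hpos[OF that, of u] hpos[OF that, of "- u"] neg by simp
  have hom: "\<phi> (r *\<^sub>R u) = r * \<phi> u" for r u
  proof (cases "r < 0")
    case True
    then show ?thesis using hpos'[of "- r" u] neg[of "r *\<^sub>R u"] by simp
  next
    case False
    then show ?thesis using hpos'[of r u] zero by (cases "r = 0") auto
  qed
  have "linear \<phi>" using addit hom by (intro linearI) auto
  moreover have "\<phi> e = 1"
  proof -
    have "1 \<le> \<phi> e" "- 1 \<le> \<phi> (- e)" using Msc[of 0 e] e CM by (auto intro!: ge)
    then show ?thesis using neg[of e] by simp
  qed
  ultimately show ?thesis using that pos CM by blast
qed

section \<open>Complemented subspaces of Banach spaces\<close>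

text \<open>Baire's theorem for \<open>L\<close> as a complete space of its own: if no
  \<open>closure (D j)\<close> contained a relative ball, \<open>L\<close> would be a countable
  union of nowhere dense sets. The relative form matters because a closed subspace may have empty
  interior in the ambient space.\<close>

lemma baire_closed:
  fixes L :: "'e::banach set" and D :: "nat \<Rightarrow> 'e set"
  assumes L: "closed L" "L \<noteq> {}" and cov: "L \<subseteq> (\<Union>j. D j)"
  obtains j x \<epsilon> where "\<epsilon> > 0" "x \<in> L" "ball x \<epsilon> \<inter> L \<subseteq> closure (D j)"
proof (rule ccontr)
  assume contra: "\<not> thesis"
  interpret S: Submetric "UNIV :: 'e set" dist L by unfold_locales auto
  have mt: "S.sub.mtopology = top_of_set L"
    using S.mtopology_submetric by simp
  have mc: "S.sub.mcomplete"
    using L(1) by (intro S.closedin_mcomplete_imp_mcomplete) (auto simp: complete_UNIV)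
  have "S.sub.mtopology interior_of \<Union>((\<lambda>j. closure (D j) \<inter> L) ` UNIV) = {}"
  proof (rule S.sub.metric_Baire_category_alt[OF mc])
    show "countable (range (\<lambda>j. closure (D j) \<inter> L))" by simp
    fix T assume "T \<in> range (\<lambda>j. closure (D j) \<inter> L)"
    then obtain j where j: "T = closure (D j) \<inter> L" by blast
    show "closedin S.sub.mtopology T \<and> S.sub.mtopology interior_of T = {}"
    proof
      show "closedin S.sub.mtopology T" unfolding mt j using closedin_closed by blast
      show "S.sub.mtopology interior_of T = {}"
      proof (rule ccontr)
        assume "S.sub.mtopology interior_of T \<noteq> {}"
        then obtain x where "x \<in> S.sub.mtopology interior_of T" by blast
        then obtain U where "openin (top_of_set L) U" "x \<in> U" "U \<subseteq> T" unfolding mt interior_of_def by blast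
        then obtain \<epsilon> where "\<epsilon> > 0" "ball x \<epsilon> \<inter> L \<subseteq> T" "x \<in> L"
          unfolding openin_contains_ball by (meson subset_iff subset_trans)
        then show False using contra that j by blast
      qed
    qed
  qed
  moreover have "\<Union>((\<lambda>j. closure (D j) \<inter> L) ` UNIV) = L" using cov closure_subset by blast
  ultimately show False using L(2) interior_of_topspace[of "S.sub.mtopology"] by (simp add: mt)
qed

text \<open>Each residual is at most half of the preceding one, so the corrections are dominated by
  a geometric series with sum \<open>2 * M * norm g\<close>. The limit is taken in the domain, so
  \<open>G\<close> may be an arbitrary subspace that contains the image of \<open>F\<close>.\<close>

lemma approximate_solution_imp_solution:
  fixes T :: "'f::banach \<Rightarrow> 'e::real_normed_vector"
  assumes T: "bounded_linear T" and F: "closed F" "subspace F" and G: "subspace G" and TG: "T ` F \<subseteq> G"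
    and approx: "\<And>g. g \<in> G \<Longrightarrow> \<exists>x\<in>F. norm x \<le> M * norm g \<and> norm (g - T x) \<le> norm g / 2"
    and g: "g \<in> G"
  obtains x where "x \<in> F" "T x = g" "norm x \<le> 2 * M * norm g"
proof -
  interpret T: bounded_linear T by (rule T)
  obtain s where s: "\<And>g. g \<in> G \<Longrightarrow> s g \<in> F \<and> norm (s g) \<le> M * norm g \<and> norm (g - T (s g)) \<le> norm g / 2"
    using approx by metis
  define r where "r = (\<lambda>k. ((\<lambda>g. g - T (s g)) ^^ k) g)"
  have r0: "r 0 = g" and rS: "r (Suc k) = r k - T (s (r k))" for k by (auto simp: r_def)
  have rG: "r k \<in> G" for k
  proof (induction k)
    case (Suc k)
    then show ?case using s[OF Suc] TG by (auto simp: rS intro!: subspace_diff[OF G])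
  qed (use g r0 in simp)
  have rn: "norm (r k) \<le> norm g * (1/2) ^ k" for k
  proof (induction k)
    case (Suc k)
    then show ?case using s[OF rG, of k] by (simp add: rS)
  qed (simp add: r0)
  have xn: "norm (s (r k)) \<le> (M * norm g) * (1/2) ^ k" for k
  proof (cases "0 \<le> M")
    case True
    have "norm (s (r k)) \<le> M * norm (r k)" using s[OF rG] by blast
    also have "\<dots> \<le> M * (norm g * (1/2) ^ k)" by (rule mult_left_mono[OF rn True])
    finally show ?thesis by simp
  next
    case False
    \<comment> \<open>A negative \<open>M\<close> forces \<open>G\<close> to be the zero
      space.\<close>
    have "h = 0" if "h \<in> G" for h
    proof -
      have "0 \<le> M * norm h" using s[OF that] norm_ge_zero order_trans by blast
      then show ?thesis using False by (simp add: zero_le_mult_iff)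
    qed
    then have "g = 0" "r k = 0" using g rG by auto
    then show ?thesis using s[OF rG, of k] by simp
  qed
  have geo: "(\<lambda>k. (M * norm g) * (1/2) ^ k) sums (2 * M * norm g)"
    using sums_mult[OF geometric_sums[of "1/2 :: real"], of "M * norm g"] by (simp add: mult_ac)
  have sm: "summable (\<lambda>k. norm (s (r k)))"
    using geo by (intro summable_comparison_test'[OF sums_summable[OF geo]]) (use xn in auto)
  define x where "x = (\<Sum>k. s (r k))"
  have sums: "(\<lambda>n. \<Sum>k<n. s (r k)) \<longlonglongrightarrow> x"
    using summable_norm_cancel[OF sm] unfolding x_def by (intro summable_LIMSEQ)
  have "norm x \<le> (\<Sum>k. norm (s (r k)))" unfolding x_def by (rule summable_norm[OF sm])
  also have "\<dots> \<le> 2 * M * norm g" using xn sm geo by (metis suminf_le sums_summable sums_unique)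
  finally have "norm x \<le> 2 * M * norm g" .
  moreover have "x \<in> F"
  proof (rule closed_sequentially[OF F(1) _ sums])
    show "(\<Sum>k<n. s (r k)) \<in> F" for n using s rG by (intro subspace_sum[OF F(2)]) auto
  qed
  moreover have "T x = g"
  proof -
    have part: "T (\<Sum>k<n. s (r k)) = g - r n" for n
      by (induction n) (auto simp: r0 rS T.add T.zero)
    have "(\<lambda>n. norm g * (1/2) ^ n) \<longlonglongrightarrow> 0"
      using tendsto_mult_right_zero[OF LIMSEQ_realpow_zero[of "1/2"], of "norm g"] by (simp add: mult.commute)
    then have "r \<longlonglongrightarrow> 0" by (rule Lim_null_comparison[rotated]) (use rn in auto)
    then have "(\<lambda>n. g - r n) \<longlonglongrightarrow> g" using tendsto_diff[OF tendsto_const] by fastforce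
    moreover have "(\<lambda>n. g - r n) \<longlonglongrightarrow> T x" using T.tendsto[OF sums] part by simp
    ultimately show ?thesis using LIMSEQ_unique by blast
  qed
  ultimately show ?thesis using that by blast
qed

text \<open>An open mapping argument for addition on \<open>V \<times> W\<close>. By Baire, sums of
  parts with bounded norm are dense in some relative ball of the closed sum. Differences of such
  sums therefore approximate all small vectors, and the approximation is improved to an exact
  decomposition, which \<open>V \<inter> W = {0}\<close> identifies with the given one. The result
  bounds the projection onto \<open>V\<close> along \<open>W\<close>.\<close>

lemma bounded_direct_sum:
  fixes V W :: "'e::banach set"
  assumes V: "closed V" "subspace V" and W: "closed W" "subspace W" and VW: "V \<inter> W = {0}"
    and cl: "closed {v + w | v w. v \<in> V \<and> w \<in> W}"
  shows "\<exists>K. \<forall>v\<in>V. \<forall>w\<in>W. norm v \<le> K * norm (v + w)"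
proof -
  define L where "L = {v + w | v w. v \<in> V \<and> w \<in> W}"
  define D where "D = (\<lambda>j::nat. {v + w | v w. v \<in> V \<and> w \<in> W \<and> norm v \<le> j \<and> norm w \<le> j})"
  have L: "subspace L" unfolding L_def by (rule subspace_sums[OF V(2) W(2)])
  have "L \<subseteq> (\<Union>j. D j)"
  proof
    fix x assume "x \<in> L"
    then obtain v w where "x = v + w" "v \<in> V" "w \<in> W" by (auto simp: L_def)
    moreover obtain j where "max (norm v) (norm w) \<le> real j" using real_arch_simple by blast
    ultimately show "x \<in> (\<Union>j. D j)" by (auto simp: D_def)
  qed
  moreover have "L \<noteq> {}" using L subspace_0 by blast
  ultimately obtain j x \<epsilon> where \<epsilon>: "\<epsilon> > 0" "x \<in> L" "ball x \<epsilon> \<inter> L \<subseteq> closure (D j)"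
    using baire_closed[of L D] cl L_def by metis
  \<comment> \<open>A vector \<open>z\<close> is scaled to norm \<open>\<epsilon> / 2\<close>. A
    difference of two elements of \<open>D j\<close> splits into parts of norm at most
    \<open>2 * j\<close>, a pair of norm at most \<open>4 * j\<close>, and scaling back multiplies
    by \<open>2 * norm z / \<epsilon>\<close>. The two tolerances \<open>\<epsilon> / 8\<close> then
    become the error \<open>norm z / 2\<close>.\<close>
  define M where "M = 8 * real j / \<epsilon>"
  have approx: "\<exists>p\<in>V \<times> W. norm p \<le> M * norm z \<and> norm (z - (fst p + snd p)) \<le> norm z / 2" if z: "z \<in> L" for z
  proof (cases "z = 0")
    case True
    then show ?thesis using V W subspace_0 by (intro bexI[of _ 0]) (auto simp: zero_prod_def)
  next
    case False
    define t where "t = \<epsilon> / (2 * norm z)"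
    have t: "t > 0" "norm (t *\<^sub>R z) < \<epsilon>" "t * norm z = \<epsilon> / 2" using False \<epsilon> by (auto simp: t_def)
    have "x + t *\<^sub>R z \<in> closure (D j)"
      using \<epsilon>(2,3) t z by (intro subsetD[OF \<epsilon>(3)]) (auto simp: dist_norm intro!: subspace_add[OF L] subspace_scale[OF L])
    then obtain d1 where d1: "d1 \<in> D j" "dist d1 (x + t *\<^sub>R z) < \<epsilon> / 8"
      using \<epsilon>(1) unfolding closure_approachable by (meson divide_pos_pos zero_less_numeral)
    have "x \<in> closure (D j)" using \<epsilon> by auto
    then obtain d2 where d2: "d2 \<in> D j" "dist d2 x < \<epsilon> / 8"
      using \<epsilon>(1) unfolding closure_approachable by (meson divide_pos_pos zero_less_numeral)
    obtain v1 w1 where 1: "d1 = v1 + w1" "v1 \<in> V" "w1 \<in> W" "norm v1 \<le> j" "norm w1 \<le> j" using d1 by (auto simp: D_def)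
    obtain v2 w2 where 2: "d2 = v2 + w2" "v2 \<in> V" "w2 \<in> W" "norm v2 \<le> j" "norm w2 \<le> j" using d2 by (auto simp: D_def)
    define v w where "v = (1/t) *\<^sub>R (v1 - v2)" and "w = (1/t) *\<^sub>R (w1 - w2)"
    have it: "1 / t = 2 * norm z / \<epsilon>" by (simp add: t_def)
    have "norm (v1 - v2) \<le> 2 * j" "norm (w1 - w2) \<le> 2 * j"
      using 1 2 norm_triangle_ineq4[of v1 v2] norm_triangle_ineq4[of w1 w2] by linarith+
    then have n: "norm v \<le> (1/t) * (2 * j)" "norm w \<le> (1/t) * (2 * j)"
      unfolding v_def w_def norm_scaleR using t(1) by (auto intro!: mult_left_mono simp: divide_right_mono)
    have "norm (v, w) \<le> norm v + norm w" by (rule norm_Pair_le)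
    also have "\<dots> \<le> (1/t) * (4 * j)" using n by simp
    also have "\<dots> = M * norm z" by (simp add: it M_def)
    finally have "norm (v, w) \<le> M * norm z" .
    moreover have "v \<in> V" "w \<in> W" unfolding v_def w_def using 1 2
      by (auto intro!: subspace_scale[OF V(2)] subspace_diff[OF V(2)] subspace_scale[OF W(2)] subspace_diff[OF W(2)])
    moreover have "norm (z - (v + w)) \<le> norm z / 2"
    proof -
      have "z - (v + w) = (1/t) *\<^sub>R (t *\<^sub>R z - (d1 - d2))"
        using t(1) by (simp add: v_def w_def 1 2 algebra_simps)
      also have "norm \<dots> = (1/t) * norm ((x + t *\<^sub>R z - d1) - (x - d2))"
      proof -
        have eq: "t *\<^sub>R z - (d1 - d2) = (x + t *\<^sub>R z - d1) - (x - d2)" by (simp add: algebra_simps)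
        show ?thesis unfolding norm_scaleR eq using t(1) by simp
      qed
      also have "\<dots> \<le> (1/t) * (\<epsilon> / 4)"
        using d1(2) d2(2) t(1) norm_triangle_ineq4[of "x + t *\<^sub>R z - d1" "x - d2"]
        by (intro mult_left_mono) (auto simp: dist_norm norm_minus_commute)
      also have "\<dots> = norm z / 2" using \<epsilon> by (simp add: it)
      finally show ?thesis .
    qed
    ultimately show ?thesis by (intro bexI[of _ "(v, w)"]) auto
  qed
  have bl: "bounded_linear (\<lambda>p::'e \<times> 'e. fst p + snd p)"
    by (intro bounded_linear_intros)
  have "norm v \<le> 2 * M * norm (v + w)" if vw: "v \<in> V" "w \<in> W" for v w
  proof -
    have TVW: "(\<lambda>p. fst p + snd p) ` (V \<times> W) \<subseteq> L" and vwL: "v + w \<in> L" using vw unfolding L_def by fastforce+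
    have "\<exists>p. p \<in> V \<times> W \<and> fst p + snd p = v + w \<and> norm p \<le> 2 * M * norm (v + w)"
      by (rule approximate_solution_imp_solution[OF bl closed_Times[OF V(1) W(1)] subspace_Times[OF V(2) W(2)] L TVW approx vwL]) (assumption, rule exI, intro conjI)
    then obtain p where p: "p \<in> V \<times> W" "fst p + snd p = v + w" "norm p \<le> 2 * M * norm (v + w)" by blast
    have "fst p - v = w - snd p" using p(2) by (simp add: algebra_simps)
    then have "fst p - v \<in> V \<inter> W" using p(1) vw
      by (metis IntI mem_Times_iff subspace_diff[OF V(2)] subspace_diff[OF W(2)])
    then have "v = fst p" using VW by auto
    then show ?thesis using norm_fst_le[of "fst p" "snd p"] p(3) by simp
  qed
  then show ?thesis by blast
qed

section \<open>Semi-inner products\<close>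

text \<open>Degenerate forms are allowed, because a mean of forms may vanish at nonzero elements;
  the completion divides out the null vectors. The scaling \<open>cs\<close> is a parameter so that
  the same facts serve the algebra and the finitely supported sequences in it.\<close>

locale semi_inner_product =
  fixes ip :: "'x::ab_group_add \<Rightarrow> 'x \<Rightarrow> complex" and cs :: "complex \<Rightarrow> 'x \<Rightarrow> 'x"
  assumes ip_add: "ip (x + y) z = ip x z + ip y z"
    and ip_scale: "ip (cs c x) y = c * ip x y"
    and ip_commute: "ip x y = cnj (ip y x)"
    and ip_nonneg: "0 \<le> Re (ip x x)"
begin

lemma ip_add_right: "ip x (y + z) = ip x y + ip x z"
  using ip_add[of y z x] ip_commute by (metis complex_cnj_add)

lemma ip_scale_right: "ip x (cs c y) = cnj c * ip x y"
  using ip_scale[of c y x] ip_commute by (metis complex_cnj_mult)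

lemma ip_zero: "ip 0 x = 0" using ip_add[of 0 0 x] by simp

lemma ip_minus: "ip (- x) y = - ip x y" using ip_add[of x "- x" y] ip_zero by (simp add: add_eq_0_iff)

lemma ip_minus_right: "ip x (- y) = - ip x y"
  using ip_minus[of y x] ip_commute[of x "- y"] ip_commute[of x y] by simp

lemma ip_diff: "ip (x - y) z = ip x z - ip y z"
  using ip_add[of x "- y" z] ip_minus by simp

lemma ip_self: "ip x x = of_real (Re (ip x x))"
  using ip_commute[of x x] by (simp add: complex_eq_iff)

text \<open>The form is nonnegative at \<open>x - t s y\<close> with \<open>s = ip x y\<close>, for
  every real \<open>t\<close>. The minimizing \<open>t\<close> is \<open>1 / Re (ip y y)\<close>; if
  this denominator is zero, a large \<open>t\<close> would produce the value \<open>- 1\<close>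
  unless \<open>s = 0\<close>.\<close>

lemma Cauchy_Schwarz: "(cmod (ip x y))\<^sup>2 \<le> Re (ip x x) * Re (ip y y)"
proof -
  define s where "s = ip x y"
  have yx: "ip y x = cnj s" using ip_commute s_def by metis
  have q: "0 \<le> Re (ip x x) - 2 * t * (cmod s)\<^sup>2 + t\<^sup>2 * (cmod s)\<^sup>2 * Re (ip y y)" for t
  proof -
    define c where "c = - of_real t * s"
    have "ip (x + cs c y) (x + cs c y) = ip x x + cnj c * s + c * cnj s + c * cnj c * ip y y"
      by (simp add: ip_add ip_add_right ip_scale ip_scale_right yx algebra_simps flip: s_def)
    also have "cnj c * s = - of_real t * (s * cnj s)" by (simp add: c_def)
    also have "c * cnj s = - of_real t * (s * cnj s)" by (simp add: c_def)
    also have "c * cnj c = of_real (t\<^sup>2) * (s * cnj s)" by (simp add: c_def power2_eq_square)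
    also have "s * cnj s = of_real ((cmod s)\<^sup>2)" by (simp add: complex_norm_square del: of_real_power)
    finally have "Re (ip (x + cs c y) (x + cs c y)) = Re (ip x x) - 2 * t * (cmod s)\<^sup>2 + t\<^sup>2 * (cmod s)\<^sup>2 * Re (ip y y)"
      by (simp del: of_real_power flip: of_real_mult)
    then show ?thesis using ip_nonneg by metis
  qed
  show ?thesis unfolding s_def[symmetric]
  proof (cases "Re (ip y y) = 0")
    case True
    have "(cmod s)\<^sup>2 = 0"
    proof (rule ccontr)
      assume "(cmod s)\<^sup>2 \<noteq> 0"
      then show False using q[of "(Re (ip x x) + 1) / (2 * (cmod s)\<^sup>2)"] True by simp
    qed
    then show "(cmod s)\<^sup>2 \<le> Re (ip x x) * Re (ip y y)" using True by simp
  next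
    case False
    then have pos: "Re (ip y y) > 0" using ip_nonneg[of y] by simp
    have "0 \<le> Re (ip x x) - (cmod s)\<^sup>2 / Re (ip y y)"
      using q[of "1 / Re (ip y y)"] pos by (simp add: power2_eq_square)
    then show "(cmod s)\<^sup>2 \<le> Re (ip x x) * Re (ip y y)" using pos by (simp add: field_simps)
  qed
qed

definition snorm :: "'x \<Rightarrow> real" where "snorm x = sqrt (Re (ip x x))"

lemma snorm_nonneg [simp]: "0 \<le> snorm x" by (simp add: snorm_def ip_nonneg)

lemma snorm_power2: "(snorm x)\<^sup>2 = Re (ip x x)" by (simp add: snorm_def ip_nonneg)

lemma cmod_ip_le: "cmod (ip x y) \<le> snorm x * snorm y"
  by (rule power2_le_imp_le) (auto simp: power_mult_distrib snorm_power2 Cauchy_Schwarz)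

text \<open>The two sides differ by exactly \<open>t * s * Re (ip (x - y) (x - y))\<close>. This
  convexity allows inequalities for two elements of a convex set to be merged into one for a
  third.\<close>

lemma ip_real_scaled_convex:
  assumes "0 \<le> t" "0 \<le> s" "t + s = 1"
  shows "Re (ip (cs (of_real t) x + cs (of_real s) y) (cs (of_real t) x + cs (of_real s) y))
    \<le> t * Re (ip x x) + s * Re (ip y y)"
proof -
  have "0 \<le> t * s * Re (ip (x - y) (x - y))" using assms ip_nonneg by simp
  also have "Re (ip (x - y) (x - y)) = Re (ip x x) - 2 * Re (ip x y) + Re (ip y y)"
    using ip_add_right[of _ x "- y"] ip_commute[of y x]
    by (simp add: ip_diff ip_minus_right)
  finally have "0 \<le> t * s * (Re (ip x x) - 2 * Re (ip x y) + Re (ip y y))" .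
  moreover have "Re (ip (cs (of_real t) x + cs (of_real s) y) (cs (of_real t) x + cs (of_real s) y))
    = t * t * Re (ip x x) + 2 * t * s * Re (ip x y) + s * s * Re (ip y y)"
    using ip_commute[of y x] by (simp add: ip_add ip_add_right ip_scale ip_scale_right algebra_simps)
  moreover have "t * Re (ip x x) + s * Re (ip y y) - (t * t * Re (ip x x) + 2 * t * s * Re (ip x y) + s * s * Re (ip y y))
    = t * s * (Re (ip x x) - 2 * Re (ip x y) + Re (ip y y))"
  proof -
    have s: "s = 1 - t" using assms by simp
    show ?thesis unfolding s by (simp add: algebra_simps)
  qed
  ultimately show ?thesis by linarith
qed

end

section \<open>Forms on an operator algebra and their means\<close>

text \<open>For fixed elements both bounds are linear inequalities in \<open>p\<close>, so they pass
  to means. The first lets left multiplication by \<open>c\<close> extend to the completion with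
  norm at most \<open>\<bar>C\<bar> * norm c\<close>; the second bounds the vector of the unit
  independently of the form.\<close>

definition module_form :: "real \<Rightarrow> ('a::complex_banach_algebra \<Rightarrow> 'a \<Rightarrow> complex) \<Rightarrow> bool" where
  "module_form C p \<longleftrightarrow> semi_inner_product p scaleC \<and>
     (\<forall>c a. Re (p (c * a) (c * a)) \<le> (C * norm c)\<^sup>2 * Re (p a a)) \<and>
     (\<forall>a. Re (p a a) \<le> (C * norm a)\<^sup>2)"

text \<open>On the type \<open>discrete\<close> every function is continuous, so the bounded
  continuous functions are all bounded functions with the supremum norm. For an unbounded
  \<open>f\<close> the value is unspecified.\<close>

definition bounded_fun :: "('x \<Rightarrow> 'b) \<Rightarrow> 'x discrete \<Rightarrow>\<^sub>C 'b::metric_space" where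
  "bounded_fun f = Bcontfun (\<lambda>x. f (of_discrete x))"

lemma apply_bounded_fun:
  assumes "bounded (range f)" shows "apply_bcontfun (bounded_fun f) (discrete x) = f x"
proof -
  have "continuous_on UNIV (\<lambda>x. f (of_discrete x))"
    unfolding continuous_on_open_vimage[OF open_UNIV] by (auto simp: open_discrete)
  moreover have "bounded (range (\<lambda>x. f (of_discrete x)))" by (rule bounded_subset[OF assms]) auto
  ultimately show ?thesis unfolding bounded_fun_def
    by (subst Bcontfun_inverse) (auto simp: bcontfun_def discrete_inverse)
qed

lemma bounded_fun_eqI:
  fixes f g :: "'x discrete \<Rightarrow>\<^sub>C 'b::metric_space"
  assumes "\<And>x. apply_bcontfun f (discrete x) = apply_bcontfun g (discrete x)" shows "f = g"
  by (rule bcontfun_eqI) (metis assms of_discrete_inverse)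

text \<open>The values \<open>q a a\<close> are convex in \<open>a\<close>. So the bounded functions on \<open>P\<close> that dominate a
  nonnegative multiple of \<open>q \<mapsto> q a a - r\<close> for some \<open>a \<in> S\<close> form a convex cone, and a functional
  that is nonnegative on it is a mean over \<open>P\<close>; averaging all \<open>q\<close> with it gives \<open>p\<close>.\<close>

lemma minimax_module_form:
  fixes P :: "('a::complex_banach_algebra \<Rightarrow> 'a \<Rightarrow> complex) set"
  assumes P: "\<And>q. q \<in> P \<Longrightarrow> module_form C q"
    and S: "convex S" "S \<noteq> {}"
    and large: "\<And>a. a \<in> S \<Longrightarrow> \<exists>q\<in>P. r < Re (q a a)"
  obtains p where "module_form C p" "\<And>a. a \<in> S \<Longrightarrow> r \<le> Re (p a a)"
proof -
  \<comment> \<open>The value \<open>0\<close> outside \<open>P\<close> keeps the function bounded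
    on the whole type of forms.\<close>
  define ev :: "(('a \<Rightarrow> 'a \<Rightarrow> complex) \<Rightarrow> real) \<Rightarrow> ('a \<Rightarrow> 'a \<Rightarrow> complex) discrete \<Rightarrow>\<^sub>C real"
    where "ev = (\<lambda>f. bounded_fun (\<lambda>q. if q \<in> P then f q else 0))"
  have ev: "apply_bcontfun (ev f) (discrete q) = (if q \<in> P then f q else 0)"
    if "\<And>q. q \<in> P \<Longrightarrow> \<bar>f q\<bar> \<le> B" for f B q
    unfolding ev_def using that
    by (intro apply_bounded_fun) (auto intro!: boundedI[of _ "\<bar>B\<bar>"] order_trans[OF that])
  have sip: "semi_inner_product q scaleC" if "q \<in> P" for q using P[OF that] by (simp add: module_form_def)
  have Cn: "semi_inner_product.snorm q a \<le> \<bar>C\<bar> * norm a" if "q \<in> P" for q a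
  proof -
    interpret semi_inner_product q scaleC by (rule sip[OF that])
    show ?thesis using P[OF that] unfolding module_form_def snorm_def
      by (intro real_le_lsqrt) (auto simp: power_mult_distrib)
  qed
  have bd: "cmod (q a b) \<le> (\<bar>C\<bar> * norm a) * (\<bar>C\<bar> * norm b)" if "q \<in> P" for q a b
  proof -
    interpret semi_inner_product q scaleC by (rule sip[OF that])
    show ?thesis using cmod_ip_le[of a b] Cn[OF that] mult_mono[of "snorm a" "\<bar>C\<bar> * norm a" "snorm b" "\<bar>C\<bar> * norm b"]
      by (auto intro: order_trans)
  qed
  have evRe: "apply_bcontfun (ev (\<lambda>q. Re (q a b))) (discrete q) = (if q \<in> P then Re (q a b) else 0)" for a b q
    by (rule ev[where B="(\<bar>C\<bar> * norm a) * (\<bar>C\<bar> * norm b)"]) (rule order_trans[OF abs_Re_le_cmod bd])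
  have evIm: "apply_bcontfun (ev (\<lambda>q. Im (q a b))) (discrete q) = (if q \<in> P then Im (q a b) else 0)" for a b q
    by (rule ev[where B="(\<bar>C\<bar> * norm a) * (\<bar>C\<bar> * norm b)"]) (rule order_trans[OF abs_Im_le_cmod bd])
  define K where "K = {u :: ('a \<Rightarrow> 'a \<Rightarrow> complex) discrete \<Rightarrow>\<^sub>C real.
     \<exists>t\<ge>0. \<exists>a\<in>S. \<forall>q\<in>P. t * (Re (q a a) - r) \<le> apply_bcontfun u (discrete q)}"
  obtain a0 where a0: "a0 \<in> S" using S by blast
  have KI: "u \<in> K" if "\<And>q. q \<in> P \<Longrightarrow> 0 \<le> apply_bcontfun u (discrete q)" for u
    unfolding K_def using that a0 by (intro CollectI exI[of _ 0]) auto
  have K1: "u + v \<in> K" if u: "u \<in> K" and v: "v \<in> K" for u v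
  proof -
    obtain t a where t: "t \<ge> 0" "a \<in> S" "\<And>q. q \<in> P \<Longrightarrow> t * (Re (q a a) - r) \<le> apply_bcontfun u (discrete q)"
      using u by (auto simp: K_def)
    obtain s b where s: "s \<ge> 0" "b \<in> S" "\<And>q. q \<in> P \<Longrightarrow> s * (Re (q b b) - r) \<le> apply_bcontfun v (discrete q)"
      using v by (auto simp: K_def)
    show ?thesis
    proof (cases "t + s = 0")
      case True
      then have "t = 0" "s = 0" using t s by auto
      then show ?thesis using t(3) s(3) by (intro KI) (force simp: plus_bcontfun.rep_eq)
    next
      case False
      then have ts: "t + s > 0" using t s by simp
      \<comment> \<open>The witness for the sum has weight \<open>t + s\<close> and is the convex
        combination of \<open>a\<close> and \<open>b\<close> in the ratio of their weights.\<close>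
      define \<alpha> \<beta> where "\<alpha> = t / (t + s)" and "\<beta> = s / (t + s)"
      have ab: "0 \<le> \<alpha>" "0 \<le> \<beta>" "\<alpha> + \<beta> = 1" using t s ts by (auto simp: \<alpha>_def \<beta>_def simp flip: add_divide_distrib)
      define c where "c = \<alpha> *\<^sub>R a + \<beta> *\<^sub>R b"
      have c: "c \<in> S" unfolding c_def using convexD[OF S(1) t(2) s(2) ab] .
      have "(t + s) * (Re (q c c) - r) \<le> apply_bcontfun (u + v) (discrete q)" if q: "q \<in> P" for q
      proof -
        interpret semi_inner_product q scaleC by (rule sip[OF q])
        have "Re (q c c) \<le> \<alpha> * Re (q a a) + \<beta> * Re (q b b)"
          using ip_real_scaled_convex[OF ab] by (simp add: c_def scaleC_of_real)
        then have "(t + s) * Re (q c c) \<le> (t + s) * (\<alpha> * Re (q a a) + \<beta> * Re (q b b))"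
          using ts by (intro mult_left_mono) auto
        also have "\<dots> = ((t + s) * \<alpha>) * Re (q a a) + ((t + s) * \<beta>) * Re (q b b)" by (simp add: algebra_simps)
        also have "(t + s) * \<alpha> = t" using ts by (simp add: \<alpha>_def)
        also have "(t + s) * \<beta> = s" using ts by (simp add: \<beta>_def)
        finally show ?thesis using t(3)[OF q] s(3)[OF q] by (simp add: plus_bcontfun.rep_eq algebra_simps)
      qed
      then show ?thesis unfolding K_def using c ts by (intro CollectI exI[of _ "t + s"]) auto
    qed
  qed
  have K2: "t *\<^sub>R u \<in> K" if t0: "0 \<le> t" and uK: "u \<in> K" for t u
  proof -
    obtain s a where s: "s \<ge> 0" "a \<in> S" "\<And>q. q \<in> P \<Longrightarrow> s * (Re (q a a) - r) \<le> apply_bcontfun u (discrete q)"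
      using uK unfolding K_def by blast
    have "t * s * (Re (q a a) - r) \<le> apply_bcontfun (t *\<^sub>R u) (discrete q)" if "q \<in> P" for q
      using mult_left_mono[OF s(3)[OF that] \<open>0 \<le> t\<close>] by (simp add: scaleR_bcontfun.rep_eq mult.assoc)
    moreover have "0 \<le> t * s" using s t0 by simp
    ultimately show ?thesis unfolding K_def using s(2) by blast
  qed
  have K3: "const_bcontfun 1 \<in> K" by (rule KI) (simp add: const_bcontfun.rep_eq)
  have K4: "- const_bcontfun 1 \<notin> K"
  proof
    assume "- const_bcontfun 1 \<in> K"
    then obtain t a where t: "t \<ge> 0" "a \<in> S" "\<And>q. q \<in> P \<Longrightarrow> t * (Re (q a a) - r) \<le> - 1"
      by (auto simp: K_def uminus_bcontfun.rep_eq const_bcontfun.rep_eq)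
    obtain q where q: "q \<in> P" "r < Re (q a a)" using large[OF t(2)] by blast
    then have "0 \<le> t * (Re (q a a) - r)" using t(1) by simp
    then show False using t(3)[OF q(1)] by linarith
  qed
  have K5: "\<exists>t. t *\<^sub>R const_bcontfun 1 - u \<in> K" for u :: "('a \<Rightarrow> 'a \<Rightarrow> complex) discrete \<Rightarrow>\<^sub>C real"
    using norm_bounded[of u]
    by (intro exI[of _ "norm u"] KI) (auto simp: minus_bcontfun.rep_eq scaleR_bcontfun.rep_eq const_bcontfun.rep_eq abs_le_iff)
  obtain \<phi> :: "_ \<Rightarrow> real" where \<phi>: "linear \<phi>" "\<phi> (const_bcontfun 1) = 1" "\<And>u. u \<in> K \<Longrightarrow> 0 \<le> \<phi> u"
    using order_unit_functional[OF K1 K2 K3 K4 K5] by metis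
  interpret \<phi>: linear \<phi> by (rule \<phi>(1))
  define p where "p = (\<lambda>a b. Complex (\<phi> (ev (\<lambda>q. Re (q a b)))) (\<phi> (ev (\<lambda>q. Im (q a b)))))"
  note pw = plus_bcontfun.rep_eq minus_bcontfun.rep_eq scaleR_bcontfun.rep_eq const_bcontfun.rep_eq uminus_bcontfun.rep_eq
  have mono: "\<phi> u \<le> \<phi> v" if "\<And>q. q \<in> P \<Longrightarrow> apply_bcontfun u (discrete q) \<le> apply_bcontfun v (discrete q)" for u v
    using \<phi>(3)[OF KI, of "v - u"] that by (simp add: \<phi>.diff pw)
  have eqI: "\<phi> u = \<phi> v" if "\<And>q. q \<in> P \<Longrightarrow> apply_bcontfun u (discrete q) = apply_bcontfun v (discrete q)" for u v
    using that by (intro antisym mono) auto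
  have "semi_inner_product p scaleC"
  proof
    fix a b c :: 'a and z :: complex
    show "p (a + b) c = p a c + p b c"
      unfolding p_def complex_eq_iff complex.sel plus_complex.sel \<phi>.add[symmetric]
      by (intro conjI eqI) (auto simp: pw evRe evIm semi_inner_product.ip_add[OF sip])
    have "\<phi> (ev (\<lambda>q. Re (q (scaleC z a) b))) = \<phi> (Re z *\<^sub>R ev (\<lambda>q. Re (q a b)) - Im z *\<^sub>R ev (\<lambda>q. Im (q a b)))"
      "\<phi> (ev (\<lambda>q. Im (q (scaleC z a) b))) = \<phi> (Re z *\<^sub>R ev (\<lambda>q. Im (q a b)) + Im z *\<^sub>R ev (\<lambda>q. Re (q a b)))"
      by (rule eqI; simp add: pw evRe evIm semi_inner_product.ip_scale[OF sip])+
    then show "p (scaleC z a) b = z * p a b"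
      by (simp add: p_def complex_eq_iff \<phi>.add \<phi>.diff \<phi>.scale)
    have cm: "Re (q a b) = Re (q b a)" "Im (q a b) = - Im (q b a)" if "q \<in> P" for q
      using semi_inner_product.ip_commute[OF sip[OF that], of a b] by (simp_all add: complex_eq_iff)
    have "\<phi> (ev (\<lambda>q. Re (q a b))) = \<phi> (ev (\<lambda>q. Re (q b a)))"
      by (rule eqI) (use cm(1) in \<open>simp add: evRe\<close>)
    moreover have "\<phi> (ev (\<lambda>q. Im (q a b))) = \<phi> (- ev (\<lambda>q. Im (q b a)))"
      by (rule eqI) (use cm(2) in \<open>simp add: pw evIm\<close>)
    ultimately show "p a b = cnj (p b a)"
      by (simp add: p_def complex_eq_iff \<phi>.neg)
    show "0 \<le> Re (p a a)"
      unfolding p_def complex.sel by (intro \<phi>(3) KI) (auto simp: evRe semi_inner_product.ip_nonneg[OF sip])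
  qed
  moreover have "Re (p (c * a) (c * a)) \<le> (C * norm c)\<^sup>2 * Re (p a a)" for c a
    unfolding p_def complex.sel
    by (subst real_scaleR_def[symmetric], subst \<phi>.scale[symmetric], intro mono)
       (use P in \<open>auto simp: pw evRe module_form_def\<close>)
  moreover have "Re (p a a) \<le> (C * norm a)\<^sup>2" for a
  proof -
    have "Re (p a a) \<le> \<phi> ((C * norm a)\<^sup>2 *\<^sub>R const_bcontfun 1)"
      unfolding p_def complex.sel by (intro mono) (use P in \<open>auto simp: pw evRe module_form_def\<close>)
    then show ?thesis by (simp add: \<phi>.scale \<phi>(2))
  qed
  moreover have "r \<le> Re (p a a)" if a: "a \<in> S" for a
  proof -
    have "0 \<le> \<phi> (ev (\<lambda>q. Re (q a a)) - r *\<^sub>R const_bcontfun 1)"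
      by (intro \<phi>(3)) (use a in \<open>auto simp: K_def pw evRe intro!: exI[of _ 1] bexI[of _ a]\<close>)
    then show ?thesis by (simp add: p_def \<phi>.diff \<phi>.scale \<phi>(2))
  qed
  ultimately show ?thesis using that unfolding module_form_def by blast
qed

section \<open>Boundedness of representations\<close>

context pre_hilbert_space
begin

lemma representation_zero:
  assumes "representation H \<theta>" "x \<in> C" shows "\<theta> (0::'b::complex_banach_algebra) x = hzero H"
proof -
  have z: "scaleC 0 (0::'b) = 0" by (metis mult_zero_left norm_eq_zero norm_scaleC norm_zero)
  have "\<theta> (scaleC 0 0) x = hscale H 0 (\<theta> 0 x)" using assms by (auto simp: representation_def)
  moreover have "\<theta> 0 x \<in> C" using assms by (auto simp: representation_def bounded_operators_def)
  ultimately show ?thesis using scale_zero_left z by metis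
qed

lemma hnorm_diff_zero: "x \<in> C \<Longrightarrow> hnorm H (hdiff H (hzero H) x) = hnorm H x"
  using hnorm_diff_commute[OF zero_closed, of x] add_zero[of x] scale_zero_left[of x] scale_scale[of x "-1" 0]
    scale_zero_left zero_closed
  by (metis hdiff_def mult_zero_right)

text \<open>Measured from \<open>\<theta> 0\<close>, which is the zero operator, the distance of
  operators becomes the operator norm.\<close>

lemma representation_dist_zero_le:
  assumes "representation H \<theta>" and "\<And>x. x \<in> C \<Longrightarrow> hnorm H x \<le> 1 \<Longrightarrow> hnorm H (\<theta> a x) \<le> r"
  shows "operator_dist H (\<theta> 0) (\<theta> a) \<le> r"
proof (rule operator_dist_least)
  fix x assume x: "x \<in> C" "hnorm H x \<le> 1"
  have "\<theta> a x \<in> C" using assms(1) x(1) by (auto simp: representation_def bounded_operators_def)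
  then show "hnorm H (hdiff H (\<theta> 0 x) (\<theta> a x)) \<le> r"
    using representation_zero[OF assms(1) x(1)] hnorm_diff_zero assms(2)[OF x] by simp
qed (use assms(1) in \<open>auto simp: representation_def\<close>)

lemma representation_le_dist_zero:
  assumes rep: "representation H \<theta>" and x: "x \<in> C" "hnorm H x \<le> 1"
  shows "hnorm H (\<theta> a x) \<le> operator_dist H (\<theta> 0) (\<theta> a)"
proof -
  have b: "\<theta> 0 \<in> bounded_operators H" "\<theta> a \<in> bounded_operators H" using rep by (auto simp: representation_def)
  then have "\<theta> a x \<in> C" using x by (auto simp: bounded_operators_def)
  then show ?thesis
    using operator_dist_upper[OF b x] representation_zero[OF rep x(1)] hnorm_diff_zero by simp
qed

lemma representation_scaleR:
  assumes "representation H \<theta>" "x \<in> C" shows "\<theta> (t *\<^sub>R a) x = hscale H (of_real t) (\<theta> a x)"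
  using assms unfolding representation_def by (metis scaleC_of_real)

text \<open>Continuity at \<open>0\<close> supplies a radius \<open>\<epsilon>\<close> within which
  the operators have distance less than \<open>1\<close> from the zero operator; homogeneity, first
  in \<open>a\<close> and then in \<open>x\<close>, gives the constant
  \<open>2 / \<epsilon>\<close>.\<close>

lemma representation_bounded:
  fixes \<theta> :: "'b::complex_banach_algebra \<Rightarrow> 'v \<Rightarrow> 'v"
  assumes rep: "representation H \<theta>"
  obtains K where "\<And>a x. x \<in> C \<Longrightarrow> hnorm H (\<theta> a x) \<le> K * norm a * hnorm H x"
proof -
  interpret O: Metric_space "bounded_operators H" "operator_dist H" by (rule Metric_space_operator_dist)
  have bo: "\<theta> a \<in> bounded_operators H" for a using rep by (auto simp: representation_def)
  have cl: "\<theta> a x \<in> C" if "x \<in> C" for a x using bo[of a] that by (auto simp: bounded_operators_def)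
  have "continuous_map euclidean O.mtopology \<theta>"
    using rep unfolding representation_def operator_norm_topology_def by blast
  then have "openin euclidean {a \<in> topspace euclidean. \<theta> a \<in> O.mball (\<theta> 0) 1}"
    by (rule openin_continuous_map_preimage) (rule O.openin_mball)
  then have "open {a. \<theta> a \<in> O.mball (\<theta> 0) 1}" by simp
  moreover have "0 \<in> {a. \<theta> a \<in> O.mball (\<theta> 0) 1}" using bo by simp
  ultimately obtain \<epsilon> where \<epsilon>: "\<epsilon> > 0" "ball 0 \<epsilon> \<subseteq> {a. \<theta> a \<in> O.mball (\<theta> 0) 1}"
    using open_contains_ball by metis
  have unit: "hnorm H (\<theta> a x) \<le> 2 / \<epsilon> * norm a" if x: "x \<in> C" "hnorm H x \<le> 1" for a x
  proof (cases "a = 0")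
    case True
    then show ?thesis using representation_zero[OF rep x(1)] hnorm_eq_0[OF zero_closed] by simp
  next
    case False
    define t where "t = \<epsilon> / (2 * norm a)"
    have t: "t > 0" "norm (t *\<^sub>R a) < \<epsilon>" using False \<epsilon> by (auto simp: t_def)
    then have "t *\<^sub>R a \<in> ball 0 \<epsilon>" by simp
    then have "\<theta> (t *\<^sub>R a) \<in> O.mball (\<theta> 0) 1" using \<epsilon>(2) by blast
    then have "operator_dist H (\<theta> 0) (\<theta> (t *\<^sub>R a)) < 1" by simp
    then have "hnorm H (\<theta> (t *\<^sub>R a) x) \<le> 1" using representation_le_dist_zero[OF rep x, of "t *\<^sub>R a"] by simp
    then have "t * hnorm H (\<theta> a x) \<le> 1"
      using representation_scaleR[OF rep x(1), of t a] hnorm_scale[OF cl[OF x(1)], of "of_real t" a] t by simp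
    then show ?thesis using False \<epsilon>(1) by (simp add: t_def field_simps)
  qed
  have "hnorm H (\<theta> a x) \<le> 2 / \<epsilon> * norm a * hnorm H x" if x: "x \<in> C" for a x
  proof (cases "hnorm H x = 0")
    case True
    then have "x = hzero H" using hnorm_eq_0[OF x] by simp
    moreover have "\<theta> a (hscale H 0 x) = hscale H 0 (\<theta> a x)" using bo[of a] x unfolding bounded_operators_def by blast
    ultimately have "\<theta> a x = hzero H" using scale_zero_left x cl by metis
    then show ?thesis using True hnorm_eq_0[OF zero_closed] by simp
  next
    case False
    define y where "y = hscale H (of_real (1 / hnorm H x)) x"
    have hx: "hnorm H x > 0" using False hnorm_nonneg[OF x] by simp
    then have y: "y \<in> C" "hnorm H y \<le> 1" using x scale_closed hnorm_scale[OF x] by (auto simp: y_def norm_divide)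
    have "\<theta> a y = hscale H (of_real (1 / hnorm H x)) (\<theta> a x)"
      using bo[of a] x unfolding bounded_operators_def y_def by blast
    then have "hnorm H (\<theta> a y) = hnorm H (\<theta> a x) / hnorm H x"
      using hnorm_scale[OF cl[OF x]] hx by (simp add: norm_divide)
    then have "hnorm H (\<theta> a x) / hnorm H x \<le> 2 / \<epsilon> * norm a" using unit[OF y, of a] by simp
    then show ?thesis using hx by (simp only: pos_divide_le_eq)
  qed
  then show ?thesis using that by blast
qed

end

text \<open>\<open>P\<close> consists of the forms
  \<open>hinner H (\<theta> a h) (\<theta> b h)\<close> with \<open>h\<close> in the unit ball. The
  third conclusion is the lower estimate of an embedding, phrased as an implication in place of a
  supremum over \<open>P\<close>: since \<open>\<theta>\<close> is open onto its range, operators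
  close to zero come from elements of norm less than \<open>1\<close>.\<close>

lemma operator_algebra_module_forms:
  assumes "operator_algebra TYPE('a::complex_banach_algebra) TYPE('h)"
  obtains C \<delta> and P :: "('a::complex_banach_algebra \<Rightarrow> 'a \<Rightarrow> complex) set"
  where "\<delta> > 0" "\<And>q. q \<in> P \<Longrightarrow> module_form C q"
    "\<And>a r. 0 \<le> r \<Longrightarrow> (\<And>q. q \<in> P \<Longrightarrow> Re (q a a) \<le> r\<^sup>2) \<Longrightarrow> \<delta> * norm a \<le> r"
proof -
  obtain H :: "'h hilbert" and \<theta> :: "'a \<Rightarrow> 'h \<Rightarrow> 'h" where H: "hilbert_space H" and rep: "representation H \<theta>"
    and emb: "embedding_map euclidean (operator_norm_topology H) \<theta>"
    using assms unfolding operator_algebra_def by blast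
  interpret hilbert_space H by (rule H)
  interpret O: Metric_space "bounded_operators H" "operator_dist H" by (rule Metric_space_operator_dist)
  have bo: "\<theta> a \<in> bounded_operators H" for a using rep by (auto simp: representation_def)
  have cl: "\<theta> a x \<in> hcarrier H" if "x \<in> hcarrier H" for a x using bo[of a] that by (auto simp: bounded_operators_def)
  obtain K where K: "\<And>a x. x \<in> hcarrier H \<Longrightarrow> hnorm H (\<theta> a x) \<le> K * norm a * hnorm H x"
    using representation_bounded[OF rep] by metis
  define q where "q = (\<lambda>h a b. hinner H (\<theta> a h) (\<theta> b h))"
  define U where "U = {h \<in> hcarrier H. hnorm H h \<le> 1}"
  have qn: "Re (q h a a) = (hnorm H (\<theta> a h))\<^sup>2" if "h \<in> U" for h a
    using that by (simp add: q_def U_def hnorm_power2 cl)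
  have "module_form K (q h)" if h: "h \<in> U" for h
  proof -
    have hC: "h \<in> hcarrier H" using h by (simp add: U_def)
    have "semi_inner_product (q h) scaleC"
    proof
      show "q h (a + b) c = q h a c + q h b c" for a b c
        using rep hC cl unfolding q_def representation_def by (simp add: inner_add_left)
      show "q h (scaleC z a) b = z * q h a b" for z a b
        using rep hC cl unfolding q_def representation_def by (simp add: inner_scale_left)
      show "q h a b = cnj (q h b a)" for a b
        unfolding q_def by (rule inner_commute) (auto intro: cl hC)
      show "0 \<le> Re (q h a a)" for a using qn[OF h] by simp
    qed
    moreover have "Re (q h (c * a) (c * a)) \<le> (K * norm c)\<^sup>2 * Re (q h a a)" for c a
    proof -
      have "\<theta> (c * a) h = \<theta> c (\<theta> a h)" using rep hC unfolding representation_def by blast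
      then have "hnorm H (\<theta> (c * a) h) \<le> K * norm c * hnorm H (\<theta> a h)" using K[OF cl[OF hC], of c a] by simp
      then show ?thesis unfolding qn[OF h] power_mult_distrib[symmetric]
        by (intro power_mono) (auto intro: hnorm_nonneg cl hC)
    qed
    moreover have "Re (q h a a) \<le> (K * norm a)\<^sup>2" for a
    proof -
      have 0: "0 \<le> K * norm a * hnorm H h" using K[OF hC, of a] hnorm_nonneg[OF cl[OF hC], of a] by linarith
      have "hnorm H (\<theta> a h) \<le> \<bar>K * norm a * hnorm H h\<bar>" using K[OF hC, of a] by linarith
      also have "\<dots> = \<bar>K * norm a\<bar> * hnorm H h" using hnorm_nonneg[OF hC] by (simp add: abs_mult)
      also have "\<dots> \<le> \<bar>K * norm a\<bar> * 1" using h by (intro mult_left_mono) (auto simp: U_def)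
      finally have "(hnorm H (\<theta> a h))\<^sup>2 \<le> \<bar>K * norm a\<bar>\<^sup>2" by (intro power_mono) (auto intro: hnorm_nonneg cl hC)
      then show ?thesis unfolding qn[OF h] by simp
    qed
    ultimately show ?thesis unfolding module_form_def by blast
  qed
  note forms = this
  have om: "open_map euclidean (subtopology O.mtopology (range \<theta>)) \<theta>" and inj: "inj \<theta>"
    using homeomorphic_imp_open_map homeomorphic_imp_injective_map emb
    unfolding embedding_map_def operator_norm_topology_def by fastforce+
  have "openin (subtopology O.mtopology (range \<theta>)) (\<theta> ` ball 0 1)"
    using om unfolding open_map_def by simp
  then obtain T where T: "openin O.mtopology T" "\<theta> ` ball 0 1 = T \<inter> range \<theta>"
    unfolding openin_subtopology by blast
  have "\<theta> 0 \<in> T" using T(2) by (metis IntE centre_in_ball image_eqI zero_less_one)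
  then obtain \<epsilon> where \<epsilon>: "\<epsilon> > 0" "O.mball (\<theta> 0) \<epsilon> \<subseteq> T" using T(1) unfolding O.openin_mtopology by blast
  have small: "norm a < 1" if "\<And>x. x \<in> U \<Longrightarrow> hnorm H (\<theta> a x) \<le> \<epsilon> / 2" for a
  proof -
    have "operator_dist H (\<theta> 0) (\<theta> a) \<le> \<epsilon> / 2"
      by (rule representation_dist_zero_le[OF rep]) (use that in \<open>auto simp: U_def\<close>)
    then have "\<theta> a \<in> O.mball (\<theta> 0) \<epsilon>" using bo \<epsilon>(1) by simp
    then have "\<theta> a \<in> \<theta> ` ball 0 1" using \<epsilon>(2) T(2) by blast
    then show ?thesis using inj by (auto simp: inj_image_mem_iff)
  qed
  have "\<epsilon> / 2 * norm a \<le> r" if r: "0 \<le> r" "\<And>h. h \<in> U \<Longrightarrow> Re (q h a a) \<le> r\<^sup>2" for a r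
  proof (rule field_le_epsilon)
    fix e :: real assume e: "e > 0"
    \<comment> \<open>The arbitrary slack \<open>e\<close> in the denominator covers the case
      \<open>r = 0\<close>.\<close>
    define t where "t = \<epsilon> / (2 * (r + e))"
    have t: "t > 0" using \<epsilon> e r by (simp add: t_def)
    have "norm (t *\<^sub>R a) < 1"
    proof (rule small)
      fix x assume x: "x \<in> U"
      then have xC: "x \<in> hcarrier H" by (simp add: U_def)
      have "hnorm H (\<theta> a x) \<le> r" using r(2)[OF x] r(1) unfolding qn[OF x] by (rule power2_le_imp_le)
      then have "t * hnorm H (\<theta> a x) \<le> t * (r + e)" using t e by (intro mult_left_mono) auto
      also have "t * (r + e) = \<epsilon> / 2" using r e by (simp add: t_def field_simps)
      finally have "t * hnorm H (\<theta> a x) \<le> \<epsilon> / 2" .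
      moreover have "hnorm H (\<theta> (t *\<^sub>R a) x) = t * hnorm H (\<theta> a x)"
        using representation_scaleR[OF rep xC, of t a] hnorm_scale[OF cl[OF xC], of "of_real t" a] t by simp
      ultimately show "hnorm H (\<theta> (t *\<^sub>R a) x) \<le> \<epsilon> / 2" by simp
    qed
    then show "\<epsilon> / 2 * norm a \<le> r + e" using t r e \<epsilon> by (simp add: t_def field_simps)
  qed
  then show ?thesis using \<epsilon>(1) forms by (intro that[of "\<epsilon>/2" "q ` U" K]) auto
qed

section \<open>Hilbert modules and their completion\<close>

text \<open>The carrier is a closed subset of a Banach space type, which provides norm and
  completeness; inner product and action have to behave well on \<open>L\<close> only.\<close>

locale hilbert_module =
  fixes L :: "'e::banach set" and sc :: "complex \<Rightarrow> 'e \<Rightarrow> 'e" and inn :: "'e \<Rightarrow> 'e \<Rightarrow> complex"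
    and act :: "'a::complex_banach_algebra \<Rightarrow> 'e \<Rightarrow> 'e" and K :: real
  assumes closed_L: "closed L" and zero_L: "0 \<in> L"
    and add_L: "\<And>x y. x \<in> L \<Longrightarrow> y \<in> L \<Longrightarrow> x + y \<in> L" and sc_L: "\<And>c x. x \<in> L \<Longrightarrow> sc c x \<in> L"
    and sc_add: "\<And>c x y. sc c (x + y) = sc c x + sc c y" and add_sc: "\<And>c d x. sc (c + d) x = sc c x + sc d x"
    and sc_sc: "\<And>c d x. sc c (sc d x) = sc (c * d) x" and sc_real: "\<And>r x. sc (of_real r) x = r *\<^sub>R x"
    and inn_commute: "\<And>x y. x \<in> L \<Longrightarrow> y \<in> L \<Longrightarrow> inn x y = cnj (inn y x)"
    and inn_add: "\<And>x y z. x \<in> L \<Longrightarrow> y \<in> L \<Longrightarrow> z \<in> L \<Longrightarrow> inn (x + y) z = inn x z + inn y z"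
    and inn_sc: "\<And>c x y. x \<in> L \<Longrightarrow> y \<in> L \<Longrightarrow> inn (sc c x) y = c * inn x y"
    and inn_norm: "\<And>x. x \<in> L \<Longrightarrow> Re (inn x x) = (norm x)\<^sup>2"
    and act_L: "\<And>a x. x \<in> L \<Longrightarrow> act a x \<in> L"
    and act_add: "\<And>a x y. x \<in> L \<Longrightarrow> y \<in> L \<Longrightarrow> act a (x + y) = act a x + act a y"
    and act_sc: "\<And>a c x. x \<in> L \<Longrightarrow> act a (sc c x) = sc c (act a x)"
    and add_act: "\<And>a b x. x \<in> L \<Longrightarrow> act (a + b) x = act a x + act b x"
    and sc_act: "\<And>a c x. x \<in> L \<Longrightarrow> act (scaleC c a) x = sc c (act a x)"
    and mult_act: "\<And>a b x. x \<in> L \<Longrightarrow> act (a * b) x = act a (act b x)"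
    and act_bound: "\<And>a x. x \<in> L \<Longrightarrow> norm (act a x) \<le> K * norm a * norm x"
    and K_nonneg: "0 \<le> K"
begin

definition submodule :: "'e set \<Rightarrow> bool" where
  "submodule V \<longleftrightarrow> V \<subseteq> L \<and> closed V \<and> 0 \<in> V \<and> (\<forall>x\<in>V. \<forall>y\<in>V. x + y \<in> V) \<and> (\<forall>c. \<forall>x\<in>V. sc c x \<in> V)
    \<and> (\<forall>a. \<forall>x\<in>V. act a x \<in> V)"

lemma sc_one: "sc 1 x = x" using sc_real[of 1 x] by simp

lemma sc_neg: "sc (-1) x = - x" using sc_real[of "-1" x] by simp

lemma subspace_submodule: "submodule V \<Longrightarrow> subspace V"
  unfolding submodule_def subspace_def by (metis sc_real)

lemma neg_L: "x \<in> L \<Longrightarrow> - x \<in> L"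
  using sc_L[of x "-1"] by (simp add: sc_neg)

lemma diff_L: "x \<in> L \<Longrightarrow> y \<in> L \<Longrightarrow> x - y \<in> L"
  using add_L[of x "- y"] sc_L[of y "-1"] by (simp add: sc_neg)

section \<open>Transport of a Hilbert module to a prescribed type of vectors\<close>

context
  fixes j :: "'e \<Rightarrow> 'u"
  assumes j: "inj_on j L"
begin

definition jinv where "jinv = inv_into L j"

lemma jinv [simp]: "x \<in> L \<Longrightarrow> jinv (j x) = x"
  unfolding jinv_def using j by (rule inv_into_f_f)

text \<open>The reduction property speaks of structures over the vector type \<open>'u\<close>, so
  the module is copied along the injection \<open>j\<close>: each operation decodes, computes and
  encodes.\<close>

definition transported :: "'u hilbert" where
  "transported = \<lparr>hcarrier = j ` L, hzero = j 0, hadd = \<lambda>x y. j (jinv x + jinv y),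
     hscale = \<lambda>c x. j (sc c (jinv x)), hinner = \<lambda>x y. inn (jinv x) (jinv y)\<rparr>"

lemma transported_simps [simp]:
  "hcarrier transported = j ` L" "hzero transported = j 0"
  "x \<in> L \<Longrightarrow> y \<in> L \<Longrightarrow> hadd transported (j x) (j y) = j (x + y)"
  "x \<in> L \<Longrightarrow> hscale transported c (j x) = j (sc c x)"
  "x \<in> L \<Longrightarrow> y \<in> L \<Longrightarrow> hinner transported (j x) (j y) = inn x y"
  by (simp_all add: transported_def)

lemma transported_diff [simp]: "x \<in> L \<Longrightarrow> y \<in> L \<Longrightarrow> hdiff transported (j x) (j y) = j (x - y)"
  by (simp add: hdiff_def sc_neg neg_L)

lemma transported_norm [simp]: "x \<in> L \<Longrightarrow> hnorm transported (j x) = norm x"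
  by (simp add: hnorm_def inn_norm)

lemma transported_dist [simp]: "x \<in> L \<Longrightarrow> y \<in> L \<Longrightarrow> hdist transported (j x) (j y) = dist x y"
  by (simp add: hdist_def diff_L dist_norm)

lemma j_eq [simp]: "x \<in> L \<Longrightarrow> y \<in> L \<Longrightarrow> j x = j y \<longleftrightarrow> x = y"
  using j by (auto simp: inj_on_def)

lemma pre_hilbert_transported: "pre_hilbert_space transported"
proof
  fix x y z c d
  show "hzero transported \<in> hcarrier transported" using zero_L by simp
  assume "x \<in> hcarrier transported"
  then obtain x' where x: "x = j x'" "x' \<in> L" by auto
  show "hscale transported c x \<in> hcarrier transported" "hadd transported x (hzero transported) = x"
    "hdiff transported x x = hzero transported" "hscale transported 1 x = x"
    "hscale transported c (hscale transported d x) = hscale transported (c * d) x"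
    "hscale transported (c + d) x = hadd transported (hscale transported c x) (hscale transported d x)"
    using x sc_L zero_L by (simp_all add: sc_sc add_sc sc_one)
  show "x \<noteq> hzero transported \<Longrightarrow> 0 < Re (hinner transported x x)"
    using x zero_L by (simp add: inn_norm)
  assume "y \<in> hcarrier transported"
  then obtain y' where y: "y = j y'" "y' \<in> L" by auto
  show "hadd transported x y \<in> hcarrier transported" "hadd transported x y = hadd transported y x"
    "hscale transported c (hadd transported x y) = hadd transported (hscale transported c x) (hscale transported c y)"
    "hinner transported (hscale transported c x) y = c * hinner transported x y"
    using x y add_L sc_L by (simp_all add: add.commute sc_add inn_sc)
  show "hinner transported x y = cnj (hinner transported y x)"
    using inn_commute[OF x(2) y(2)] x y by simp
  assume "z \<in> hcarrier transported"
  then obtain z' where z: "z = j z'" "z' \<in> L" by auto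
  show "hadd transported (hadd transported x y) z = hadd transported x (hadd transported y z)"
    "hinner transported (hadd transported x y) z = hinner transported x z + hinner transported y z"
    using x y z add_L by (simp_all add: add.assoc inn_add)
qed

interpretation T: pre_hilbert_space transported by (rule pre_hilbert_transported)

interpretation M: Metric_space "j ` L" "hdist transported"
  using T.Metric_space_hdist by simp

lemma hilbert_transported: "hilbert_space transported"
proof (intro hilbert_space.intro hilbert_space_axioms.intro pre_hilbert_transported)
  have "M.mcomplete"
    unfolding M.mcomplete_def
  proof (intro allI impI)
    fix \<sigma> assume s: "M.MCauchy \<sigma>"
    then have "\<forall>n. \<exists>x\<in>L. \<sigma> n = j x" unfolding M.MCauchy_def by blast
    then obtain f where f: "\<And>n. f n \<in> L" "\<And>n. \<sigma> n = j (f n)" by metis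
    have "Cauchy f" using s f unfolding M.MCauchy_def Cauchy_def by simp
    then obtain l where l: "f \<longlonglongrightarrow> l" using Cauchy_convergent convergent_def by blast
    have lL: "l \<in> L" by (rule closed_sequentially[OF closed_L _ l]) (use f in auto)
    have "limitin M.mtopology \<sigma> (j l) sequentially"
      unfolding M.limitin_metric
    proof (intro conjI allI impI)
      show "j l \<in> j ` L" using lL by blast
      fix \<epsilon> :: real assume "\<epsilon> > 0"
      from tendstoD[OF l this]
      show "\<forall>\<^sub>F n in sequentially. \<sigma> n \<in> j ` L \<and> hdist transported (\<sigma> n) (j l) < \<epsilon>"
        by eventually_elim (use f lL in simp)
    qed
    then show "\<exists>x. limitin M.mtopology \<sigma> x sequentially" by blast
  qed
  then show "Metric_space.mcomplete (hcarrier transported) (hdist transported)" by simp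
qed

text \<open>Both notions say that the points of \<open>L - U\<close> have positive distance from
  \<open>U\<close>. For the ambient topology this uses that \<open>L\<close> is closed: limits of
  points of \<open>U\<close> stay in \<open>L\<close>.\<close>

lemma closedin_transported:
  assumes "U \<subseteq> L" shows "closedin (norm_topology transported) (j ` U) \<longleftrightarrow> closed U"
proof -
  have "closedin M.mtopology (j ` U) \<longleftrightarrow> (\<forall>x\<in>L - U. \<exists>r>0. \<forall>y\<in>U. r \<le> dist x y)"
  proof
    assume c: "closedin M.mtopology (j ` U)"
    show "\<forall>x\<in>L - U. \<exists>r>0. \<forall>y\<in>U. r \<le> dist x y"
    proof
      fix x assume x: "x \<in> L - U"
      then have "j x \<in> j ` L - j ` U" using assms by auto
      then obtain r where r: "r > 0" "disjnt (j ` U) (M.mball (j x) r)" using c unfolding M.closedin_metric by blast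
      have "r \<le> dist x y" if y: "y \<in> U" for y
      proof (rule ccontr)
        assume "\<not> r \<le> dist x y"
        then have "j y \<in> M.mball (j x) r" using x y assms by auto
        then show False using r(2) y unfolding disjnt_def by blast
      qed
      then show "\<exists>r>0. \<forall>y\<in>U. r \<le> dist x y" using r(1) by blast
    qed
  next
    assume R: "\<forall>x\<in>L - U. \<exists>r>0. \<forall>y\<in>U. r \<le> dist x y"
    show "closedin M.mtopology (j ` U)"
      unfolding M.closedin_metric
    proof (intro conjI allI impI)
      show "j ` U \<subseteq> j ` L" using assms by blast
      fix x assume "x \<in> j ` L - j ` U"
      then obtain x' where x: "x = j x'" "x' \<in> L - U" by blast
      then obtain r where r: "r > 0" "\<And>y. y \<in> U \<Longrightarrow> r \<le> dist x' y" using R by blast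
      have "disjnt (j ` U) (M.mball x r)"
        unfolding disjnt_iff using r(2) x assms by (fastforce simp: subset_iff)
      then show "\<exists>r>0. disjnt (j ` U) (M.mball x r)" using r(1) by blast
    qed
  qed
  also have "\<dots> \<longleftrightarrow> closed U"
  proof
    assume R: "\<forall>x\<in>L - U. \<exists>r>0. \<forall>y\<in>U. r \<le> dist x y"
    show "closed U" unfolding closed_sequential_limits
    proof (intro allI impI, elim conjE)
      fix f l assume f: "\<forall>n. f n \<in> U" "f \<longlonglongrightarrow> l"
      have "l \<in> L" by (rule closed_sequentially[OF closed_L _ f(2)]) (use f assms in auto)
      show "l \<in> U"
      proof (rule ccontr)
        assume "l \<notin> U"
        then obtain r where r: "r > 0" "\<And>y. y \<in> U \<Longrightarrow> r \<le> dist l y" using R \<open>l \<in> L\<close> by blast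
        obtain n where "dist (f n) l < r" using LIMSEQ_D[OF f(2), unfolded dist_norm[symmetric], OF r(1)] by auto
        then show False using r(2)[of "f n"] f(1) by (simp add: dist_commute)
      qed
    qed
  next
    assume "closed U"
    then have "open (- U)" by (rule open_Compl)
    show "\<forall>x\<in>L - U. \<exists>r>0. \<forall>y\<in>U. r \<le> dist x y"
    proof
      fix x assume "x \<in> L - U"
      then obtain r where "r > 0" "ball x r \<subseteq> - U" using \<open>open (- U)\<close> open_contains_ball by blast
      then show "\<exists>r>0. \<forall>y\<in>U. r \<le> dist x y" by (intro exI[of _ r]) (auto simp: subset_iff not_less)
    qed
  qed
  finally show ?thesis by (simp add: norm_topology_def)
qed

definition tact :: "'a \<Rightarrow> 'u \<Rightarrow> 'u" where
  "tact a = restrict (\<lambda>x. j (act a (jinv x))) (j ` L)"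

lemma tact [simp]: "x \<in> L \<Longrightarrow> tact a (j x) = j (act a x)" by (simp add: tact_def)

lemma tact_bounded: "tact a \<in> bounded_operators transported"
proof -
  have "\<exists>M. \<forall>x\<in>hcarrier transported. hnorm transported (tact a x) \<le> M * hnorm transported x"
    using act_bound act_L by (intro exI[of _ "K * norm a"]) auto
  moreover have "tact a \<in> j ` L \<rightarrow>\<^sub>E j ` L" using act_L by (auto simp: tact_def)
  ultimately show ?thesis
    unfolding bounded_operators_def using act_add act_sc act_L sc_L add_L by auto
qed

lemma representation_transported: "representation transported tact"
proof -
  interpret O: Metric_space "bounded_operators transported" "operator_dist transported"
    by (rule T.Metric_space_operator_dist)
  have d: "operator_dist transported (tact a) (tact b) \<le> K * norm (a - b)" for a b
  proof (rule T.operator_dist_least[OF tact_bounded tact_bounded])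
    fix x assume "x \<in> hcarrier transported" "hnorm transported x \<le> 1"
    then obtain x' where x: "x = j x'" "x' \<in> L" "norm x' \<le> 1" by auto
    have "act (a - b) x' + act b x' = act a x'" using add_act[OF x(2), of "a - b" b] by simp
    then have "hnorm transported (hdiff transported (tact a x) (tact b x)) = norm (act (a - b) x')"
      using x act_L diff_L by (simp add: eq_diff_eq[symmetric] add.commute)
    also have "\<dots> \<le> K * norm (a - b) * norm x'" by (rule act_bound[OF x(2)])
    also have "\<dots> \<le> K * norm (a - b) * 1" using x K_nonneg by (intro mult_left_mono) auto
    finally show "hnorm transported (hdiff transported (tact a x) (tact b x)) \<le> K * norm (a - b)" by simp
  qed
  have "continuous_map euclidean O.mtopology tact"
    unfolding O.continuous_map_to_metric
  proof (intro ballI allI impI)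
    fix a :: 'a and \<epsilon> :: real assume e: "\<epsilon> > 0"
    \<comment> \<open>The radius is \<open>\<epsilon> / (K + 1)\<close> because \<open>K\<close> may
      be \<open>0\<close>.\<close>
    have "operator_dist transported (tact a) (tact b) < \<epsilon>" if "b \<in> ball a (\<epsilon> / (K + 1))" for b
    proof -
      have "norm (a - b) * (K + 1) < \<epsilon>" using that K_nonneg by (simp add: dist_norm pos_less_divide_eq)
      moreover have "K * norm (a - b) \<le> norm (a - b) * (K + 1)" by (simp add: algebra_simps)
      ultimately show ?thesis using d[of a b] by linarith
    qed
    then show "\<exists>U. openin euclidean U \<and> a \<in> U \<and> (\<forall>y\<in>U. tact y \<in> O.mball (tact a) \<epsilon>)"
      using e K_nonneg tact_bounded by (intro exI[of _ "ball a (\<epsilon> / (K + 1))"]) auto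
  qed
  then show ?thesis
    unfolding representation_def operator_norm_topology_def
    using tact_bounded add_act sc_act mult_act act_L by auto
qed

lemma invariant_transported:
  assumes "U \<subseteq> L" shows "invariant_subspace transported tact (j ` U) \<longleftrightarrow> submodule U"
proof -
  have m: "j x \<in> j ` U \<longleftrightarrow> x \<in> U" if "x \<in> L" for x using assms that by (auto dest: subsetD)
  have "j ` U \<subseteq> hcarrier transported" using assms by auto
  moreover have "hzero transported \<in> j ` U \<longleftrightarrow> 0 \<in> U" using m zero_L by simp
  moreover have "(\<forall>x\<in>j ` U. \<forall>y\<in>j ` U. hadd transported x y \<in> j ` U) \<longleftrightarrow> (\<forall>x\<in>U. \<forall>y\<in>U. x + y \<in> U)"
    using assms m add_L by (auto simp: subset_iff)
  moreover have "(\<forall>c. \<forall>x\<in>j ` U. hscale transported c x \<in> j ` U) \<longleftrightarrow> (\<forall>c. \<forall>x\<in>U. sc c x \<in> U)"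
    using assms m sc_L by (auto simp: subset_iff)
  moreover have "(\<forall>a. \<forall>x\<in>j ` U. tact a x \<in> j ` U) \<longleftrightarrow> (\<forall>a. \<forall>x\<in>U. act a x \<in> U)"
    using assms m act_L by (auto simp: subset_iff)
  ultimately show ?thesis
    unfolding invariant_subspace_def closed_subspace_def submodule_def closedin_transported[OF assms]
    using assms by blast
qed

lemma submodule_complement:
  assumes trp: "total_reduction_property TYPE('a) TYPE('u)" and V: "submodule V"
  obtains W where "submodule W" "V \<inter> W = {0}" "L = {v + w | v w. v \<in> V \<and> w \<in> W}"
proof -
  have VL: "V \<subseteq> L" using V by (simp add: submodule_def)
  obtain W' where W': "invariant_subspace transported tact W'" "direct_sum transported (j ` V) W'"
    using trp hilbert_transported representation_transported V invariant_transported[OF VL]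
    unfolding total_reduction_property_def by blast
  \<comment> \<open>As an invariant subspace, \<open>W'\<close> lies in the image of
    \<open>L\<close>, so it is the image of its preimage \<open>W\<close>.\<close>
  define W where "W = {x \<in> L. j x \<in> W'}"
  have WL: "W \<subseteq> L" by (auto simp: W_def)
  have "W' \<subseteq> j ` L" using W' by (auto simp: invariant_subspace_def closed_subspace_def)
  then have jW: "W' = j ` W" by (auto simp: W_def)
  have "submodule W" using W'(1) invariant_transported[OF WL] jW by simp
  moreover have "V \<inter> W = {0}"
  proof -
    have "j ` V \<inter> j ` W = {j 0}" using W'(2) jW by (simp add: direct_sum_def)
    then have "j ` (V \<inter> W) = j ` {0}" using inj_on_image_Int[OF j VL WL] by simp
    then show ?thesis using inj_on_image_eq_iff[OF j, of "V \<inter> W" "{0}"] VL zero_L by auto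
  qed
  moreover have "L = {v + w | v w. v \<in> V \<and> w \<in> W}"
  proof
    show "{v + w | v w. v \<in> V \<and> w \<in> W} \<subseteq> L" using VL WL add_L by auto
    show "L \<subseteq> {v + w | v w. v \<in> V \<and> w \<in> W}"
    proof
      fix x assume x: "x \<in> L"
      have "j ` L = {hadd transported v w | v w. v \<in> j ` V \<and> w \<in> j ` W}"
        using W'(2) jW by (simp add: direct_sum_def)
      then have "j x \<in> {hadd transported v w | v w. v \<in> j ` V \<and> w \<in> j ` W}" using x by blast
      then obtain v w where vw: "v \<in> V" "w \<in> W" "j x = hadd transported (j v) (j w)" by blast
      then have "j x = j (v + w)" "v + w \<in> L" using VL WL add_L by (auto simp: subset_iff)
      then have "x = v + w" using x by simp
      then show "x \<in> {v + w | v w. v \<in> V \<and> w \<in> W}" using vw by blast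
    qed
  qed
  ultimately show ?thesis using that by blast
qed

end

end

section \<open>Complex scalars and polarization for bounded functions\<close>

instance bcontfun :: (metric_space, banach) banach ..

definition scaleC_bcontfun :: "complex \<Rightarrow> ('i::topological_space \<Rightarrow>\<^sub>C complex) \<Rightarrow> ('i \<Rightarrow>\<^sub>C complex)" where
  "scaleC_bcontfun c f = Bcontfun (\<lambda>x. c * apply_bcontfun f x)"

lemma apply_scaleC_bcontfun: "apply_bcontfun (scaleC_bcontfun c f) x = c * apply_bcontfun f x"
proof -
  have "bounded (range (\<lambda>x. c * apply_bcontfun f x))"
    by (rule boundedI[of _ "cmod c * norm f"]) (auto simp: norm_mult intro!: mult_left_mono norm_bounded)
  then have "(\<lambda>x. c * apply_bcontfun f x) \<in> bcontfun"
    by (auto simp: bcontfun_def intro!: continuous_intros)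
  then show ?thesis by (simp add: scaleC_bcontfun_def Bcontfun_inverse)
qed

lemma norm_scaleC_bcontfun: "norm (scaleC_bcontfun c f) = cmod c * norm f"
proof -
  have le: "norm (scaleC_bcontfun d g) \<le> cmod d * norm g" for d and g :: "'a \<Rightarrow>\<^sub>C complex"
    by (rule norm_bound) (auto simp: apply_scaleC_bcontfun norm_mult intro!: mult_left_mono norm_bounded)
  show ?thesis
  proof (cases "c = 0")
    case True
    then show ?thesis using le[of c f] by simp
  next
    case False
    then have "f = scaleC_bcontfun (inverse c) (scaleC_bcontfun c f)"
      by (intro bcontfun_eqI) (simp add: apply_scaleC_bcontfun)
    then have "norm f \<le> cmod (inverse c) * norm (scaleC_bcontfun c f)" using le by metis
    then have "cmod c * norm f \<le> cmod c * (cmod (inverse c) * norm (scaleC_bcontfun c f))"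
      by (intro mult_left_mono) auto
    also have "\<dots> = norm (scaleC_bcontfun c f)" using False by (simp flip: mult.assoc norm_mult)
    finally show ?thesis using le[of c f] by simp
  qed
qed

lemma scaleC_bcontfun_add: "scaleC_bcontfun c (f + g) = scaleC_bcontfun c f + scaleC_bcontfun c g"
  by (intro bcontfun_eqI) (simp add: apply_scaleC_bcontfun plus_bcontfun.rep_eq algebra_simps)

lemma scaleC_bcontfun_add_left: "scaleC_bcontfun (c + d) f = scaleC_bcontfun c f + scaleC_bcontfun d f"
  by (intro bcontfun_eqI) (simp add: apply_scaleC_bcontfun plus_bcontfun.rep_eq algebra_simps)

lemma scaleC_bcontfun_scaleC: "scaleC_bcontfun c (scaleC_bcontfun d f) = scaleC_bcontfun (c * d) f"
  by (intro bcontfun_eqI) (simp add: apply_scaleC_bcontfun)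

lemma scaleC_bcontfun_of_real: "scaleC_bcontfun (of_real r) f = r *\<^sub>R f"
  by (intro bcontfun_eqI) (simp add: apply_scaleC_bcontfun scaleR_bcontfun.rep_eq scaleR_conv_of_real)

lemma bounded_linear_scaleC_bcontfun: "bounded_linear (scaleC_bcontfun c)"
proof (rule bounded_linear_intro[where K = "cmod c"])
  show "scaleC_bcontfun c (r *\<^sub>R x) = r *\<^sub>R scaleC_bcontfun c x" for r x
    by (simp add: scaleC_bcontfun_scaleC mult.commute flip: scaleC_bcontfun_of_real)
qed (simp_all add: scaleC_bcontfun_add norm_scaleC_bcontfun)

lemmas continuous_on_scaleC_bcontfun [continuous_intros] =
  bounded_linear.continuous_on[OF bounded_linear_scaleC_bcontfun]

text \<open>The polarization identity, so that the inner product of the completion is given by the norm and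
  its continuity is immediate.\<close>

definition polar :: "('i::topological_space \<Rightarrow>\<^sub>C complex) \<Rightarrow> ('i \<Rightarrow>\<^sub>C complex) \<Rightarrow> complex" where
  "polar x y = Complex (((norm (x + y))\<^sup>2 - (norm (x - y))\<^sup>2) / 4)
     (((norm (x + scaleC_bcontfun \<i> y))\<^sup>2 - (norm (x - scaleC_bcontfun \<i> y))\<^sup>2) / 4)"

lemma continuous_on_polar [continuous_intros]:
  assumes "continuous_on S f" "continuous_on S g" shows "continuous_on S (\<lambda>x. polar (f x) (g x))"
  unfolding polar_def Complex_eq by (auto intro!: continuous_intros assms)

lemma continuous_eq_on_closure:
  fixes f g :: "'b::metric_space \<Rightarrow> 'c::real_normed_vector"
  assumes "continuous_on (closure S) f" "continuous_on (closure S) g" "\<And>x. x \<in> S \<Longrightarrow> f x = g x" "x \<in> closure S"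
  shows "f x = g x"
  using continuous_constant_on_closure[of S "\<lambda>x. f x - g x" 0 x] assms by (auto intro: continuous_intros)

section \<open>Completion of a semi-inner product\<close>

context semi_inner_product
begin

text \<open>The functional \<open>ip u\<close> restricted to normalized vectors: bounded functions with the supremum norm are
  complete, hence the closure of the range is the completion. Where \<open>snorm v = 0\<close>, the value is \<open>0\<close>.\<close>

definition emb :: "'x \<Rightarrow> 'x discrete \<Rightarrow>\<^sub>C complex" where
  "emb u = bounded_fun (\<lambda>v. ip u v / of_real (snorm v))"

lemma cmod_emb_le: "cmod (ip u v / of_real (snorm v)) \<le> snorm u"
  using cmod_ip_le[of u v] by (cases "snorm v = 0") (auto simp: norm_divide divide_simps less_le)

lemma apply_emb: "apply_bcontfun (emb u) (discrete v) = ip u v / of_real (snorm v)"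
  unfolding emb_def by (rule apply_bounded_fun) (use cmod_emb_le in \<open>auto intro!: boundedI\<close>)

lemma emb_add: "emb (u + v) = emb u + emb v"
  by (rule bounded_fun_eqI) (simp add: apply_emb plus_bcontfun.rep_eq ip_add add_divide_distrib)

lemma emb_diff: "emb (u - v) = emb u - emb v"
  by (rule bounded_fun_eqI) (simp add: apply_emb minus_bcontfun.rep_eq ip_diff diff_divide_distrib)

lemma emb_scale: "emb (cs c u) = scaleC_bcontfun c (emb u)"
  by (rule bounded_fun_eqI) (simp add: apply_emb apply_scaleC_bcontfun ip_scale)

lemma emb_zero: "emb 0 = 0"
  using emb_add[of 0 0] by simp

lemma norm_emb: "norm (emb u) = snorm u"
proof (rule antisym)
  show "norm (emb u) \<le> snorm u"
  proof (rule norm_bound)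
    fix x show "norm (apply_bcontfun (emb u) x) \<le> snorm u"
      using apply_emb[of u "of_discrete x"] cmod_emb_le by (simp add: of_discrete_inverse)
  qed
  \<comment> \<open>The supremum is attained at \<open>u\<close> itself; for
    \<open>snorm u = 0\<close> both sides are \<open>0\<close>.\<close>
  have "apply_bcontfun (emb u) (discrete u) = of_real (snorm u)"
    using ip_self[of u] snorm_power2[of u] by (simp add: apply_emb power2_eq_square flip: of_real_divide) (metis nonzero_mult_div_cancel_left of_real_divide division_ring_divide_zero div_by_0 of_real_0 mult_zero_left)
  then show "snorm u \<le> norm (emb u)" using norm_bounded[of "emb u" "discrete u"] by simp
qed

lemma polar_emb: "polar (emb u) (emb v) = ip u v"
proof -
  have *: "(norm (emb u + emb w))\<^sup>2 - (norm (emb u - emb w))\<^sup>2 = 4 * Re (ip u w)" for w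
    using ip_commute[of w u]
    by (simp add: norm_emb snorm_power2 ip_add ip_diff ip_add_right ip_minus_right ip_add_right[of _ _ "- w", simplified] flip: emb_add emb_diff)
  show ?thesis
    using *[of v] *[of "cs \<i> v"] by (simp add: polar_def complex_eq_iff ip_scale_right flip: emb_scale)
qed

definition completion :: "('x discrete \<Rightarrow>\<^sub>C complex) set" where "completion = closure (range emb)"

lemma emb_in_completion [simp]: "emb u \<in> completion"
  unfolding completion_def by (rule subsetD[OF closure_subset]) (rule rangeI)

text \<open>The density principle by which the completion inherits its identities. Identities in
  several variables are extended in one variable at a time, while the remaining ones are still
  embedded vectors.\<close>

lemma completion_eq:
  fixes f g :: "('x discrete \<Rightarrow>\<^sub>C complex) \<Rightarrow> 'c::real_normed_vector"
  assumes "continuous_on completion f" "continuous_on completion g" "\<And>u. f (emb u) = g (emb u)" "x \<in> completion"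
  shows "f x = g x"
proof (rule continuous_eq_on_closure[of "range emb" f g x])
  show "f y = g y" if "y \<in> range emb" for y using that assms(3) by blast
qed (use assms in \<open>simp_all only: completion_def\<close>)

lemma completion_map:
  assumes f: "continuous_on completion f" and "\<And>u. f (emb u) \<in> completion" and "x \<in> completion"
  shows "f x \<in> completion"
proof -
  have "f ` closure (range emb) \<subseteq> completion"
    by (rule image_closure_subset) (use f assms(2) in \<open>auto simp: completion_def\<close>)
  then show ?thesis using assms(3) by (auto simp: completion_def)
qed

lemma completion_scale: "x \<in> completion \<Longrightarrow> scaleC_bcontfun c x \<in> completion"
  by (rule completion_map) (auto intro!: continuous_intros simp flip: emb_scale)

lemma completion_add:
  assumes x: "x \<in> completion" and y: "y \<in> completion" shows "x + y \<in> completion"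
proof -
  have "emb u + y \<in> completion" for u
    by (rule completion_map[OF _ _ y]) (auto intro!: continuous_intros simp flip: emb_add)
  then show ?thesis by (intro completion_map[OF _ _ x, of "\<lambda>x. x + y"]) (auto intro!: continuous_intros)
qed

lemma polar_commute:
  assumes x: "x \<in> completion" and y: "y \<in> completion" shows "polar x y = cnj (polar y x)"
proof -
  have "polar (emb u) y = cnj (polar y (emb u))" for u
    by (rule completion_eq[OF _ _ _ y]) (auto intro!: continuous_intros simp: polar_emb simp flip: ip_commute)
  then show ?thesis by (intro completion_eq[OF _ _ _ x, of "\<lambda>x. polar x y"]) (auto intro!: continuous_intros)
qed

lemma polar_add:
  assumes x: "x \<in> completion" and y: "y \<in> completion" and z: "z \<in> completion"
  shows "polar (x + y) z = polar x z + polar y z"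
proof -
  have "polar (emb u + emb v) z = polar (emb u) z + polar (emb v) z" for u v
    by (rule completion_eq[OF _ _ _ z]) (auto intro!: continuous_intros simp: polar_emb ip_add simp flip: emb_add)
  then have "polar (emb u + y) z = polar (emb u) z + polar y z" for u
    by (intro completion_eq[OF _ _ _ y, of "\<lambda>y. polar (emb u + y) z"]) (auto intro!: continuous_intros)
  then show ?thesis by (intro completion_eq[OF _ _ _ x, of "\<lambda>x. polar (x + y) z"]) (auto intro!: continuous_intros)
qed

lemma polar_scale:
  assumes x: "x \<in> completion" and y: "y \<in> completion"
  shows "polar (scaleC_bcontfun c x) y = c * polar x y"
proof -
  have "polar (scaleC_bcontfun c (emb u)) y = c * polar (emb u) y" for u
    by (rule completion_eq[OF _ _ _ y]) (auto intro!: continuous_intros simp: polar_emb ip_scale simp flip: emb_scale)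
  then show ?thesis
    by (intro completion_eq[OF _ _ _ x, of "\<lambda>x. polar (scaleC_bcontfun c x) y"]) (auto intro!: continuous_intros)
qed

lemma polar_norm: "x \<in> completion \<Longrightarrow> Re (polar x x) = (norm x)\<^sup>2"
  by (rule completion_eq[of "\<lambda>x. Re (polar x x)"]) (auto intro!: continuous_intros simp: polar_emb norm_emb snorm_power2)

end

section \<open>Extension of a bounded action to the completion\<close>

locale semi_inner_module = semi_inner_product ip cs
  for ip :: "'x::ab_group_add \<Rightarrow> 'x \<Rightarrow> complex" and cs :: "complex \<Rightarrow> 'x \<Rightarrow> 'x" +
  fixes act :: "'a::complex_banach_algebra \<Rightarrow> 'x \<Rightarrow> 'x" and K :: real
  assumes act_add: "act a (x + y) = act a x + act a y"
    and act_cs: "act a (cs c x) = cs c (act a x)"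
    and add_act: "act (a + b) x = act a x + act b x"
    and cs_act: "act (scaleC c a) x = cs c (act a x)"
    and mult_act: "act (a * b) x = act a (act b x)"
    and act_bound: "Re (ip (act a x) (act a x)) \<le> (K * norm a)\<^sup>2 * Re (ip x x)"
    and K_nonneg: "0 \<le> K"
begin

lemma norm_emb_act: "norm (emb (act a u)) \<le> K * norm a * norm (emb u)"
  unfolding norm_emb
  by (rule power2_le_imp_le) (use act_bound K_nonneg in \<open>auto simp: power_mult_distrib snorm_power2\<close>)

lemma act_diff: "act a (x - y) = act a x - act a y"
  using act_add[of a "x - y" y] by simp

text \<open>The action is Lipschitz for the seminorm, so vectors with equal embeddings have images
  with equal embeddings. Hence the choice made by \<open>inv emb\<close> is harmless, and the
  resulting Lipschitz map extends to the closure.\<close>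

lemma extension_exists:
  "\<exists>g. continuous_on completion g \<and> (\<forall>u. g (emb u) = emb (act a u))"
proof -
  define f where "f = (\<lambda>x. emb (act a (inv emb x)))"
  have d: "dist (emb (act a u)) (emb (act a v)) \<le> K * norm a * dist (emb u) (emb v)" for u v
    using norm_emb_act[of a "u - v"] by (simp add: dist_norm act_diff emb_diff)
  have f: "f (emb u) = emb (act a u)" for u
  proof -
    have "emb (inv emb (emb u)) = emb u" by (simp add: f_inv_into_f)
    then show ?thesis using d[of "inv emb (emb u)" u] by (simp add: f_def)
  qed
  have "(K * norm a)-lipschitz_on (range emb) f"
    by (rule lipschitz_onI) (use d K_nonneg in \<open>auto simp: f\<close>)
  then have "uniformly_continuous_on (range emb) f" by (rule lipschitz_on_uniformly_continuous)
  then obtain g where "uniformly_continuous_on (closure (range emb)) g" "\<And>x. x \<in> range emb \<Longrightarrow> f x = g x"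
    using uniformly_continuous_on_extension_on_closure by metis
  then show ?thesis
    using f by (intro exI[of _ g]) (auto simp: completion_def intro: uniformly_continuous_imp_continuous)
qed

definition ext :: "'a \<Rightarrow> ('x discrete \<Rightarrow>\<^sub>C complex) \<Rightarrow> 'x discrete \<Rightarrow>\<^sub>C complex" where
  "ext a = (SOME g. continuous_on completion g \<and> (\<forall>u. g (emb u) = emb (act a u)))"

lemma continuous_on_ext: "continuous_on completion (ext a)" and ext_emb: "ext a (emb u) = emb (act a u)"
  using someI_ex[OF extension_exists[of a]] by (auto simp: ext_def)

lemma ext_completion: "x \<in> completion \<Longrightarrow> ext a x \<in> completion"
  by (rule completion_map[OF continuous_on_ext]) (auto simp: ext_emb)

lemma continuous_on_ext_comp:
  "continuous_on S f \<Longrightarrow> f ` S \<subseteq> completion \<Longrightarrow> continuous_on S (\<lambda>x. ext a (f x))"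
  by (rule continuous_on_compose2[OF continuous_on_ext])

lemma hilbert_module_completion: "hilbert_module completion scaleC_bcontfun polar ext K"
proof
  show "closed completion" by (simp add: completion_def)
  show "0 \<in> completion" using emb_in_completion[of 0] by (simp add: emb_zero)
  fix a b :: 'a and c d x y z r
  show "scaleC_bcontfun (of_real r) x = r *\<^sub>R x" for x :: "'x discrete \<Rightarrow>\<^sub>C complex" by (rule scaleC_bcontfun_of_real)
  show "scaleC_bcontfun c (x + y) = scaleC_bcontfun c x + scaleC_bcontfun c y" for x y :: "'x discrete \<Rightarrow>\<^sub>C complex"
    by (rule scaleC_bcontfun_add)
  show "scaleC_bcontfun (c + d) x = scaleC_bcontfun c x + scaleC_bcontfun d x" for x :: "'x discrete \<Rightarrow>\<^sub>C complex"
    by (rule scaleC_bcontfun_add_left)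
  show "scaleC_bcontfun c (scaleC_bcontfun d x) = scaleC_bcontfun (c * d) x" for x :: "'x discrete \<Rightarrow>\<^sub>C complex"
    by (rule scaleC_bcontfun_scaleC)
  assume x: "x \<in> completion"
  show "scaleC_bcontfun c x \<in> completion" using x by (rule completion_scale)
  show "Re (polar x x) = (norm x)\<^sup>2" using x by (rule polar_norm)
  show "ext a x \<in> completion" using x by (rule ext_completion)
  show "ext a (scaleC_bcontfun c x) = scaleC_bcontfun c (ext a x)"
    by (rule completion_eq[OF _ _ _ x])
       (auto intro!: continuous_intros continuous_on_ext_comp completion_scale simp: ext_emb act_cs simp flip: emb_scale)
  show "ext (a + b) x = ext a x + ext b x"
    by (rule completion_eq[OF _ _ _ x]) (auto intro!: continuous_intros continuous_on_ext simp: ext_emb add_act emb_add)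
  show "ext (scaleC c a) x = scaleC_bcontfun c (ext a x)"
    by (rule completion_eq[OF _ _ _ x]) (auto intro!: continuous_intros continuous_on_ext simp: ext_emb cs_act emb_scale)
  show "ext (a * b) x = ext a (ext b x)"
    by (rule completion_eq[OF _ _ _ x])
       (auto intro!: continuous_on_ext continuous_on_ext_comp ext_completion simp: ext_emb mult_act)
  show "norm (ext a x) \<le> K * norm a * norm x"
  proof -
    have "norm (ext a x) - K * norm a * norm x \<le> 0"
      by (rule continuous_le_on_closure[of "range emb" "\<lambda>x. norm (ext a x) - K * norm a * norm x"])
         (use x norm_emb_act in \<open>auto intro!: continuous_intros continuous_on_ext simp: ext_emb simp flip: completion_def\<close>)
    then show ?thesis by simp
  qed
  assume y: "y \<in> completion"
  show "x + y \<in> completion" using x y by (rule completion_add)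
  show "polar x y = cnj (polar y x)" using x y by (rule polar_commute)
  show "polar (scaleC_bcontfun c x) y = c * polar x y" using x y by (rule polar_scale)
  show "ext a (x + y) = ext a x + ext a y"
  proof -
    have "ext a (emb u + y) = ext a (emb u) + ext a y" for u
      by (rule completion_eq[OF _ _ _ y])
         (auto intro!: continuous_intros continuous_on_ext continuous_on_ext_comp completion_add
            simp: ext_emb act_add emb_add simp flip: emb_add)
    then show ?thesis
      by (intro completion_eq[OF _ _ _ x, of "\<lambda>x. ext a (x + y)"])
         (auto intro!: continuous_intros continuous_on_ext continuous_on_ext_comp completion_add y)
  qed
  assume z: "z \<in> completion"
  show "polar (x + y) z = polar x z + polar y z" using x y z by (rule polar_add)
qed (rule K_nonneg)

end

section \<open>The total reduction property on a Hilbert sum\<close>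

text \<open>In the presence of a unit \<open>e\<close>, scalar multiples are covered by
  multiplication with \<open>scaleC c e\<close>.\<close>

definition algebra_ideal :: "'a::complex_banach_algebra set \<Rightarrow> bool" where
  "algebra_ideal J \<longleftrightarrow> 0 \<in> J \<and> (\<forall>x\<in>J. \<forall>y\<in>J. x + y \<in> J) \<and> (\<forall>a. \<forall>x\<in>J. a * x \<in> J)"

lemma scaleC_zero_right [simp]: "scaleC c (0::'a::complex_banach_algebra) = 0"
  using scaleC_add_right[of c "0::'a" 0] by simp

lemma bounded_linear_apply_bcontfun:
  "bounded_linear (\<lambda>f :: 'i::topological_space \<Rightarrow>\<^sub>C 'b::real_normed_vector. apply_bcontfun f x)"
  by (rule bounded_linear_intro[of _ 1])
     (auto simp: plus_bcontfun.rep_eq scaleR_bcontfun.rep_eq norm_bounded)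

text \<open>The orthogonal sum of the modules given by the forms \<open>p n\<close>. Polynomials only serve as finitely
  supported sequences: their multiplication is not used.\<close>

locale form_sequence =
  fixes p :: "nat \<Rightarrow> 'a::{complex_banach_algebra, comm_ring} \<Rightarrow> 'a \<Rightarrow> complex" and C :: real
  assumes form: "\<And>n. module_form C (p n)" and C_nonneg: "0 \<le> C"
begin

lemma form_ip: "semi_inner_product (p n) scaleC" using form by (simp add: module_form_def)

definition ip :: "'a poly \<Rightarrow> 'a poly \<Rightarrow> complex" where
  "ip u v = (\<Sum>k\<le>degree u. p k (coeff u k) (coeff v k))"

definition cs :: "complex \<Rightarrow> 'a poly \<Rightarrow> 'a poly" where "cs c = map_poly (scaleC c)"

text \<open>The defining sum stops at the degree of its first argument and so looks asymmetric.
  Terms beyond the degree vanish, which permits one common range when two sums are compared.\<close>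

lemma ip_eq: assumes "degree u \<le> N" shows "ip u v = (\<Sum>k\<le>N. p k (coeff u k) (coeff v k))"
  unfolding ip_def using assms
  by (intro sum.mono_neutral_left) (auto simp: coeff_eq_0 semi_inner_product.ip_zero[OF form_ip])

lemma coeff_cs [simp]: "coeff (cs c u) k = scaleC c (coeff u k)"
  by (simp add: cs_def coeff_map_poly)

lemma degree_cs: "degree (cs c u) \<le> degree u"
  by (rule degree_le) (simp add: coeff_eq_0)

sublocale semi_inner_module ip cs smult C
proof
  fix x y z :: "'a poly" and c a b
  let ?N = "max (degree x) (max (degree y) (degree (x + y)))"
  have N: "degree x \<le> ?N" "degree y \<le> ?N" "degree (x + y) \<le> ?N" "degree (cs c x) \<le> ?N" "degree (smult a x) \<le> ?N"
    using degree_cs[of c x] degree_smult_le[of a x] by linarith+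
  show "ip (x + y) z = ip x z + ip y z"
    unfolding ip_eq[OF N(1)] ip_eq[OF N(2)] ip_eq[OF N(3)]
    by (simp add: semi_inner_product.ip_add[OF form_ip] sum.distrib)
  show "ip (cs c x) y = c * ip x y"
    unfolding ip_eq[OF N(1)] ip_eq[OF N(4)]
    by (simp add: semi_inner_product.ip_scale[OF form_ip] sum_distrib_left)
  show "ip x y = cnj (ip y x)"
    unfolding ip_eq[OF N(1)] ip_eq[OF N(2)] cnj_sum
    by (intro sum.cong refl semi_inner_product.ip_commute[OF form_ip])
  show "0 \<le> Re (ip x x)"
    unfolding ip_def Re_sum by (intro sum_nonneg semi_inner_product.ip_nonneg[OF form_ip])
  show "smult a (x + y) = smult a x + smult a y" by (rule smult_add_right)
  show "smult (a + b) x = smult a x + smult b x" for b by (rule smult_add_left)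
  show "smult (a * b) x = smult a (smult b x)" for b by simp
  show "smult a (cs c x) = cs c (smult a x)" by (rule poly_eqI) (simp add: mult_scaleC_right)
  show "smult (scaleC c a) x = cs c (smult a x)" by (rule poly_eqI) (simp add: mult_scaleC_left)
  show "Re (ip (smult a x) (smult a x)) \<le> (C * norm a)\<^sup>2 * Re (ip x x)"
    unfolding ip_eq[OF N(1)] ip_eq[OF N(5)] Re_sum sum_distrib_left
    by (rule sum_mono) (use form in \<open>auto simp: module_form_def\<close>)
qed (rule C_nonneg)

lemma form_le_snorm: "sqrt (Re (p n (coeff u n) (coeff u n))) \<le> snorm u"
proof -
  have "Re (p n (coeff u n) (coeff u n)) \<le> (\<Sum>k\<le>max n (degree u). Re (p k (coeff u k) (coeff u k)))"
    by (rule member_le_sum) (auto intro: semi_inner_product.ip_nonneg[OF form_ip])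
  also have "\<dots> = Re (ip u u)" using ip_eq[of u "max n (degree u)" u] by simp
  finally show ?thesis by (simp add: snorm_def)
qed

lemma snorm_monom: "snorm (monom a n) = sqrt (Re (p n a a))"
proof -
  have "ip (monom a n) (monom a n) = (\<Sum>k\<le>n. p k (coeff (monom a n) k) (coeff (monom a n) k))"
    by (rule ip_eq) (rule degree_monom_le)
  also have "\<dots> = (\<Sum>k\<in>{n}. p k (coeff (monom a n) k) (coeff (monom a n) k))"
    by (rule sum.mono_neutral_right) (auto simp: semi_inner_product.ip_zero[OF form_ip])
  finally show ?thesis by (simp add: snorm_def)
qed

text \<open>The values of a point of the completion are its inner products with normalized vectors;
  for a null vector \<open>u\<close> both sides are \<open>0\<close>.\<close>

lemma polar_apply:
  assumes "z \<in> completion"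
  shows "polar z (emb u) = apply_bcontfun z (discrete u) * of_real (snorm u)"
proof (rule completion_eq[OF _ _ _ assms])
  show "polar (emb v) (emb u) = apply_bcontfun (emb v) (discrete u) * of_real (snorm u)" for v
    using cmod_ip_le[of v u] by (cases "snorm u = 0") (auto simp: polar_emb apply_emb)
qed (auto intro!: continuous_intros bounded_linear.continuous_on[OF bounded_linear_apply_bcontfun])

text \<open>The values at monomials determine the inner products with embedded monomials, and
  monomials span all polynomials. So \<open>x - y\<close> is orthogonal to a dense subspace, hence
  to itself.\<close>

lemma completion_eqI:
  assumes x: "x \<in> completion" and y: "y \<in> completion"
    and eq: "\<And>a k. apply_bcontfun x (discrete (monom a k)) = apply_bcontfun y (discrete (monom a k))"
  shows "x = y"
proof -
  interpret M: hilbert_module completion scaleC_bcontfun polar ext C by (rule hilbert_module_completion)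
  define z where "z = x - y"
  have z: "z \<in> completion" unfolding z_def by (rule M.diff_L[OF x y])
  have m: "polar z (emb (monom a k)) = 0" for a k
    using eq by (simp add: polar_apply[OF z]) (simp add: z_def minus_bcontfun.rep_eq)
  have add: "polar z (emb (u + v)) = polar z (emb u) + polar z (emb v)" for u v
    using M.inn_commute[OF z emb_in_completion, of "u + v"] M.inn_commute[OF z emb_in_completion, of u]
      M.inn_commute[OF z emb_in_completion, of v] M.inn_add[OF emb_in_completion emb_in_completion z, of u v]
    by (simp add: emb_add)
  have "polar z (emb (\<Sum>k\<in>A. monom (coeff u k) k)) = 0" if "finite A" for A u
    using that
  proof (induction A rule: finite_induct)
    case empty
    then show ?case using m[of 0 0] by simp
  qed (simp add: add m)
  then have "polar z (emb u) = 0" for u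
    using poly_as_sum_of_monoms[of u] finite_atMost by metis
  then have "polar z z = 0"
    using completion_eq[of "\<lambda>w. polar z w" "\<lambda>_. 0" z] z by (simp add: continuous_intros)
  then have "(norm z)\<^sup>2 = 0" using M.inn_norm[OF z] by simp
  then show ?thesis by (simp add: z_def)
qed

text \<open>An element of the completion is determined by its complex values at the monomials, and these by
  the rationals below their real and imaginary parts. A set \<open>{Inl i, Inr (Inl a)}\<close> encodes a pair.\<close>

definition code :: "('a poly discrete \<Rightarrow>\<^sub>C complex) \<Rightarrow> (nat + 'a + 'h) set set" where
  "code x = {{Inl (to_nat (k, b, q)), Inr (Inl a)} | k b (q :: rat) a.
     of_rat q < (if b then Re else Im) (apply_bcontfun x (discrete (monom a k)))}"

lemma code_mem:
  "{Inl (to_nat (k, b, q :: rat)), Inr (Inl a)} \<in> (code x :: (nat + 'a + 'h) set set) \<longleftrightarrow>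
     of_rat q < (if b then Re else Im) (apply_bcontfun x (discrete (monom a k)))"
  unfolding code_def by (auto simp: doubleton_eq_iff)

lemma inj_code: "inj_on code completion"
proof (rule inj_onI)
  fix x y assume x: "x \<in> completion" and y: "y \<in> completion"
    and eq: "code x = (code y :: (nat + 'a + 'h) set set)"
  have *: "of_rat q < (if b then Re else Im) (apply_bcontfun x (discrete (monom a k)))
    \<longleftrightarrow> of_rat q < (if b then Re else Im) (apply_bcontfun y (discrete (monom a k)))" for q :: rat and a k b
    using eq code_mem[where 'h='h, of k b q a x] code_mem[where 'h='h, of k b q a y] by simp
  have "r = s" if rs: "\<And>q::rat. of_rat q < r \<longleftrightarrow> of_rat q < s" for r s :: real
  proof (rule ccontr)
    assume "r \<noteq> s"
    then consider "r < s" | "s < r" by linarith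
    then show False
    proof cases
      case 1
      then obtain q where "r < of_rat q" "of_rat q < s" using of_rat_dense by blast
      then show False using rs[of q] by simp
    next
      case 2
      then obtain q where "s < of_rat q" "of_rat q < r" using of_rat_dense by blast
      then show False using rs[of q] by simp
    qed
  qed
  then have "(if b then Re else Im) (apply_bcontfun x (discrete (monom a k)))
    = (if b then Re else Im) (apply_bcontfun y (discrete (monom a k)))" for b a k using * by blast
  from this[of True] this[of False]
  show "x = y" by (intro completion_eqI x y) (simp add: complex_eq_iff)
qed

text \<open>With \<open>V\<close> the submodule of sequences with \<open>n\<close>-th entry in \<open>J n\<close>, split the vector with the single
  entry \<open>e\<close> as \<open>v + w\<close>. If \<open>d \<in> J n\<close> and \<open>e - d \<in> I n\<close>, then \<open>d\<close> annihilates \<open>w\<close>, since \<open>d w\<close> lies in both \<open>V\<close>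
  and its complement. Therefore, if \<open>a\<close> approximates the \<open>n\<close>-th component of \<open>v\<close>, then so does
  \<open>a' = a + d - a d\<close>, for which moreover \<open>e - a'\<close> is in \<open>I n\<close>; and \<open>v\<close> is bounded uniformly in \<open>n\<close>.\<close>

theorem total_reduction_bound:
  fixes J I :: "nat \<Rightarrow> 'a set"
  assumes trp: "total_reduction_property TYPE('a) TYPE((nat + 'a + 'h) set set)"
    and e: "\<And>x::'a. e * x = x"
    and J: "\<And>n. algebra_ideal (J n)" and I: "\<And>n. algebra_ideal (I n)"
    and ne: "\<And>n. \<exists>a\<in>J n. e - a \<in> I n"
  shows "\<exists>B. \<forall>n. \<exists>a\<in>J n. e - a \<in> I n \<and> sqrt (Re (p n a a)) \<le> B"
proof -
  interpret M: hilbert_module completion scaleC_bcontfun polar ext C by (rule hilbert_module_completion)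
  define U where "U = {u. \<forall>k. coeff u k \<in> J k}"
  define V where "V = closure (emb ` U)"
  have Jsc: "scaleC c x \<in> J n" if "x \<in> J n" for c x n
    using J[of n] that e[of x] unfolding algebra_ideal_def by (metis mult_scaleC_left)
  have U: "0 \<in> U" "\<And>u v. u \<in> U \<Longrightarrow> v \<in> U \<Longrightarrow> u + v \<in> U" "\<And>c u. u \<in> U \<Longrightarrow> cs c u \<in> U" "\<And>a u. u \<in> U \<Longrightarrow> smult a u \<in> U"
    using J Jsc unfolding U_def algebra_ideal_def by auto
  have embV: "emb u \<in> V" if "u \<in> U" for u
    unfolding V_def by (rule subsetD[OF closure_subset]) (use that in blast)
  have VL: "V \<subseteq> completion" unfolding V_def completion_def by (rule closure_mono) blast
  have Vmap: "f x \<in> V" if f: "continuous_on V f" and fu: "\<And>u. u \<in> U \<Longrightarrow> f (emb u) \<in> V" and x: "x \<in> V" for f x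
  proof -
    have "f ` closure (emb ` U) \<subseteq> V"
      by (rule image_closure_subset) (use f fu in \<open>auto simp: V_def\<close>)
    then show ?thesis using x by (auto simp: V_def)
  qed
  have V: "M.submodule V"
    unfolding M.submodule_def
  proof (intro conjI ballI allI)
    show "closed V" by (simp add: V_def)
    show "0 \<in> V" using embV[OF U(1)] by (simp add: emb_zero)
    fix x assume x: "x \<in> V"
    show "scaleC_bcontfun c x \<in> V" for c
      by (rule Vmap[OF _ _ x]) (auto intro!: continuous_intros embV U simp flip: emb_scale)
    show "ext a x \<in> V" for a
      by (rule Vmap[OF _ _ x]) (auto intro!: continuous_on_subset[OF continuous_on_ext VL] embV U simp: ext_emb)
    fix y assume y: "y \<in> V"
    have "emb u + y \<in> V" if "u \<in> U" for u
      by (rule Vmap[OF _ _ y]) (auto intro!: continuous_intros embV U that simp flip: emb_add)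
    then show "x + y \<in> V" by (intro Vmap[OF _ _ x, of "\<lambda>x. x + y"]) (auto intro!: continuous_intros)
  qed (use VL in auto)
  obtain W where W: "M.submodule W" "V \<inter> W = {0}" "completion = {v + w | v w. v \<in> V \<and> w \<in> W}"
    by (rule M.submodule_complement[OF inj_code trp V])
  have VW: "closed V" "closed W" "closed {v + w | v w. v \<in> V \<and> w \<in> W}"
    using V W(1) W(3)[symmetric] by (simp_all add: M.submodule_def M.closed_L)
  obtain K where K: "\<forall>v\<in>V. \<forall>w\<in>W. norm v \<le> K * norm (v + w)"
    using bounded_direct_sum[OF VW(1) M.subspace_submodule[OF V] VW(2) M.subspace_submodule[OF W(1)] W(2) VW(3)] by blast
  have "\<exists>a\<in>J n. e - a \<in> I n \<and> sqrt (Re (p n a a)) \<le> \<bar>K\<bar> * (C * norm e) + 1" for n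
  proof -
    obtain d where d: "d \<in> J n" "e - d \<in> I n" using ne by blast
    obtain v w where vw: "v \<in> V" "w \<in> W" "emb (monom e n) = v + w"
      using emb_in_completion[of "monom e n"] unfolding W(3) by blast
    have mon: "smult d (monom e n) = monom d n" using e[of d] by (simp add: smult_monom mult.commute)
    have vL: "v \<in> completion" and wL: "w \<in> completion" using vw VL W(1) by (auto simp: M.submodule_def)
    have "norm v \<le> K * norm (v + w)" using K vw by blast
    also have "\<dots> \<le> \<bar>K\<bar> * norm (v + w)" by (intro mult_right_mono) auto
    also have "norm (v + w) = sqrt (Re (p n e e))" using vw(3) by (metis norm_emb snorm_monom)
    also have "\<bar>K\<bar> * sqrt (Re (p n e e)) \<le> \<bar>K\<bar> * (C * norm e)"
      using form[of n] C_nonneg unfolding module_form_def by (intro mult_left_mono real_le_lsqrt) auto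
    finally have nv: "norm v \<le> \<bar>K\<bar> * (C * norm e)" .
    have "ext d w \<in> V"
    proof -
      have "emb (monom d n) \<in> V" using d J[of ] by (intro embV) (auto simp: U_def algebra_ideal_def)
      moreover have "emb (monom d n) = ext d v + ext d w"
        using M.act_add[OF vL wL, of d] ext_emb[of d "monom e n"] by (simp add: mon vw(3))
      moreover have "ext d v \<in> V" using V vw(1) by (simp add: M.submodule_def)
      ultimately show ?thesis using subspace_diff[OF M.subspace_submodule[OF V]] by (metis add_diff_cancel_left')
    qed
    moreover have "ext d w \<in> W" using W(1) vw(2) by (simp add: M.submodule_def)
    ultimately have dw: "ext d w = 0" using W(2) by blast
    \<comment> \<open>The approximation error enters once directly and once through the action of
      \<open>d\<close>; this tolerance makes the total \<open>(1 + C * norm d) * \<eta>\<close>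
      equal to \<open>1\<close>.\<close>
    define \<eta> where "\<eta> = 1 / (1 + C * norm d)"
    have den: "1 + C * norm d > 0" using C_nonneg by (simp add: add_pos_nonneg)
    then have "\<eta> > 0" by (simp add: \<eta>_def)
    then obtain u where u: "u \<in> U" "dist (emb u) v < \<eta>" using vw(1) unfolding V_def closure_approachable by blast
    define a where "a = coeff u n"
    define a' where "a' = a + d - a * d"
    have aJ: "a \<in> J n" using u(1) by (simp add: U_def a_def)
    have a'd: "a' = a + (d + (- a) * d)" by (simp add: a'_def)
    have "a' \<in> J n" unfolding a'd using aJ d(1) J[of n] unfolding algebra_ideal_def by blast
    moreover have "(e - a) * (e - d) = e * e - e * d - e * a + a * d" by (simp add: algebra_simps)
    then have "e - a' = (e - a) * (e - d)" by (simp add: e a'_def)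
    then have "e - a' \<in> I n" using d(2) I[of n] unfolding algebra_ideal_def by simp
    moreover have "sqrt (Re (p n a' a')) \<le> \<bar>K\<bar> * (C * norm e) + 1"
    proof -
      \<comment> \<open>The \<open>n\<close>-th coefficient is \<open>a + d * (e - a) = a'\<close>.
        In the completion the added term is \<open>d\<close> acting on
        \<open>w + (v - emb u)\<close>, of which only the small second part survives.\<close>
      define y where "y = u + smult d (monom e n - u)"
      have "coeff y n = a'" using e[of d] by (simp add: y_def a_def a'_def algebra_simps)
      then have "sqrt (Re (p n a' a')) \<le> norm (emb y)" using form_le_snorm[of n y] by (simp add: norm_emb)
      also have "emb y = emb u + ext d (emb (monom e n) - emb u)"
        by (simp add: y_def emb_add ext_emb flip: emb_diff)
      also have "emb (monom e n) - emb u = w + (v - emb u)" by (simp add: vw(3))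
      also have "ext d (w + (v - emb u)) = ext d (v - emb u)"
        using M.act_add[OF wL M.diff_L[OF vL emb_in_completion]] dw by simp
      also have "norm (emb u + ext d (v - emb u)) \<le> norm (emb u) + C * norm d * norm (v - emb u)"
        using M.act_bound[OF M.diff_L[OF vL emb_in_completion], of d u] norm_triangle_ineq order_trans add_left_mono by meson
      also have "norm (emb u) \<le> norm v + norm (v - emb u)"
        using norm_triangle_ineq2[of "emb u" v] by (simp add: norm_minus_commute)
      also have "norm v + norm (v - emb u) + C * norm d * norm (v - emb u) = norm v + (1 + C * norm d) * norm (v - emb u)"
        by (simp add: algebra_simps)
      also have "(1 + C * norm d) * norm (v - emb u) \<le> (1 + C * norm d) * \<eta>"
        using u(2) den by (intro mult_left_mono) (auto simp: dist_norm norm_minus_commute)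
      also have "(1 + C * norm d) * \<eta> = 1" using den by (simp add: \<eta>_def)
      finally show ?thesis using nv by simp
    qed
    ultimately show ?thesis by blast
  qed
  then show ?thesis by blast
qed

end

section \<open>Gelfand theory\<close>

text \<open>If \<open>\<phi>\<close> exceeded the norm at \<open>a\<close>, a scalar multiple
  \<open>b\<close> of \<open>a\<close> would satisfy \<open>norm b < 1\<close> and
  \<open>\<phi> b = 1\<close>. The contraction \<open>c \<mapsto> b + b * c\<close> has a fixed
  point, and applying \<open>\<phi>\<close> to it gives
  \<open>\<phi> c = 1 + \<phi> c\<close>.\<close>

lemma character_bounded:
  assumes "\<phi> \<in> characters" shows "cmod (\<phi> a) \<le> norm (a :: 'a::complex_banach_algebra)"
proof (rule ccontr)
  assume n: "\<not> cmod (\<phi> a) \<le> norm a"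
  have \<phi>: "\<And>x y. \<phi> (x + y) = \<phi> x + \<phi> y" "\<And>x y. \<phi> (x * y) = \<phi> x * \<phi> y" "\<And>c x. \<phi> (scaleC c x) = c * \<phi> x"
    using assms by (auto simp: characters_def)
  have nz: "cmod (\<phi> a) > 0" using n norm_ge_zero[of a] by linarith
  define b where "b = scaleC (1 / \<phi> a) a"
  have b: "norm b < 1" "\<phi> b = 1" using n nz by (auto simp: b_def norm_scaleC norm_divide \<phi>)
  have "\<exists>!c. b + b * c = c"
  proof (rule banach_fix_type)
    show "\<forall>x y. dist (b + b * x) (b + b * y) \<le> norm b * dist x y"
      using norm_mult_ineq[of b] by (auto simp: dist_norm simp flip: right_diff_distrib)
  qed (use b in auto)
  then obtain c where "b + b * c = c" by blast
  then have "\<phi> c = \<phi> (b + b * c)" by simp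
  then show False using b(2) by (simp add: \<phi>)
qed

text \<open>Hahn-Banach from the cone principle: \<open>C\<close> is the epigraph of
  \<open>N\<close> enlarged by the ray through \<open>(x0, - N x0)\<close>, with order unit
  \<open>(0, 1)\<close>. The functional obtained has the form
  \<open>(x, t) \<mapsto> \<psi> x + t\<close>; positivity on the epigraph means
  \<open>\<bar>\<psi> x\<bar> \<le> N x\<close>, and positivity on the ray means
  \<open>N x0 \<le> \<psi> x0\<close>.\<close>

lemma seminorm_functional:
  fixes N :: "'v::real_vector \<Rightarrow> real"
  assumes tri: "\<And>x y. N (x + y) \<le> N x + N y" and hom: "\<And>t x. N (t *\<^sub>R x) = \<bar>t\<bar> * N x"
  obtains \<psi> :: "'v \<Rightarrow> real" where "linear \<psi>" "\<And>x. \<bar>\<psi> x\<bar> \<le> N x" "N x0 \<le> \<psi> x0"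
proof -
  define C where "C = {(x, t). \<exists>s\<ge>0. N (x - s *\<^sub>R x0) - s * N x0 \<le> t}"
  have N0: "N 0 = 0" using hom[of 0 0] by simp
  have Nneg: "N (- x) = N x" for x using hom[of "-1" x] by simp
  have C0: "(x, t) \<in> C" if "N x \<le> t" for x t
    unfolding C_def using that by (auto intro!: exI[of _ 0])
  have K1: "u + v \<in> C" if u: "u \<in> C" and v: "v \<in> C" for u v
  proof -
    obtain x t s y r q where "u = (x, t)" "v = (y, r)" "0 \<le> s" "0 \<le> q"
      "N (x - s *\<^sub>R x0) - s * N x0 \<le> t" "N (y - q *\<^sub>R x0) - q * N x0 \<le> r"
      using u v by (auto simp: C_def)
    moreover have "N ((x + y) - (s + q) *\<^sub>R x0) \<le> N (x - s *\<^sub>R x0) + N (y - q *\<^sub>R x0)"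
      using tri[of "x - s *\<^sub>R x0" "y - q *\<^sub>R x0"] by (simp add: algebra_simps)
    ultimately show ?thesis unfolding C_def by (auto intro!: exI[of _ "s + q"] simp: algebra_simps)
  qed
  have K2: "c *\<^sub>R u \<in> C" if c: "0 \<le> c" and u: "u \<in> C" for c u
  proof -
    obtain x t s where x: "u = (x, t)" "0 \<le> s" "N (x - s *\<^sub>R x0) - s * N x0 \<le> t"
      using u by (auto simp: C_def)
    have "N (c *\<^sub>R x - (c * s) *\<^sub>R x0) = c * N (x - s *\<^sub>R x0)"
      using hom[of c "x - s *\<^sub>R x0"] c by (simp add: scaleR_diff_right)
    then have "N (c *\<^sub>R x - (c * s) *\<^sub>R x0) - (c * s) * N x0 \<le> c * t"
      using mult_left_mono[OF x(3) c] by (simp add: algebra_simps)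
    then show ?thesis using x c unfolding C_def by (auto intro!: exI[of _ "c * s"])
  qed
  have K3: "(0, 1) \<in> C" by (rule C0) (simp add: N0)
  have K4: "- (0, 1) \<notin> C"
  proof
    assume "- (0, 1) \<in> C"
    then obtain s where s: "0 \<le> s" "N (- (s *\<^sub>R x0)) - s * N x0 \<le> -1" by (auto simp: C_def)
    then show False unfolding Nneg hom by simp
  qed
  have K5: "\<exists>t. t *\<^sub>R (0, 1) - u \<in> C" for u :: "'v \<times> real"
    by (cases u) (auto intro!: exI[of _ "snd u + N (fst u)"] C0 simp: Nneg)
  obtain \<phi> :: "'v \<times> real \<Rightarrow> real" where \<phi>: "linear \<phi>" "\<phi> (0, 1) = 1" "\<And>u. u \<in> C \<Longrightarrow> 0 \<le> \<phi> u"
    using order_unit_functional[OF K1 K2 K3 K4 K5] by metis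
  interpret linear \<phi> by (rule \<phi>(1))
  define \<psi> where "\<psi> = (\<lambda>x. \<phi> (x, 0))"
  have "(x, t) = (x, 0) + t *\<^sub>R (0, 1)" for x :: 'v and t by simp
  then have \<phi>eq: "\<phi> (x, t) = \<psi> x + t" for x t
    unfolding \<psi>_def using add scale \<phi>(2) by (metis mult.right_neutral real_scaleR_def)
  have lin: "linear \<psi>"
  proof (rule linearI)
    show "\<psi> (x + y) = \<psi> x + \<psi> y" for x y unfolding \<psi>_def using add[of "(x, 0)" "(y, 0)"] by simp
    show "\<psi> (t *\<^sub>R x) = t *\<^sub>R \<psi> x" for t x unfolding \<psi>_def using scale[of t "(x, 0)"] by simp
  qed
  have lower: "- N x \<le> \<psi> x" for x using \<phi>(3)[OF C0[of x "N x"]] \<phi>eq[of x "N x"] by simp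
  have upper: "\<psi> x \<le> N x" for x using lower[of "- x"] linear_neg[OF lin, of x] by (simp add: Nneg)
  have "(x0, - N x0) \<in> C" unfolding C_def using N0 by (auto intro!: exI[of _ 1])
  then have "N x0 \<le> \<psi> x0" using \<phi>(3)[of "(x0, - N x0)"] \<phi>eq by simp
  then show ?thesis using that[of \<psi>] lin lower upper by (simp add: abs_le_iff minus_le_iff)
qed

section \<open>The Gelfand-Mazur theorem modulo a maximal ideal\<close>

text \<open>The quotient by \<open>M\<close> is not formed: congruence is membership of a difference
  in \<open>M\<close>, the distance \<open>N\<close> to \<open>M\<close> serves as the quotient
  norm, and \<open>inverse\<close> says that the quotient is a field.\<close>

locale maximal_algebra_ideal =
  fixes M :: "'a::{complex_banach_algebra, comm_ring} set" and e :: 'a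
  assumes e: "\<And>x. e * x = x" and ideal: "algebra_ideal M" and e_notin: "e \<notin> M"
    and inverse: "\<And>a. a \<notin> M \<Longrightarrow> \<exists>b. a * b - e \<in> M"
begin

lemma M_zero: "0 \<in> M" and M_add: "x \<in> M \<Longrightarrow> y \<in> M \<Longrightarrow> x + y \<in> M" and M_mult: "x \<in> M \<Longrightarrow> a * x \<in> M"
  using ideal by (auto simp: algebra_ideal_def)

lemma M_scale: "x \<in> M \<Longrightarrow> scaleC c x \<in> M"
  using M_mult[of x "scaleC c e"] by (simp add: mult_scaleC_left e)

lemma M_neg: "x \<in> M \<Longrightarrow> - x \<in> M"
  using M_mult[of x "- e"] by (simp add: e)

lemma M_diff: "x \<in> M \<Longrightarrow> y \<in> M \<Longrightarrow> x - y \<in> M"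
  using M_add[of x "- y"] M_neg by simp

definition N :: "'a \<Rightarrow> real" where "N x = infdist x M"

lemma N_le: "m \<in> M \<Longrightarrow> N x \<le> norm (x - m)"
  unfolding N_def by (metis dist_norm infdist_le)

lemma N_approx: assumes "0 < \<epsilon>" obtains m where "m \<in> M" "norm (x - m) < N x + \<epsilon>"
proof -
  have "M \<noteq> {}" using M_zero by blast
  then obtain m where "m \<in> M" "dist x m < N x + \<epsilon>"
    using infdist_notempty[of M x] cINF_less_iff[of M "dist x" "N x + \<epsilon>"] assms
    unfolding N_def by (metis bdd_below_image_dist less_add_same_cancel1)
  then show ?thesis using that by (simp add: dist_norm)
qed

lemma N_nonneg: "0 \<le> N x" by (simp add: N_def infdist_nonneg)

lemma N_add: "N (x + y) \<le> N x + N y"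
proof (rule field_le_epsilon)
  fix \<epsilon> :: real assume "\<epsilon> > 0"
  then have e2: "0 < \<epsilon> / 2" by simp
  obtain m n where "m \<in> M" "norm (x - m) < N x + \<epsilon>/2" "n \<in> M" "norm (y - n) < N y + \<epsilon>/2"
    using N_approx[OF e2] by metis
  moreover have "norm (x + y - (m + n)) \<le> norm (x - m) + norm (y - n)"
    using norm_triangle_ineq[of "x - m" "y - n"] by (simp add: algebra_simps)
  ultimately show "N (x + y) \<le> N x + N y + \<epsilon>" using N_le[OF M_add, of m n "x + y"] by linarith
qed

lemma N_mult: "N (x * y) \<le> N x * N y"
proof -
  have "N (x * y) \<le> (N x + \<epsilon>) * (N y + \<epsilon>)" if \<epsilon>: "0 < \<epsilon>" for \<epsilon>
  proof -
    obtain m n where m: "m \<in> M" "norm (x - m) < N x + \<epsilon>" and n: "n \<in> M" "norm (y - n) < N y + \<epsilon>"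
      using N_approx[OF \<epsilon>] by metis
    have "x * y - (x * n + (y - n) * m) = (x - m) * (y - n)" by (simp add: algebra_simps)
    moreover have "x * n + (y - n) * m \<in> M" by (intro M_add M_mult m n)
    ultimately have "N (x * y) \<le> norm ((x - m) * (y - n))" using N_le by metis
    also have "\<dots> \<le> norm (x - m) * norm (y - n)" by (rule norm_mult_ineq)
    also have "\<dots> \<le> (N x + \<epsilon>) * (N y + \<epsilon>)" using m n N_nonneg[of x] \<epsilon> by (intro mult_mono) auto
    finally show ?thesis .
  qed
  then have "eventually (\<lambda>\<epsilon>. N (x * y) \<le> (N x + \<epsilon>) * (N y + \<epsilon>)) (at_right 0)"
    by (auto simp: eventually_at_filter)
  moreover have "((\<lambda>\<epsilon>. (N x + \<epsilon>) * (N y + \<epsilon>)) \<longlongrightarrow> (N x + 0) * (N y + 0)) (at_right 0)"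
    by (intro tendsto_intros)
  ultimately show ?thesis
    using tendsto_lowerbound[of _ _ "at_right (0::real)" "N (x * y)"] by fastforce
qed

lemma N_M: "m \<in> M \<Longrightarrow> N m = 0"
  by (simp add: N_def)

lemma N_cong: "x - y \<in> M \<Longrightarrow> N x = N y"
  using N_add[of y "x - y"] N_add[of x "y - x"] N_M[of "x - y"] N_M[of "y - x"] M_neg[of "x - y"] by simp

lemma N_scale: "N (scaleC c x) = cmod c * N x"
proof -
  have le: "N (scaleC c x) \<le> cmod c * N x" for c x
  proof (rule field_le_epsilon)
    fix \<epsilon> :: real assume \<epsilon>: "\<epsilon> > 0"
    then have "0 < \<epsilon> / (cmod c + 1)" by (simp add: add_nonneg_pos)
    then obtain m where m: "m \<in> M" "norm (x - m) < N x + \<epsilon> / (cmod c + 1)" using N_approx by metis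
    have "scaleC c (x - m) + scaleC c m = scaleC c x" by (simp flip: scaleC_add_right)
    then have "scaleC c x - scaleC c m = scaleC c (x - m)" by (simp add: algebra_simps)
    then have "N (scaleC c x) \<le> cmod c * norm (x - m)" using N_le[OF M_scale[OF m(1)]] by (metis norm_scaleC)
    also have "\<dots> \<le> cmod c * (N x + \<epsilon> / (cmod c + 1))" using m by (intro mult_left_mono) auto
    also have "\<dots> = cmod c * N x + \<epsilon> * (cmod c / (cmod c + 1))" by (simp add: algebra_simps)
    also have "\<dots> \<le> cmod c * N x + \<epsilon> * 1"
    proof (intro add_left_mono mult_left_mono)
      have "cmod c + 1 > 0" by (simp add: add_nonneg_pos)
      then show "cmod c / (cmod c + 1) \<le> 1" by simp
    qed (use \<epsilon> in simp)
    finally show "N (scaleC c x) \<le> cmod c * N x + \<epsilon>" by simp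
  qed
  show ?thesis
  proof (cases "c = 0")
    case True
    then show ?thesis using le[of c x] N_nonneg[of "scaleC c x"] by simp
  next
    case False
    have "scaleC 1 x = x" using scaleC_of_real[of 1 x] by simp
    then have "N x \<le> cmod (inverse c) * N (scaleC c x)"
      using le[of "inverse c" "scaleC c x"] False by (simp add: scaleC_scaleC)
    then have "cmod c * N x \<le> cmod c * (cmod (inverse c) * N (scaleC c x))" by (intro mult_left_mono) auto
    also have "\<dots> = N (scaleC c x)" using False by (simp flip: mult.assoc norm_mult)
    finally show ?thesis using le[of c x] by simp
  qed
qed

text \<open>An element \<open>m\<close> of \<open>M\<close> at distance less than \<open>1\<close>
  from \<open>e\<close> would be invertible: the fixed point of
  \<open>y \<mapsto> e + (e - m) * y\<close> satisfies \<open>e = y * m\<close>.\<close>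

lemma N_e: "N e \<ge> 1"
proof (rule ccontr)
  assume "\<not> N e \<ge> 1"
  then obtain m where m: "m \<in> M" "norm (e - m) < 1"
    using N_approx[of "1 - N e" e] by auto
  have "\<exists>!y. e + (e - m) * y = y"
  proof (rule banach_fix_type)
    show "\<forall>x y. dist (e + (e - m) * x) (e + (e - m) * y) \<le> norm (e - m) * dist x y"
      using norm_mult_ineq[of "e - m"] by (auto simp: dist_norm simp flip: right_diff_distrib)
  qed (use m in auto)
  then obtain y where "e + (e - m) * y = y" by blast
  then have "e + (y - m * y) = y" by (simp add: left_diff_distrib e)
  then have "e = y * m" by (simp add: algebra_simps)
  then show False using M_mult[OF m(1)] e_notin by metis
qed

text \<open>If no \<open>a - scaleC c e\<close> were in \<open>M\<close>, all of them would be
  invertible modulo \<open>M\<close>, with inverses \<open>r c\<close>. Composed with a functional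
  bounded by a multiple of \<open>N\<close>, this resolvent is entire and vanishes at infinity, so
  it is zero by Liouville; but the functional is chosen not to vanish at \<open>r 0\<close>.\<close>

lemma Gelfand_Mazur: "\<exists>c. a - scaleC c e \<in> M"
proof (rule ccontr)
  assume "\<nexists>c. a - scaleC c e \<in> M"
  then have "\<forall>c. \<exists>b. (a - scaleC c e) * b - e \<in> M" using inverse by blast
  then obtain r where r: "\<And>c. (a - scaleC c e) * r c - e \<in> M" by metis
  define g where "g = (\<lambda>c. N (r c))"
  \<comment> \<open>The resolvent identity modulo \<open>M\<close>, from which both local
    boundedness and the derivative are read off.\<close>
  have res: "r c - r d - scaleC (c - d) (r c * r d) \<in> M" for c d
  proof -
    have "r c * ((a - scaleC d e) * r d - e) - r d * ((a - scaleC c e) * r c - e) \<in> M"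
      by (intro M_diff M_mult r)
    moreover have "r c * ((a - scaleC d e) * r d - e) - r d * ((a - scaleC c e) * r c - e)
      = - (r c - r d - scaleC (c - d) (r c * r d))"
    proof -
      have "scaleC c (r c * r d) = scaleC (c - d) (r c * r d) + scaleC d (r c * r d)"
        by (simp flip: scaleC_add_left)
      then show ?thesis
        using e[of "r c"] e[of "r d"]
        by (simp add: algebra_simps mult_scaleC_left mult_scaleC_right e)
    qed
    ultimately show ?thesis using M_neg by fastforce
  qed
  have gdiff: "N (r c - r d) \<le> cmod (c - d) * (g c * g d)" for c d
    using N_cong[OF res[of c d]] N_scale[of "c - d" "r c * r d"] N_mult[of "r c" "r d"]
    by (simp add: g_def mult_left_mono)
  have g0: "0 \<le> g c" for c by (simp add: g_def N_nonneg)
  \<comment> \<open>The identity gives \<open>g c \<le> g d + cmod (c - d) * g d * g c\<close>,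
    where the last term is at most half of \<open>g c\<close>.\<close>
  have gle: "g c \<le> 2 * g d" if "cmod (c - d) * g d \<le> 1/2" for c d
  proof -
    have "g c \<le> g d + N (r c - r d)" using N_add[of "r d" "r c - r d"] by (simp add: g_def)
    also have "\<dots> \<le> g d + (cmod (c - d) * g d) * g c" using gdiff[of c d] by (simp add: mult_ac)
    also have "\<dots> \<le> g d + 1/2 * g c" using that g0[of c] by (intro add_left_mono mult_right_mono) auto
    finally show ?thesis by simp
  qed
  have gpos: "0 < g 0"
  proof (rule ccontr)
    assume "\<not> 0 < g 0"
    then have "N (r 0) = 0" using g0[of 0] by (simp add: g_def)
    then have "N ((a - scaleC 0 e) * r 0) \<le> 0" using N_mult[of "a - scaleC 0 e" "r 0"] by simp
    then show False using N_cong[OF r[of 0]] N_e by simp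
  qed
  obtain \<psi> :: "'a \<Rightarrow> real" where \<psi>: "linear \<psi>" "\<And>x. \<bar>\<psi> x\<bar> \<le> N x" "N (r 0) \<le> \<psi> (r 0)"
  proof (rule seminorm_functional[of N "r 0"])
    show "N (t *\<^sub>R x) = \<bar>t\<bar> * N x" for t x using N_scale[of "of_real t" x] by (simp add: scaleC_of_real)
  qed (auto intro: N_add)
  interpret \<psi>: linear \<psi> by (rule \<psi>(1))
  \<comment> \<open>The complex-linear functional with real part \<open>\<psi>\<close>.\<close>
  define f where "f = (\<lambda>x. Complex (\<psi> x) (- \<psi> (scaleC \<i> x)))"
  have fadd: "f (x + y) = f x + f y" for x y by (simp add: f_def \<psi>.add scaleC_add_right complex_eq_iff)
  have fscale: "f (scaleC c x) = c * f x" for c x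
  proof -
    have cx: "scaleC c y = Re c *\<^sub>R y + Im c *\<^sub>R scaleC \<i> y" for y
    proof -
      have "scaleC c y = scaleC (of_real (Re c) + of_real (Im c) * \<i>) y" by (metis complex_eq mult.commute)
      then show ?thesis by (simp add: scaleC_add_left scaleC_of_real flip: scaleC_scaleC)
    qed
    have ii: "scaleC \<i> (scaleC \<i> x) = - x"
      using scaleC_of_real[of "-1" x] by (simp add: scaleC_scaleC)
    have "\<psi> (scaleC c x) = Re c * \<psi> x + Im c * \<psi> (scaleC \<i> x)"
      unfolding cx by (simp add: \<psi>.add \<psi>.scale)
    moreover have "\<psi> (scaleC \<i> (scaleC c x)) = Re c * \<psi> (scaleC \<i> x) - Im c * \<psi> x"
    proof -
      have "scaleC \<i> (scaleC c x) = scaleC c (scaleC \<i> x)" by (simp add: scaleC_scaleC mult.commute)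
      also have "\<dots> = Re c *\<^sub>R scaleC \<i> x + Im c *\<^sub>R (- x)" unfolding cx[of "scaleC \<i> x"] ii ..
      finally show ?thesis by (simp only: \<psi>.add \<psi>.scale \<psi>.neg real_scaleR_def)
    qed
    ultimately show ?thesis by (simp add: f_def complex_eq_iff)
  qed
  have fN: "cmod (f x) \<le> 2 * N x" for x
  proof -
    have "cmod (f x) \<le> \<bar>\<psi> x\<bar> + \<bar>\<psi> (scaleC \<i> x)\<bar>" using cmod_le[of "f x"] by (simp add: f_def)
    then show ?thesis using \<psi>(2)[of x] \<psi>(2)[of "scaleC \<i> x"] N_scale[of \<i> x] by simp
  qed
  have fneg: "f (- x) = - f x" for x using fadd[of x "- x"] fadd[of 0 0] by (simp add: add_eq_0_iff)
  have fdiff: "f (x - y) = f x - f y" for x y using fadd[of x "- y"] fneg by simp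
  have fM: "f m = 0" if "m \<in> M" for m using fN[of m] N_M[OF that] by simp
  define h where "h = (\<lambda>c. f (r c))"
  have hdiff: "h c - h d = (c - d) * f (r c * r d)" for c d
    using fM[OF res[of c d]] by (simp add: h_def fdiff fscale)
  have "(h has_field_derivative f (r d * r d)) (at d)" for d
    unfolding has_field_derivative_iff
  proof (rule Lim_transform_within_open)
    \<comment> \<open>The difference is at most \<open>2 * cmod (c - d) * g c * (g d * g d)\<close>,
      and \<open>g c \<le> 2 * g d\<close> near \<open>d\<close>.\<close>
    define B where "B = 4 * g d * (g d * g d)"
    show "((\<lambda>c. f (r c * r d)) \<longlongrightarrow> f (r d * r d)) (at d)"
    proof (rule Lim_null[THEN iffD2], rule Lim_null_comparison)
      have "\<forall>\<^sub>F c in at d. cmod (c - d) < 1 / (2 * (g d + 1))"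
        using g0[of d] by (auto simp: eventually_at dist_norm intro!: exI[of _ "1 / (2 * (g d + 1))"])
      then show "\<forall>\<^sub>F c in at d. norm (f (r c * r d) - f (r d * r d)) \<le> B * cmod (c - d)"
      proof eventually_elim
        case (elim c)
        have "cmod (c - d) * g d \<le> cmod (c - d) * (g d + 1)" by (intro mult_left_mono) auto
        also have "\<dots> \<le> 1/2" using elim g0[of d] by (simp add: field_simps)
        finally have "g c \<le> 2 * g d" by (rule gle)
        have "norm (f (r c * r d) - f (r d * r d)) = cmod (f ((r c - r d) * r d))"
          by (simp add: fdiff left_diff_distrib)
        also have "\<dots> \<le> 2 * (N (r c - r d) * g d)" using fN N_mult unfolding g_def by (meson mult_left_mono order_trans zero_le_numeral)
        also have "\<dots> \<le> 2 * ((cmod (c - d) * (g c * g d)) * g d)" using gdiff g0 by (intro mult_left_mono mult_right_mono) auto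
        also have "\<dots> = cmod (c - d) * (2 * g d * g d) * g c" by simp
        also have "\<dots> \<le> cmod (c - d) * (2 * g d * g d) * (2 * g d)"
          using \<open>g c \<le> 2 * g d\<close> g0[of d] by (intro mult_left_mono) auto
        finally show ?case by (simp add: B_def mult_ac)
      qed
      show "((\<lambda>c. B * cmod (c - d)) \<longlongrightarrow> 0) (at d)"
        by (auto intro!: tendsto_eq_intros)
    qed
    show "f (r c * r d) = (h c - h d) / (c - d)" if "c \<in> UNIV" "c \<noteq> d" for c using that by (simp add: hdiff)
  qed auto
  then have "h holomorphic_on UNIV" by (auto simp: holomorphic_on_open)
  moreover have "(h \<longlongrightarrow> 0) at_infinity"
    unfolding Lim_at_infinity
  proof (intro allI impI)
    fix \<epsilon> :: real assume \<epsilon>: "\<epsilon> > 0"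
    \<comment> \<open>Modulo \<open>M\<close>, \<open>scaleC c (r c)\<close> equals
      \<open>a * r c - e\<close>, so \<open>(cmod c - N a) * g c \<le> N e\<close>. The factor
      \<open>2\<close> in the threshold is the one of \<open>fN\<close>; the summand
      \<open>1\<close> makes the inequalities strict.\<close>
    have "dist (h c) 0 < \<epsilon>" if c: "2 * N e / \<epsilon> + N a + 1 \<le> cmod c" for c
    proof -
      have pos: "cmod c - N a > 0" using c \<epsilon> N_nonneg[of e] by (smt (verit) divide_nonneg_pos)
      have "scaleC c (r c) - (a * r c - e) = - ((a - scaleC c e) * r c - e)"
        by (simp add: left_diff_distrib mult_scaleC_left e)
      then have "scaleC c (r c) - (a * r c - e) \<in> M" using M_neg[OF r[of c]] by (simp only:)
      then have "N (scaleC c (r c)) = N (a * r c - e)" by (rule N_cong)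
      also have "\<dots> \<le> N a * g c + N e"
        using N_add[of "a * r c" "- e"] N_mult[of a "r c"] N_scale[of "-1" e] scaleC_of_real[of "-1" e] by (simp add: g_def)
      finally have "(cmod c - N a) * g c \<le> N e" by (simp add: N_scale g_def algebra_simps)
      then have "2 * g c \<le> 2 * N e / (cmod c - N a)" using pos by (simp add: field_simps)
      also have "\<dots> < \<epsilon>" using c pos \<epsilon> by (simp add: field_simps)
      finally show ?thesis using fN[of "r c"] by (simp add: h_def g_def)
    qed
    then show "\<exists>b. \<forall>c. b \<le> cmod c \<longrightarrow> dist (h c) 0 < \<epsilon>" by blast
  qed
  ultimately have "h 0 = 0" by (rule Liouville_weak)
  then have "\<psi> (r 0) = 0" by (simp add: h_def f_def complex_eq_iff)
  then show False using \<psi>(3) gpos by (simp add: g_def)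
qed

text \<open>The character sends \<open>a\<close> to the scalar \<open>c\<close> for which
  \<open>a\<close> is congruent to \<open>scaleC c e\<close>. This scalar is unique because nonzero
  multiples of \<open>e\<close> are outside \<open>M\<close>, and uniqueness reduces each law to a
  congruence.\<close>

lemma character_exists: "\<exists>\<phi>\<in>characters. \<forall>x\<in>M. \<phi> x = 0"
proof -
  obtain \<phi> where \<phi>: "\<And>a. a - scaleC (\<phi> a) e \<in> M" using Gelfand_Mazur by metis
  have uniq: "\<phi> a = c" if "a - scaleC c e \<in> M" for a c
  proof (rule ccontr)
    assume n: "\<phi> a \<noteq> c"
    have "a - scaleC c e - (a - scaleC (\<phi> a) e) \<in> M" using that \<phi> by (rule M_diff)
    moreover have "scaleC (\<phi> a) e = scaleC (\<phi> a - c) e + scaleC c e" by (simp flip: scaleC_add_left)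
    ultimately have "scaleC (\<phi> a - c) e \<in> M" by (simp add: algebra_simps)
    then have "scaleC (inverse (\<phi> a - c)) (scaleC (\<phi> a - c) e) \<in> M" by (rule M_scale)
    then show False using n e_notin scaleC_of_real[of 1 e] by (simp add: scaleC_scaleC)
  qed
  have "\<phi> \<in> characters"
    unfolding characters_def
  proof (intro CollectI conjI allI)
    fix x y c
    show "\<phi> (x + y) = \<phi> x + \<phi> y"
      using M_add[OF \<phi>[of x] \<phi>[of y]] by (intro uniq) (simp add: scaleC_add_left algebra_simps)
    show "\<phi> (scaleC c x) = c * \<phi> x"
    proof (rule uniq)
      have "scaleC c (x - scaleC (\<phi> x) e) + scaleC c (scaleC (\<phi> x) e) = scaleC c x"
        by (simp flip: scaleC_add_right)
      then have "scaleC c (x - scaleC (\<phi> x) e) = scaleC c x - scaleC (c * \<phi> x) e"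
        by (simp add: scaleC_scaleC algebra_simps)
      then show "scaleC c x - scaleC (c * \<phi> x) e \<in> M" using M_scale[OF \<phi>[of x], of c] by simp
    qed
    show "\<phi> (x * y) = \<phi> x * \<phi> y"
    proof (rule uniq)
      have "y * (x - scaleC (\<phi> x) e) + scaleC (\<phi> x) (y - scaleC (\<phi> y) e) \<in> M"
        by (intro M_add M_mult M_scale \<phi>)
      moreover have "scaleC (\<phi> x) (y - scaleC (\<phi> y) e) + scaleC (\<phi> x) (scaleC (\<phi> y) e) = scaleC (\<phi> x) y"
        by (simp flip: scaleC_add_right)
      then have "scaleC (\<phi> x) (y - scaleC (\<phi> y) e) = scaleC (\<phi> x) y - scaleC (\<phi> x * \<phi> y) e"
        by (simp add: scaleC_scaleC algebra_simps)
      ultimately show "x * y - scaleC (\<phi> x * \<phi> y) e \<in> M"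
        by (simp add: right_diff_distrib mult_scaleC_right mult.commute e)
    qed
    have "\<phi> e = 1" using M_zero scaleC_of_real[of 1 e] by (intro uniq) simp
    then show "\<exists>x. \<phi> x \<noteq> 0" by (intro exI[of _ e]) simp
  qed
  moreover have "\<phi> x = 0" if "x \<in> M" for x
    using that scaleC_of_real[of 0 e] by (intro uniq) simp
  ultimately show ?thesis by blast
qed

end

text \<open>Zorn gives an ideal \<open>M\<close> maximal among those that contain \<open>I\<close>
  and omit \<open>e\<close>. For \<open>a\<close> outside \<open>M\<close>, the ideal generated by
  \<open>M\<close> and \<open>a\<close> contains \<open>e\<close>, which yields an inverse of
  \<open>a\<close> modulo \<open>M\<close>.\<close>

lemma proper_ideal_in_character_kernel:
  fixes I :: "'a::{complex_banach_algebra, comm_ring} set"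
  assumes e: "\<And>x. e * x = x" and I: "algebra_ideal I" "e \<notin> I"
  shows "\<exists>\<phi>\<in>characters. \<forall>x\<in>I. \<phi> x = 0"
proof -
  define \<A> where "\<A> = {J. algebra_ideal J \<and> I \<subseteq> J \<and> e \<notin> J}"
  have "\<exists>M\<in>\<A>. \<forall>X\<in>\<A>. M \<subseteq> X \<longrightarrow> X = M"
  proof (rule subset_Zorn_nonempty)
    have "I \<in> \<A>" using I by (simp add: \<A>_def)
    then show "\<A> \<noteq> {}" by blast
    fix \<C> assume ne: "\<C> \<noteq> {}" and ch: "subset.chain \<A> \<C>"
    then have c: "\<And>J. J \<in> \<C> \<Longrightarrow> algebra_ideal J \<and> I \<subseteq> J \<and> e \<notin> J" by (auto simp: subset.chain_def \<A>_def)
    have "u + v \<in> \<Union>\<C>" if uv: "u \<in> \<Union>\<C>" "v \<in> \<Union>\<C>" for u v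
    proof -
      obtain X Y where "X \<in> \<C>" "Y \<in> \<C>" "u \<in> X" "v \<in> Y" using uv by blast
      moreover have "X \<subseteq> Y \<or> Y \<subseteq> X" using ch calculation by (auto simp: subset_chain_def)
      ultimately obtain Z where "Z \<in> \<C>" "u \<in> Z" "v \<in> Z" by blast
      then show ?thesis using c[of Z] by (auto simp: algebra_ideal_def)
    qed
    moreover have "a * u \<in> \<Union>\<C>" if "u \<in> \<Union>\<C>" for a u using that c unfolding algebra_ideal_def by blast
    moreover have "0 \<in> \<Union>\<C>" "I \<subseteq> \<Union>\<C>" "e \<notin> \<Union>\<C>" using ne c unfolding algebra_ideal_def by blast+
    ultimately show "\<Union>\<C> \<in> \<A>" unfolding \<A>_def algebra_ideal_def by blast
  qed
  then obtain M where "M \<in> \<A>" and "\<forall>X\<in>\<A>. M \<subseteq> X \<longrightarrow> X = M" by blast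
  then have M: "algebra_ideal M" "I \<subseteq> M" "e \<notin> M"
    and max: "\<And>X. algebra_ideal X \<Longrightarrow> M \<subseteq> X \<Longrightarrow> e \<notin> X \<Longrightarrow> X = M" by (auto simp: \<A>_def)
  have "\<exists>b. a * b - e \<in> M" if a: "a \<notin> M" for a
  proof -
    define X where "X = {m + a * b | m b. m \<in> M}"
    have "algebra_ideal X"
      unfolding algebra_ideal_def
    proof (intro conjI ballI allI)
      have "0 + a * 0 \<in> X" unfolding X_def using M(1) unfolding algebra_ideal_def by blast
      then show "0 \<in> X" by simp
      fix x assume "x \<in> X"
      then obtain m b where x: "x = m + a * b" "m \<in> M" by (auto simp: X_def)
      have "c * x = c * m + a * (c * b)" for c by (simp add: x algebra_simps)
      then show "c * x \<in> X" for c using x M(1) unfolding X_def algebra_ideal_def by blast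
      fix y assume "y \<in> X"
      then obtain n d where y: "y = n + a * d" "n \<in> M" by (auto simp: X_def)
      have "x + y = (m + n) + a * (b + d)" by (simp add: x y algebra_simps)
      then show "x + y \<in> X" using x y M(1) unfolding X_def algebra_ideal_def by blast
    qed
    moreover have "M \<subseteq> X"
    proof
      fix m assume "m \<in> M"
      then have "m + a * 0 \<in> X" unfolding X_def by blast
      then show "m \<in> X" by simp
    qed
    moreover have "a \<in> X"
    proof -
      have "0 + a * e \<in> X" unfolding X_def using M(1) unfolding algebra_ideal_def by blast
      then show ?thesis using e[of a] by (simp add: mult.commute)
    qed
    ultimately have "e \<in> X" using max a by blast
    then obtain m b where mb: "e = m + a * b" "m \<in> M" by (auto simp: X_def)
    have "(- e) * m \<in> M" using mb M(1) unfolding algebra_ideal_def by blast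
    moreover have "(- e) * m = a * b - e" using mb(1) e[of m] by (simp add: algebra_simps)
    ultimately show ?thesis by metis
  qed
  then interpret maximal_algebra_ideal M e using e M by unfold_locales auto
  show ?thesis using character_exists M(2) by blast
qed

definition vanishing_ideal :: "('a::complex_banach_algebra \<Rightarrow> complex) set \<Rightarrow> 'a set" where
  "vanishing_ideal E = {a. \<forall>\<phi>\<in>E. \<phi> a = 0}"

lemma algebra_ideal_vanishing_ideal:
  assumes "E \<subseteq> characters" shows "algebra_ideal (vanishing_ideal E)"
proof -
  have add: "\<phi> (x + y) = \<phi> x + \<phi> y" and mult: "\<phi> (x * y) = \<phi> x * \<phi> y" if "\<phi> \<in> E" for \<phi> x y
    using assms that unfolding characters_def by blast+
  have "\<phi> 0 = 0" if "\<phi> \<in> E" for \<phi> using add[OF that, of 0 0] by simp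
  then show ?thesis by (auto simp: algebra_ideal_def vanishing_ideal_def add mult)
qed

text \<open>By regularity \<open>E\<close> and \<open>F\<close> are their own hull-kernel closures,
  so a character annihilating both vanishing ideals would lie in \<open>E\<close> and in
  \<open>F\<close>. As these are disjoint, the sum of the ideals is in no character kernel and
  contains \<open>e\<close>; splitting \<open>e\<close> gives \<open>a\<close>.\<close>

lemma regular_imp_normal:
  fixes e :: "'a::{complex_banach_algebra, comm_ring}"
  assumes e: "\<And>x. e * x = x" and reg: "regular_algebra TYPE('a)"
    and E: "closedin maximal_ideal_space E" and F: "closedin maximal_ideal_space F" and EF: "E \<inter> F = {}"
  shows "\<exists>a\<in>vanishing_ideal E. e - a \<in> vanishing_ideal F"
proof -
  have hE: "E \<subseteq> characters" "hull_kernel_closure E = E" and hF: "F \<subseteq> characters" "hull_kernel_closure F = F"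
    using E F reg closedin_hull_kernel unfolding regular_algebra_def by metis+
  define I where "I = {x + y | x y. x \<in> vanishing_ideal E \<and> y \<in> vanishing_ideal F}"
  note kE = algebra_ideal_vanishing_ideal[OF hE(1)] and kF = algebra_ideal_vanishing_ideal[OF hF(1)]
  have sub: "vanishing_ideal E \<subseteq> I" "vanishing_ideal F \<subseteq> I"
  proof -
    show "vanishing_ideal E \<subseteq> I" unfolding I_def using kF by (force simp: algebra_ideal_def)
    show "vanishing_ideal F \<subseteq> I" unfolding I_def using kE by (force simp: algebra_ideal_def)
  qed
  have "algebra_ideal I"
    unfolding algebra_ideal_def
  proof (intro conjI ballI allI)
    show "0 \<in> I" using sub kE by (auto simp: algebra_ideal_def)
    fix x assume "x \<in> I"
    then obtain a b where x: "x = a + b" "a \<in> vanishing_ideal E" "b \<in> vanishing_ideal F" by (auto simp: I_def)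
    have "c * x = c * a + c * b" for c by (simp add: x distrib_left)
    then show "c * x \<in> I" for c using x kE kF unfolding I_def algebra_ideal_def by blast
    fix y assume "y \<in> I"
    then obtain c d where y: "y = c + d" "c \<in> vanishing_ideal E" "d \<in> vanishing_ideal F" by (auto simp: I_def)
    have "x + y = (a + c) + (b + d)" by (simp add: x y)
    then show "x + y \<in> I" using x y kE kF unfolding I_def algebra_ideal_def by blast
  qed
  have "e \<in> I"
  proof (rule ccontr)
    assume "e \<notin> I"
    then obtain \<phi> where \<phi>: "\<phi> \<in> characters" "\<And>x. x \<in> I \<Longrightarrow> \<phi> x = 0"
      using proper_ideal_in_character_kernel[OF e \<open>algebra_ideal I\<close>] by blast
    then have "\<phi> \<in> hull_kernel_closure E" "\<phi> \<in> hull_kernel_closure F"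
      using sub by (auto simp: hull_kernel_closure_def vanishing_ideal_def)
    then show False using hE hF EF by blast
  qed
  then obtain a b where "e = a + b" "a \<in> vanishing_ideal E" "b \<in> vanishing_ideal F" by (auto simp: I_def)
  then show ?thesis by (intro bexI[of _ a]) auto
qed

section \<open>Bounded normality and the isomorphism\<close>

theorem bounded_normality:
  assumes e: "\<And>x::'a::{complex_banach_algebra, comm_ring}. e * x = x"
    and reg: "regular_algebra TYPE('a)"
    and opalg: "operator_algebra TYPE('a) TYPE('h)"
    and trp: "total_reduction_property TYPE('a) TYPE((nat + 'a + 'h) set set)"
  shows "\<exists>K. \<forall>E F. closedin maximal_ideal_space E \<longrightarrow> closedin maximal_ideal_space F \<longrightarrow> E \<inter> F = {} \<longrightarrow>
    (\<exists>a\<in>vanishing_ideal E. e - a \<in> vanishing_ideal F \<and> norm a \<le> K)"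
proof (rule ccontr)
  assume contra: "\<not> ?thesis"
  have "\<forall>n::nat. \<exists>E F. closedin maximal_ideal_space E \<and> closedin maximal_ideal_space F \<and> E \<inter> F = {} \<and>
    (\<forall>a\<in>vanishing_ideal E. e - a \<in> vanishing_ideal F \<longrightarrow> real n < norm a)"
    using contra by (meson not_less)
  then obtain E F :: "nat \<Rightarrow> ('a \<Rightarrow> complex) set" where E: "\<And>n. closedin maximal_ideal_space (E n)"
    and F: "\<And>n. closedin maximal_ideal_space (F n)" and EF: "\<And>n. E n \<inter> F n = {}"
    and big: "\<And>n a. a \<in> vanishing_ideal (E n) \<Longrightarrow> e - a \<in> vanishing_ideal (F n) \<Longrightarrow> real n < norm a"
    by metis
  have chE: "E n \<subseteq> characters" and chF: "F n \<subseteq> characters" for n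
    using closedin_subset[OF E[of n]] closedin_subset[OF F[of n]] by (auto simp: maximal_ideal_space_def)
  obtain C \<delta> and P :: "('a \<Rightarrow> 'a \<Rightarrow> complex) set" where \<delta>: "\<delta> > 0" and P: "\<And>q. q \<in> P \<Longrightarrow> module_form C q"
    and lower: "\<And>a r. 0 \<le> r \<Longrightarrow> (\<And>q. q \<in> P \<Longrightarrow> Re (q a a) \<le> r\<^sup>2) \<Longrightarrow> \<delta> * norm a \<le> r"
    using operator_algebra_module_forms[OF opalg] by metis
  define S where "S = (\<lambda>n. {a \<in> vanishing_ideal (E n). e - a \<in> vanishing_ideal (F n)})"
  have "\<exists>p. module_form C p \<and> (\<forall>a\<in>S n. (\<delta> * real n)\<^sup>2 \<le> Re (p a a))" for n
  proof -
    have "convex (S n)"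
    proof (rule convexI)
      fix a b and s t :: real assume ab: "a \<in> S n" "b \<in> S n" and st: "0 \<le> s" "0 \<le> t" "s + t = 1"
      have lin: "\<phi> (s *\<^sub>R x + t *\<^sub>R y) = of_real s * \<phi> x + of_real t * \<phi> y" if "\<phi> \<in> characters" for \<phi> x y
        using that unfolding characters_def by (simp flip: scaleC_of_real)
      have eq: "e - (s *\<^sub>R a + t *\<^sub>R b) = s *\<^sub>R (e - a) + t *\<^sub>R (e - b)"
        using scaleR_add_left[of s t e] st by (simp add: algebra_simps)
      have "\<phi> (s *\<^sub>R a + t *\<^sub>R b) = 0" if "\<phi> \<in> E n" for \<phi>
      proof -
        have "\<phi> a = 0" "\<phi> b = 0" using ab that unfolding S_def vanishing_ideal_def by blast+
        then show ?thesis using lin[OF subsetD[OF chE that], of a b] by simp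
      qed
      moreover have "\<phi> (e - (s *\<^sub>R a + t *\<^sub>R b)) = 0" if "\<phi> \<in> F n" for \<phi>
      proof -
        have "\<phi> (e - a) = 0" "\<phi> (e - b) = 0" using ab that unfolding S_def vanishing_ideal_def by blast+
        then show ?thesis unfolding eq using lin[OF subsetD[OF chF that], of "e - a" "e - b"] by simp
      qed
      ultimately show "s *\<^sub>R a + t *\<^sub>R b \<in> S n" by (simp add: S_def vanishing_ideal_def)
    qed
    moreover have "S n \<noteq> {}" using regular_imp_normal[OF e reg E F EF] by (auto simp: S_def)
    moreover have "\<exists>q\<in>P. (\<delta> * real n)\<^sup>2 < Re (q a a)" if a: "a \<in> S n" for a
    proof (rule ccontr)
      assume "\<not> ?thesis"
      \<comment> \<open>If no form in \<open>P\<close> exceeded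
        \<open>(\<delta> * real n)\<^sup>2\<close> at \<open>a\<close>, then \<open>lower\<close>
        would bound \<open>norm a\<close> by \<open>n\<close>, contrary to the choice of
        \<open>E n\<close> and \<open>F n\<close>.\<close>
      then have "\<delta> * norm a \<le> \<delta> * real n" using \<delta> by (intro lower) (auto simp: not_less)
      then show False using big[of a n] a \<delta> by (simp add: S_def)
    qed
    ultimately show ?thesis using minimax_module_form[OF P] by metis
  qed
  then obtain p where p: "\<And>n. module_form C (p n)" and pS: "\<And>n a. a \<in> S n \<Longrightarrow> (\<delta> * real n)\<^sup>2 \<le> Re (p n a a)"
    by metis
  have "form_sequence p \<bar>C\<bar>"
    using p by unfold_locales (auto simp: module_form_def power_mult_distrib)
  then obtain B where B: "\<And>n. \<exists>a\<in>vanishing_ideal (E n). e - a \<in> vanishing_ideal (F n) \<and> sqrt (Re (p n a a)) \<le> B"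
    using form_sequence.total_reduction_bound[OF _ trp e, of p "\<bar>C\<bar>" "\<lambda>n. vanishing_ideal (E n)" "\<lambda>n. vanishing_ideal (F n)"]
      algebra_ideal_vanishing_ideal[OF chE] algebra_ideal_vanishing_ideal[OF chF] regular_imp_normal[OF e reg E F EF] by metis
  have bound: "\<delta> * real n \<le> B" for n
  proof -
    obtain a where a: "a \<in> S n" "sqrt (Re (p n a a)) \<le> B" using B[of n] by (auto simp: S_def)
    have "\<delta> * real n \<le> sqrt (Re (p n a a))" using pS[OF a(1)] \<delta> by (intro real_le_rsqrt) auto
    then show ?thesis using a(2) by linarith
  qed
  obtain n :: nat where "B / \<delta> < real n" using reals_Archimedean2 by blast
  then show False using bound[of n] \<delta> by (simp add: field_simps)
qed

text \<open>Averaging the separating elements for the disjoint level sets \<open>u \<le> j/n\<close> and \<open>u \<ge> (j+1)/n\<close>, at each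
  character only one summand is uncontrolled.\<close>

lemma staircase_approximation:
  fixes e :: "'a::{complex_banach_algebra, comm_ring}" and u :: "('a \<Rightarrow> complex) \<Rightarrow> real"
  assumes e: "\<And>x. e * x = x"
    and K: "\<And>E F :: ('a \<Rightarrow> complex) set. closedin maximal_ideal_space E \<Longrightarrow> closedin maximal_ideal_space F \<Longrightarrow> E \<inter> F = {} \<Longrightarrow>
      \<exists>a\<in>vanishing_ideal E. e - a \<in> vanishing_ideal F \<and> norm a \<le> K"
    and u: "continuous_map maximal_ideal_space euclideanreal u" "\<And>\<phi>. \<phi> \<in> characters \<Longrightarrow> 0 \<le> u \<phi> \<and> u \<phi> \<le> 1"
    and n: "0 < n"
  shows "\<exists>a. norm a \<le> K \<and> (\<forall>\<phi>\<in>characters. cmod (\<phi> a - of_real (u \<phi>)) \<le> (K + 1) / real n)"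
proof -
  let ?X = "maximal_ideal_space :: ('a \<Rightarrow> complex) topology"
  have top: "topspace ?X = characters" by (simp add: maximal_ideal_space_def)
  define E where "E = (\<lambda>j::nat. {\<phi> \<in> topspace ?X. u \<phi> \<in> {..real j / real n}})"
  define F where "F = (\<lambda>j::nat. {\<phi> \<in> topspace ?X. u \<phi> \<in> {real (Suc j) / real n..}})"
  have cl: "closedin ?X (E j)" "closedin ?X (F j)" for j
    unfolding E_def F_def by (rule closedin_continuous_map_preimage[OF u(1)]; simp)+
  have disj: "E j \<inter> F j = {}" for j
  proof -
    have "real j / real n < real (Suc j) / real n" using n by (intro divide_strict_right_mono) auto
    then show ?thesis unfolding E_def F_def by fastforce
  qed
  have "\<forall>j. \<exists>a. a \<in> vanishing_ideal (E j) \<and> e - a \<in> vanishing_ideal (F j) \<and> norm a \<le> K"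
    using K[OF cl disj] by blast
  then obtain f where f: "\<And>j. f j \<in> vanishing_ideal (E j)" "\<And>j. e - f j \<in> vanishing_ideal (F j)" "\<And>j. norm (f j) \<le> K"
    by metis
  define a where "a = (1 / real n) *\<^sub>R (\<Sum>j<n. f j)"
  have K0: "0 \<le> K" using f(3)[of 0] norm_ge_zero order_trans by blast
  have "norm a = (1 / real n) * norm (\<Sum>j<n. f j)" using n by (simp add: a_def)
  also have "\<dots> \<le> (1 / real n) * (real n * K)"
    using sum_norm_le[of "{..<n}" f "\<lambda>_. K"] f(3) n by (intro mult_left_mono) auto
  finally have na: "norm a \<le> K" using n by simp
  have "cmod (\<phi> a - of_real (u \<phi>)) \<le> (K + 1) / real n" if \<phi>: "\<phi> \<in> characters" for \<phi>
  proof -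
    have add: "\<phi> (x + y) = \<phi> x + \<phi> y" and mult: "\<phi> (x * y) = \<phi> x * \<phi> y" and sc: "\<phi> (scaleC c x) = c * \<phi> x" for x y c
      using \<phi> by (auto simp: characters_def)
    have \<phi>0: "\<phi> 0 = 0" using add[of 0 0] by simp
    obtain x where "\<phi> x \<noteq> 0" using \<phi> by (auto simp: characters_def)
    then have \<phi>e: "\<phi> e = 1" using mult[of e x] e[of x] by simp
    have \<phi>sum: "\<phi> (\<Sum>j\<in>A. f j) = (\<Sum>j\<in>A. \<phi> (f j))" if "finite A" for A
      using that by (induction A rule: finite_induct) (auto simp: \<phi>0 add)
    have \<phi>a: "\<phi> a = of_real (1 / real n) * (\<Sum>j<n. \<phi> (f j))"
      unfolding a_def scaleC_of_real[symmetric] sc by (simp add: \<phi>sum)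
    \<comment> \<open>At \<open>\<phi>\<close> the summands with \<open>j < m\<close> take the value
      \<open>1\<close>, those with \<open>j > m\<close> the value \<open>0\<close>, and the one with
      \<open>j = m\<close> causes an error of at most \<open>K\<close>. Rounding
      \<open>real n * u \<phi>\<close> down to \<open>m\<close> costs at most \<open>1\<close>,
      whence \<open>K + 1\<close>. For \<open>u \<phi> = 1\<close> one has \<open>m = n\<close>, and
      no summand is uncontrolled.\<close>
    define m where "m = nat \<lfloor>real n * u \<phi>\<rfloor>"
    have nu: "0 \<le> real n * u \<phi>" "real n * u \<phi> \<le> real n * 1" using u(2)[OF \<phi>] n by (auto intro: mult_left_mono)
    have m: "real m \<le> real n * u \<phi>" "real n * u \<phi> < real m + 1" using nu by (auto simp: m_def)
    then have mn: "m \<le> n" using nu by (metis mult.right_neutral of_nat_le_iff order_trans)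
    have step: "cmod (\<phi> (f j) - (if j < m then 1 else 0)) \<le> (if j = m then K else 0)" for j
    proof (cases j m rule: linorder_cases)
      case less
      then have "real (Suc j) \<le> real m" by simp
      then have "real (Suc j) / real n \<le> u \<phi>" using m n by (simp add: pos_divide_le_eq mult.commute)
      then have "\<phi> (e - f j) = 0" using f(2)[of j] \<phi> by (simp add: F_def vanishing_ideal_def top)
      moreover have "\<phi> (e - f j) + \<phi> (f j) = 1" using \<phi>e by (simp flip: add)
      ultimately show ?thesis using less by simp
    next
      case equal
      then show ?thesis using character_bounded[OF \<phi>, of "f j"] f(3)[of j] by simp
    next
      case greater
      then have "real m + 1 \<le> real j" by simp
      then have "u \<phi> \<le> real j / real n" using m n by (simp add: pos_le_divide_eq mult.commute)
      then have "\<phi> (f j) = 0" using f(1)[of j] \<phi> by (simp add: E_def vanishing_ideal_def top)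
      then show ?thesis using greater by simp
    qed
    have c: "(\<Sum>j<n. if j < m then 1 else 0 :: complex) = of_nat m"
    proof -
      have "{..<n} \<inter> {j. j < m} = {..<m}" using mn by auto
      then show ?thesis by (simp add: sum.If_cases)
    qed
    have "cmod ((\<Sum>j<n. \<phi> (f j)) - of_nat m) \<le> (\<Sum>j<n. if j = m then K else 0)"
      unfolding c[symmetric] sum_subtractf[symmetric] by (rule sum_norm_le) (rule step)
    also have "\<dots> \<le> K" using K0 by simp
    finally have "cmod ((\<Sum>j<n. \<phi> (f j)) - of_nat m) \<le> K" .
    moreover have "cmod (of_nat m - of_real (real n * u \<phi>)) \<le> 1"
    proof -
      have "of_nat m - complex_of_real (real n * u \<phi>) = of_real (real m - real n * u \<phi>)" by simp
      then have "cmod (of_nat m - of_real (real n * u \<phi>)) = \<bar>real m - real n * u \<phi>\<bar>" by (simp only: norm_of_real)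
      then show ?thesis using m by simp
    qed
    ultimately have "cmod ((\<Sum>j<n. \<phi> (f j)) - of_real (real n * u \<phi>)) \<le> K + 1"
      using norm_triangle_ineq[of "(\<Sum>j<n. \<phi> (f j)) - of_nat m" "of_nat m - of_real (real n * u \<phi>)"] by simp
    moreover have "\<phi> a - of_real (u \<phi>) = of_real (1 / real n) * ((\<Sum>j<n. \<phi> (f j)) - of_real (real n * u \<phi>))"
      using n by (simp add: \<phi>a right_diff_distrib)
    then have "cmod (\<phi> a - of_real (u \<phi>)) = (1 / real n) * cmod ((\<Sum>j<n. \<phi> (f j)) - of_real (real n * u \<phi>))"
      using n by (simp only: norm_mult norm_of_real) simp
    ultimately show ?thesis using n by (simp add: divide_right_mono)
  qed
  then show ?thesis using na by blast
qed

lemma continuous_map_evaluation: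
  "continuous_map maximal_ideal_space euclidean (\<lambda>\<phi>. \<phi> a)"
  unfolding maximal_ideal_space_def
  by (intro continuous_map_from_subtopology continuous_map_product_projection) simp

text \<open>A function bounded by \<open>s\<close> is \<open>s\<close> times a combination of four
  functions with values in \<open>[0, 1]\<close>, from the positive and negative parts of its real
  and imaginary parts. Staircases approximate these, and iteration removes the error. The norm bound
  is what later makes the inverse of the Gelfand transform continuous.\<close>

theorem gelfand_surjective:
  fixes e :: "'a::{complex_banach_algebra, comm_ring}"
  assumes e: "\<And>x. e * x = x"
    and K: "\<And>E F :: ('a \<Rightarrow> complex) set. closedin maximal_ideal_space E \<Longrightarrow> closedin maximal_ideal_space F \<Longrightarrow> E \<inter> F = {} \<Longrightarrow>
      \<exists>a\<in>vanishing_ideal E. e - a \<in> vanishing_ideal F \<and> norm a \<le> K"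
  shows "\<exists>M\<ge>0. \<forall>g s. continuous_map maximal_ideal_space euclidean g \<longrightarrow> 0 \<le> s \<longrightarrow> (\<forall>\<phi>\<in>characters. cmod (g \<phi>) \<le> s) \<longrightarrow>
    (\<exists>a::'a. norm a \<le> M * s \<and> (\<forall>\<phi>\<in>characters. \<phi> a = g \<phi>))"
proof -
  let ?X = "maximal_ideal_space :: ('a \<Rightarrow> complex) topology"
  let ?Ch = "characters :: ('a \<Rightarrow> complex) set"
  have top: "topspace ?X = ?Ch" by (simp add: maximal_ideal_space_def)
  obtain a0 :: 'a where "norm a0 \<le> K" using K[OF closedin_empty closedin_empty] by blast
  then have K0: "0 \<le> K" using norm_ge_zero[of a0] by linarith
  \<comment> \<open>Continuous functions on the characters are extended by zero to the whole type,
    so that they form a subspace of the bounded functions with the supremum norm.\<close>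
  define D where "D = {h :: ('a \<Rightarrow> complex) discrete \<Rightarrow>\<^sub>C complex.
    continuous_map ?X euclidean (\<lambda>\<phi>. apply_bcontfun h (discrete \<phi>)) \<and> (\<forall>\<phi>. \<phi> \<notin> ?Ch \<longrightarrow> apply_bcontfun h (discrete \<phi>) = 0)}"
  note pw = plus_bcontfun.rep_eq scaleR_bcontfun.rep_eq minus_bcontfun.rep_eq zero_bcontfun.rep_eq
  have D: "subspace D"
  proof (rule subspaceI)
    show "0 \<in> D" by (simp add: D_def pw)
    show "x + y \<in> D" if "x \<in> D" "y \<in> D" for x y
      using that by (auto simp: D_def pw intro: continuous_map_add)
    show "c *\<^sub>R x \<in> D" if x: "x \<in> D" for c x
    proof -
      have "continuous_map euclidean euclidean (\<lambda>z::complex. c *\<^sub>R z)"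
        unfolding continuous_map_iff_continuous2 by (intro continuous_intros)
      from continuous_map_compose[OF _ this] show ?thesis using x by (auto simp: D_def pw o_def)
    qed
  qed
  define T where "T = (\<lambda>a :: 'a. bounded_fun (\<lambda>\<phi>. if \<phi> \<in> ?Ch then \<phi> a else 0))"
  have T: "apply_bcontfun (T a) (discrete \<phi>) = (if \<phi> \<in> ?Ch then \<phi> a else 0)" for a \<phi>
    unfolding T_def by (rule apply_bounded_fun) (auto intro!: boundedI[of _ "norm a"] simp: character_bounded)
  have norm_le: "norm h \<le> b" if "\<And>\<phi>. cmod (apply_bcontfun h (discrete \<phi>)) \<le> b" for h :: "('a \<Rightarrow> complex) discrete \<Rightarrow>\<^sub>C complex" and b
    by (rule norm_bound) (metis that of_discrete_inverse)
  have Tlin: "bounded_linear T"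
  proof (rule bounded_linear_intro[of _ 1])
    show "T (a + b) = T a + T b" for a b
      by (rule bounded_fun_eqI) (auto simp: T pw characters_def)
    show "T (r *\<^sub>R a) = r *\<^sub>R T a" for r a
      by (rule bounded_fun_eqI) (auto simp: T pw characters_def scaleR_conv_of_real simp flip: scaleC_of_real)
    show "norm (T a) \<le> norm a * 1" for a
      by (rule norm_le) (auto simp: T character_bounded)
  qed
  have TD: "range T \<subseteq> D"
  proof -
    have "continuous_map ?X euclidean (\<lambda>\<phi>. if \<phi> \<in> ?Ch then \<phi> a else 0)" for a
      by (rule continuous_map_eq[OF continuous_map_evaluation[of a]]) (simp add: top)
    then show ?thesis by (auto simp: D_def T)
  qed
  \<comment> \<open>Four staircase errors of at most \<open>(K + 1) / n\<close>, relative to the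
    norm of \<open>h\<close>, have to add up to at most \<open>1 / 2\<close>.\<close>
  define n where "n = nat \<lceil>8 * (K + 1)\<rceil>"
  have n: "8 * (K + 1) \<le> real n" unfolding n_def by linarith
  then have n0: "0 < n" using K0 by (cases n) auto
  define M where "M = 4 * K"
  have approx: "\<exists>a\<in>UNIV. norm a \<le> M * norm h \<and> norm (h - T a) \<le> norm h / 2" if h: "h \<in> D" for h
  proof (cases "h = 0")
    case True
    then show ?thesis using bounded_linear.linear[OF Tlin] linear_0 by (intro bexI[of _ 0]) auto
  next
    case False
    define s where "s = norm h"
    have s: "s > 0" using False by (simp add: s_def)
    define g where "g = (\<lambda>\<phi>. apply_bcontfun h (discrete \<phi>))"
    have g: "continuous_map ?X euclidean g" "\<And>\<phi>. \<phi> \<notin> ?Ch \<Longrightarrow> g \<phi> = 0" using h by (auto simp: D_def g_def)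
    have gs: "cmod (g \<phi>) \<le> s" for \<phi> unfolding g_def s_def by (rule norm_bounded)
    have part: "\<exists>a. norm a \<le> K \<and> (\<forall>\<phi>\<in>?Ch. cmod (\<phi> a - of_real (max 0 (w (g \<phi>)) / s)) \<le> (K + 1) / real n)"
      if w: "continuous_on UNIV w" "\<And>z. w z \<le> cmod z" for w :: "complex \<Rightarrow> real"
    proof (rule staircase_approximation[OF e K _ _ n0])
      have "continuous_map euclidean euclideanreal (\<lambda>z. max 0 (w z) / s)"
        unfolding continuous_map_iff_continuous2 using w(1) s by (auto intro!: continuous_intros)
      from continuous_map_compose[OF g(1) this]
      show "continuous_map ?X euclideanreal (\<lambda>\<phi>. max 0 (w (g \<phi>)) / s)" by (simp add: o_def)
      show "0 \<le> max 0 (w (g \<phi>)) / s \<and> max 0 (w (g \<phi>)) / s \<le> 1" for \<phi>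
        using w(2)[of "g \<phi>"] gs[of \<phi>] s by simp
    qed
    have wRe: "Re z \<le> cmod z" "- Re z \<le> cmod z" "Im z \<le> cmod z" "- Im z \<le> cmod z" for z
      using abs_Re_le_cmod[of z] abs_Im_le_cmod[of z] by linarith+
    have cont: "continuous_on UNIV Re" "continuous_on UNIV (\<lambda>z. - Re z)" "continuous_on UNIV Im" "continuous_on UNIV (\<lambda>z. - Im z)"
      by (intro continuous_intros)+
    define \<epsilon> where "\<epsilon> = (K + 1) / real n"
    obtain a1 where a1: "norm a1 \<le> K" "\<And>\<phi>. \<phi> \<in> ?Ch \<Longrightarrow> cmod (\<phi> a1 - of_real (max 0 (Re (g \<phi>)) / s)) \<le> \<epsilon>"
      using part[OF cont(1) wRe(1)] unfolding \<epsilon>_def by blast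
    obtain a2 where a2: "norm a2 \<le> K" "\<And>\<phi>. \<phi> \<in> ?Ch \<Longrightarrow> cmod (\<phi> a2 - of_real (max 0 (- Re (g \<phi>)) / s)) \<le> \<epsilon>"
      using part[OF cont(2) wRe(2)] unfolding \<epsilon>_def by blast
    obtain a3 where a3: "norm a3 \<le> K" "\<And>\<phi>. \<phi> \<in> ?Ch \<Longrightarrow> cmod (\<phi> a3 - of_real (max 0 (Im (g \<phi>)) / s)) \<le> \<epsilon>"
      using part[OF cont(3) wRe(3)] unfolding \<epsilon>_def by blast
    obtain a4 where a4: "norm a4 \<le> K" "\<And>\<phi>. \<phi> \<in> ?Ch \<Longrightarrow> cmod (\<phi> a4 - of_real (max 0 (- Im (g \<phi>)) / s)) \<le> \<epsilon>"
      using part[OF cont(4) wRe(4)] unfolding \<epsilon>_def by blast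
    define a where "a = s *\<^sub>R (a1 - a2 + scaleC \<i> (a3 - a4))"
    have "norm (a1 - a2 + scaleC \<i> (a3 - a4)) \<le> 4 * K"
      using norm_triangle_ineq[of "a1 - a2" "scaleC \<i> (a3 - a4)"] norm_triangle_ineq4[of a1 a2]
        norm_triangle_ineq4[of a3 a4] a1(1) a2(1) a3(1) a4(1) by (simp add: norm_scaleC)
    then have na: "norm a \<le> M * norm h" using s by (simp add: a_def M_def flip: s_def)
    have "cmod (apply_bcontfun (h - T a) (discrete \<phi>)) \<le> s / 2" for \<phi>
    proof (cases "\<phi> \<in> ?Ch")
      case True
      have add: "\<phi> (x + y) = \<phi> x + \<phi> y" and sc: "\<phi> (scaleC c x) = c * \<phi> x" for x y c
        using True by (auto simp: characters_def)
      have diff: "\<phi> (x - y) = \<phi> x - \<phi> y" for x y using add[of "x - y" y] by simp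
      define d1 d2 d3 d4 where "d1 = \<phi> a1 - of_real (max 0 (Re (g \<phi>)) / s)"
        and "d2 = \<phi> a2 - of_real (max 0 (- Re (g \<phi>)) / s)"
        and "d3 = \<phi> a3 - of_real (max 0 (Im (g \<phi>)) / s)"
        and "d4 = \<phi> a4 - of_real (max 0 (- Im (g \<phi>)) / s)"
      have split: "g \<phi> = of_real s * (of_real (max 0 (Re (g \<phi>)) / s) - of_real (max 0 (- Re (g \<phi>)) / s)
          + \<i> * (of_real (max 0 (Im (g \<phi>)) / s) - of_real (max 0 (- Im (g \<phi>)) / s)))"
        using s by (simp add: complex_eq_iff max_def)
      have "\<phi> a = of_real s * (\<phi> a1 - \<phi> a2 + \<i> * (\<phi> a3 - \<phi> a4))"
        unfolding a_def scaleC_of_real[symmetric] by (simp add: add sc diff)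
      then have "g \<phi> - \<phi> a = - of_real s * (d1 - d2 + \<i> * (d3 - d4))"
        by (subst split) (simp only: d1_def d2_def d3_def d4_def ring_distribs mult_minus_left, simp)
      then have "cmod (g \<phi> - \<phi> a) = s * cmod (d1 - d2 + \<i> * (d3 - d4))" using s by (simp add: norm_mult)
      also have "cmod (d1 - d2 + \<i> * (d3 - d4)) \<le> 4 * \<epsilon>"
        using norm_triangle_ineq[of "d1 - d2" "\<i> * (d3 - d4)"] norm_triangle_ineq4[of d1 d2] norm_triangle_ineq4[of d3 d4]
          a1(2)[OF True] a2(2)[OF True] a3(2)[OF True] a4(2)[OF True]
        unfolding d1_def[symmetric] d2_def[symmetric] d3_def[symmetric] d4_def[symmetric] by (simp add: norm_mult)
      also have "4 * \<epsilon> \<le> 1 / 2" using n n0 by (simp add: \<epsilon>_def field_simps)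
      finally show ?thesis using s True by (simp add: pw T g_def mult_left_mono)
    next
      case False
      then show ?thesis using g(2)[OF False] s by (simp add: pw T g_def)
    qed
    then have "norm (h - T a) \<le> norm h / 2" unfolding s_def by (rule norm_le)
    then show ?thesis using na by blast
  qed
  have "\<exists>a. norm a \<le> (2 * M) * s \<and> (\<forall>\<phi>\<in>?Ch. \<phi> a = g \<phi>)"
    if g: "continuous_map ?X euclidean g" and s: "0 \<le> s" and gs: "\<forall>\<phi>\<in>?Ch. cmod (g \<phi>) \<le> s" for g s
  proof -
    define h where "h = bounded_fun (\<lambda>\<phi>. if \<phi> \<in> ?Ch then g \<phi> else 0)"
    have h: "apply_bcontfun h (discrete \<phi>) = (if \<phi> \<in> ?Ch then g \<phi> else 0)" for \<phi>
      unfolding h_def by (rule apply_bounded_fun) (use gs s in \<open>auto intro!: boundedI[of _ s]\<close>)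
    have "norm h \<le> s" by (rule norm_le) (use gs s in \<open>auto simp: h\<close>)
    have "continuous_map ?X euclidean (\<lambda>\<phi>. if \<phi> \<in> ?Ch then g \<phi> else 0)"
      by (rule continuous_map_eq[OF g]) (simp add: top)
    then have hD: "h \<in> D" by (simp add: D_def h)
    obtain a where a: "T a = h" "norm a \<le> 2 * M * norm h"
      by (rule approximate_solution_imp_solution[OF Tlin closed_UNIV subspace_UNIV D TD approx hD])
    have "2 * M * norm h \<le> 2 * M * s" using \<open>norm h \<le> s\<close> K0 by (intro mult_left_mono) (auto simp: M_def)
    moreover have "\<phi> a = g \<phi>" if "\<phi> \<in> ?Ch" for \<phi> using T[of a \<phi>] h[of \<phi>] that by (simp add: a)
    ultimately show ?thesis using a(2) by (intro exI[of _ a]) auto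
  qed
  moreover have "0 \<le> 2 * M" using K0 by (simp add: M_def)
  ultimately show ?thesis by blast
qed

theorem theorem4p2p10:
  assumes "unital_algebra TYPE('a::{complex_banach_algebra, comm_ring})"
    and "semisimple_algebra TYPE('a)"
    and "regular_algebra TYPE('a)"
    and "operator_algebra TYPE('a) TYPE('h)"
    and "total_reduction_property TYPE('a) TYPE((nat + 'a + 'h) set set)"
  shows "isomorphic_to_C TYPE('a) (maximal_ideal_space :: ('a \<Rightarrow> complex) topology)"
proof -
  let ?X = "maximal_ideal_space :: ('a \<Rightarrow> complex) topology"
  let ?Ch = "characters :: ('a \<Rightarrow> complex) set"
  let ?G = "gelfand_transform :: 'a \<Rightarrow> ('a \<Rightarrow> complex) \<Rightarrow> complex"
  let ?m = "cfunspace ?X (euclidean_metric :: complex metric)"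
  have top: "topspace ?X = ?Ch" by (simp add: maximal_ideal_space_def)
  obtain e :: 'a where e: "\<And>x. e * x = x" using assms(1) unfolding unital_algebra_def by blast
  obtain K where K: "\<forall>E F :: ('a \<Rightarrow> complex) set. closedin ?X E \<longrightarrow> closedin ?X F \<longrightarrow> E \<inter> F = {} \<longrightarrow>
      (\<exists>a\<in>vanishing_ideal E. e - a \<in> vanishing_ideal F \<and> norm a \<le> K)"
    using bounded_normality[OF e assms(3-5)] by (rule exE)
  obtain M where M: "0 \<le> M" "\<forall>g s. continuous_map ?X euclidean g \<longrightarrow> 0 \<le> s \<longrightarrow> (\<forall>\<phi>\<in>?Ch. cmod (g \<phi>) \<le> s) \<longrightarrow>
    (\<exists>a::'a. norm a \<le> M * s \<and> (\<forall>\<phi>\<in>?Ch. \<phi> a = g \<phi>))"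
    using gelfand_surjective[OF e K[rule_format]] by blast
  have G: "?G a \<phi> = \<phi> a" if "\<phi> \<in> ?Ch" for a \<phi> using that by (simp add: gelfand_transform_def)
  have inj: "inj ?G" using assms(2) by (simp add: semisimple_algebra_def)
  have eqI: "a = b" if "\<And>\<phi>. \<phi> \<in> ?Ch \<Longrightarrow> \<phi> a = \<phi> b" for a b
    using that by (intro injD[OF inj] ext) (auto simp: gelfand_transform_def restrict_def)
  have ch_diff: "\<phi> (a - b) = \<phi> a - \<phi> b" if "\<phi> \<in> ?Ch" for \<phi> a b
  proof -
    have "\<phi> ((a - b) + b) = \<phi> (a - b) + \<phi> b" using that unfolding characters_def by blast
    then show ?thesis by simp
  qed
  have mem: "f \<in> mspace ?m \<longleftrightarrow> f \<in> extensional ?Ch \<and> bounded (f ` ?Ch) \<and> continuous_map ?X euclidean f" for f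
    by (auto simp: top)
  have Gm: "?G a \<in> mspace ?m" for a
    unfolding mem
  proof (intro conjI)
    show "?G a \<in> extensional ?Ch" by (simp add: gelfand_transform_def)
    show "bounded (?G a ` ?Ch)" by (auto intro!: boundedI[of _ "norm a"] simp: G character_bounded)
    show "continuous_map ?X euclidean (?G a)"
      by (rule continuous_map_eq[OF continuous_map_evaluation[of a]]) (simp add: top G)
  qed
  have surj: "\<exists>a. ?G a = f" if f: "f \<in> mspace ?m" for f
  proof -
    obtain s where s: "s > 0" "\<And>\<phi>. \<phi> \<in> ?Ch \<Longrightarrow> cmod (f \<phi>) \<le> s"
      using f unfolding mem bounded_pos by blast
    obtain a where a: "\<forall>\<phi>\<in>?Ch. \<phi> a = f \<phi>" using M(2)[rule_format, of f s] f s unfolding mem by auto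
    have "f \<in> extensional ?Ch" using f unfolding mem by blast
    then have "?G a = f" using a by (intro extensionalityI[of _ ?Ch]) (auto simp: gelfand_transform_def)
    then show ?thesis by blast
  qed
  define S where "S = inv_into UNIV ?G"
  have GS: "?G (S f) = f" if "f \<in> mspace ?m" for f
    using surj[OF that] unfolding S_def by (metis f_inv_into_f rangeI)
  have "Lipschitz_continuous_map euclidean_metric ?m ?G"
    unfolding Lipschitz_continuous_map_def
  proof (intro conjI exI[of _ 1] ballI)
    show "?G \<in> mspace euclidean_metric \<rightarrow> mspace ?m" using Gm by blast
    fix a b :: 'a
    show "mdist ?m (?G a) (?G b) \<le> 1 * mdist euclidean_metric a b"
      by (rule mdist_cfunspace_le)
         (use character_bounded[of _ "a - b"] in \<open>auto simp: top G dist_norm ch_diff\<close>)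
  qed
  then have "continuous_map euclidean (mtopology_of ?m) ?G"
    using Lipschitz_continuous_imp_continuous_map by fastforce
  \<comment> \<open>The difference \<open>f - g\<close> has a preimage of norm at most
    \<open>M\<close> times its supremum, and by injectivity this preimage is
    \<open>S f - S g\<close>.\<close>
  moreover have "Lipschitz_continuous_map ?m euclidean_metric S"
    unfolding Lipschitz_continuous_map_def
  proof (intro conjI exI[of _ M] ballI)
    show "S \<in> mspace ?m \<rightarrow> mspace euclidean_metric" by simp
    fix f g assume f: "f \<in> mspace ?m" and g: "g \<in> mspace ?m"
    define s where "s = mdist ?m f g"
    have s: "0 \<le> s" by (simp add: s_def)
    have "cmod (f \<phi> - g \<phi>) \<le> s" if "\<phi> \<in> ?Ch" for \<phi>
      using mdist_cfunspace_imp_mdist_le[OF f g order_refl, of \<phi>] that by (simp add: top s_def dist_norm)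
    moreover have "continuous_map ?X euclidean (\<lambda>\<phi>. f \<phi> - g \<phi>)"
      using f g unfolding mem by (intro continuous_map_diff) auto
    ultimately obtain a where a: "norm a \<le> M * s" "\<forall>\<phi>\<in>?Ch. \<phi> a = f \<phi> - g \<phi>"
      using M(2)[rule_format, of "\<lambda>\<phi>. f \<phi> - g \<phi>" s] s by blast
    have "S f - S g = a"
    proof (rule eqI)
      fix \<phi> assume \<phi>: "\<phi> \<in> ?Ch"
      show "\<phi> (S f - S g) = \<phi> a"
        using G[OF \<phi>, of "S f"] G[OF \<phi>, of "S g"] GS[OF f] GS[OF g] bspec[OF a(2) \<phi>] \<phi> by (simp add: ch_diff)
    qed
    then show "mdist euclidean_metric (S f) (S g) \<le> M * mdist ?m f g" using a(1) by (simp add: dist_norm s_def)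
  qed
  then have "continuous_map (mtopology_of ?m) euclidean S"
    using Lipschitz_continuous_imp_continuous_map by fastforce
  moreover have "S (?G a) = a" for a using inj by (simp add: S_def)
  ultimately have "homeomorphic_maps euclidean (mtopology_of ?m) ?G S"
    unfolding homeomorphic_maps_def using GS by simp
  then have "homeomorphic_map euclidean (mtopology_of ?m) ?G" by (rule homeomorphic_maps_imp_map)
  moreover have "?G (a + b) \<phi> = ?G a \<phi> + ?G b \<phi>" "?G (scaleC c a) \<phi> = c * ?G a \<phi>" "?G (a * b) \<phi> = ?G a \<phi> * ?G b \<phi>"
    if "\<phi> \<in> topspace ?X" for a b c \<phi>
    using that G by (auto simp: top characters_def)
  ultimately show ?thesis unfolding isomorphic_to_C_def by (intro exI[of _ ?G]) blast
qed

end
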